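(* Let $q$ be a complex number with $|q|<1$, let $P(q)=1-24\sum_{j\ge1}\frac{jq^j}{1-q^j}$, and let $$z=\prod_{j=1}^\infty\frac{(1-q^j)^4(1-q^{3j})^4}{(1-q^{2j})^2(1-q^{6j})^2},\qquad y=q\prod_{j=1}^\infty\frac{(1-q^{2j})^6(1-q^{6j})^6}{(1-q^j)^6(1-q^{3j})^6}.$$ Let $u(n)=\sum_{j=0}^n\binom nj^2\binom{2j}j\binom{2n-2j}{n-j}$ (the Domb numbers). Put $Z^*=(1+16y)z$ and $x^*=\frac{y}{1+16y}$. Then in a neighborhood of $q=0$, $$Z^*=\tfrac12\bigl(3P(q^3)-P(q)\bigr)=\sum_{n=0}^\infty v(n)(x^* )^n=\sum_{n=0}^\infty(-1)^nu(n)\frac{(x^* )^n}{(1-16x^* )^{n+1}}=\sum_{n=0}^\infty\binom{3n}n\binom{2n}n^2(x^* )^n(1-16x^* )^{2n},$$ where the coefficients $v(n)$ of the expansion of $Z^*$ in powers of $x^*$ satisfy, for $n\ge0$, $$(n+1)^3v(n+1)=(2n+1)(22n^2+22n+12)v(n)-128n(5n^2+1)v(n-1)+1536n(n-1)(2n-1)v(n-2).$$ *)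

theory Defs
  imports "HOL-Analysis.Analysis"
begin

text \<open>Sums and products over \<open>j \<ge> 1\<close> are written with index \<open>Suc j\<close>. The functions below are
  meaningful for \<open>norm q < 1\<close>, where all the sums and products converge.\<close>

definition eisP :: "complex \<Rightarrow> complex" where
  "eisP q = 1 - 24 * (\<Sum>j. of_nat (Suc j) * q ^ Suc j / (1 - q ^ Suc j))"

definition z6 :: "complex \<Rightarrow> complex" where
  "z6 q = (\<Prod>j. ((1 - q ^ Suc j) ^ 4 * (1 - q ^ (3 * Suc j)) ^ 4)
              / ((1 - q ^ (2 * Suc j)) ^ 2 * (1 - q ^ (6 * Suc j)) ^ 2))"

definition y6 :: "complex \<Rightarrow> complex" where
  "y6 q = q * (\<Prod>j. ((1 - q ^ (2 * Suc j)) ^ 6 * (1 - q ^ (6 * Suc j)) ^ 6)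
                  / ((1 - q ^ Suc j) ^ 6 * (1 - q ^ (3 * Suc j)) ^ 6))"

definition domb :: "nat \<Rightarrow> nat" where
  "domb n = (\<Sum>j\<le>n. (n choose j) ^ 2 * ((2 * j) choose j) * ((2 * (n - j)) choose (n - j)))"

definition Zstar :: "complex \<Rightarrow> complex" where
  "Zstar q = (1 + 16 * y6 q) * z6 q"

definition xstar :: "complex \<Rightarrow> complex" where
  "xstar q = y6 q / (1 + 16 * y6 q)"

text \<open>The index subtractions in \<open>v (n - 1)\<close> and \<open>v (n - 2)\<close> are truncated; this is harmless, since
  the coefficient of \<open>v (n - 1)\<close> vanishes for \<open>n = 0\<close> and that of \<open>v (n - 2)\<close> for \<open>n = 0\<close> and \<open>n = 1\<close>.
  The coefficients themselves are computed in the complex numbers.\<close>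

definition v_recurrence :: "(nat \<Rightarrow> complex) \<Rightarrow> bool" where
  "v_recurrence v \<longleftrightarrow> (\<forall>n.
     (of_nat n + 1) ^ 3 * v (n + 1) =
       (2 * of_nat n + 1) * (22 * of_nat n ^ 2 + 22 * of_nat n + 12) * v n
       - 128 * of_nat n * (5 * of_nat n ^ 2 + 1) * v (n - 1)
       + 1536 * of_nat n * (of_nat n - 1) * (2 * of_nat n - 1) * v (n - 2))"

end

theory Submission
  imports Defs "HOL-Complex_Analysis.Complex_Analysis"
begin

text \<open>Let $S(x) = \frac{1+x}{2(1-x)} + \sum_{n \ge 1} \frac{q^n}{1-q^n}(x^n - x^{-n})$, a version of the Weierstrass
  zeta function. Its addition formula
  $(S(x) + S(y) - S(xy))^2 = S'(x) + S'(y) + S'(xy) + P(q)/4$ (with $S' = x \, dS/dx$) and the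
  Burgers-type equation $2 q \partial_q S = S'' - 2 S S'$ follow from the bilateral expansion of $S$.
  At sixth roots of unity they show that $r = S(e^{\pi i/3})$, $s = S(e^{2 \pi i/3})$ and $P$ generate a ring
  closed under $\theta = q\, d/dq$ that contains all $P(q^d)$ with $d$ dividing 6. Comparing logarithmic derivatives,
  $z = -4r(r-2s)$ and $yz = (r+s)(r-3s)/4$, hence $Z^* = -12 s^2$.

  For each of the pairs $(Z, X) = (z, y)$, $(Z^*, x^*)$, $(Z^*, x^*(1-16x^*)^2)$ there are polynomials $W$, $R$
  with $(\theta X / X)^2 = Z^2 W(X)$ and $2 Z \theta^2 Z - 3 (\theta Z)^2 = Z^4 R(X)$. If $Z = w(X)$, differentiating
  the resulting equation for $w$ once makes it linear: with $\delta = X\, d/dX$,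
  $2 W \delta^3 w + 3\, \delta W\, \delta^2 w + \delta^2 W\, \delta w = 2 R\, \delta w + \delta R\, w$.
  This is a recurrence for the coefficients of $w$, which identifies them in each case.\<close>

subsection \<open>The recurrence of the Domb numbers\<close>

text \<open>The classical route compares finitely many coefficients in a finite-dimensional space of
  modular forms. Differential algebra replaces it here: once z, yz and the P(q^d) are polynomials in
  r, s and P, each relation is a polynomial identity, and an eta quotient is recognised by its
  logarithmic derivative and leading coefficient. Why W and R exist: X has weight 0, so theta X / X
  is modular of weight 2. The derivative theta Z is only quasimodular, but 2 Z theta^2 Z - 3 (theta
  Z)^2 is, up to a factor, the second Rankin-Cohen bracket of the weight 2 form Z with itself, hence
  modular of weight 8, the weight of Z^4. In all three cases W(0) = 1 and R(0) = 0, so the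
  recurrence has leading coefficient 2 N^3 and the value w(0) = 1 fixes everything. The obstacle is
  convergence: the bilateral series lives on |q| < |x| < 1, whereas the roots of unity lie on the
  boundary. The identities reach them by radial limits, and q = 0 is checked separately.\<close>

definition domb_term :: "nat \<Rightarrow> nat \<Rightarrow> complex" where
  "domb_term j m = of_nat (((j + m) choose j) ^ 2 * ((2 * j) choose j) * ((2 * m) choose m))"

text \<open>The summand of the Domb number at n is \<open>domb_term j (n - j)\<close>. Taking j and
  m = n - j as independent indices exhibits the symmetry and turns a step in n at fixed j into a
  step in m.\<close>

lemma domb_term_commute: "domb_term j m = domb_term m j"
  using binomial_symmetric[of j "j + m"] by (simp add: domb_term_def add.commute)

lemma central_binomial_Suc:
  "of_nat (Suc m) * (of_nat ((2 * Suc m) choose Suc m) :: complex)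
     = 2 * (2 * of_nat m + 1) * of_nat ((2 * m) choose m)"
proof -
  have 1: "Suc m * ((2 * Suc m) choose Suc m) = (2 * Suc m) * (Suc (2 * m) choose m)"
    using Suc_times_binomial_eq[of "Suc (2 * m)" m] by (simp add: mult.commute)
  have 2: "Suc (2 * m) choose m = Suc (2 * m) choose Suc m"
    using binomial_symmetric[of m "Suc (2 * m)"] by simp
  have 3: "Suc m * (Suc (2 * m) choose Suc m) = Suc (2 * m) * ((2 * m) choose m)"
    using Suc_times_binomial_eq[of "2 * m" m] by (simp add: mult.commute)
  have "Suc m * ((2 * Suc m) choose Suc m) = 2 * (Suc (2 * m) * ((2 * m) choose m))"
    unfolding 1 2 mult.assoc 3 ..
  then have "(of_nat (Suc m * ((2 * Suc m) choose Suc m)) :: complex)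
      = of_nat (2 * (Suc (2 * m) * ((2 * m) choose m)))"
    by (rule arg_cong)
  then show ?thesis by (simp only: of_nat_mult) (simp add: algebra_simps)
qed

lemma domb_term_Suc_right:
  "(of_nat m + 1) ^ 3 * domb_term j (Suc m)
     = 2 * (of_nat j + of_nat m + 1) ^ 2 * (2 * of_nat m + 1) * domb_term j m"
proof -
  have "Suc m * ((j + Suc m) choose Suc m) = Suc (j + m) * ((j + m) choose m)"
    using Suc_times_binomial_eq[of "j + m" m] by (simp add: mult.commute)
  moreover have "(j + Suc m) choose Suc m = (j + Suc m) choose j" "(j + m) choose m = (j + m) choose j"
    using binomial_symmetric[of j "j + Suc m"] binomial_symmetric[of j "j + m"] by simp_all
  ultimately have "Suc m * ((j + Suc m) choose j) = Suc (j + m) * ((j + m) choose j)"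
    by simp
  then have "(of_nat (Suc m * ((j + Suc m) choose j)) :: complex) = of_nat (Suc (j + m) * ((j + m) choose j))"
    by (rule arg_cong)
  then have 1: "(of_nat m + 1) * (of_nat ((j + Suc m) choose j) :: complex)
      = (of_nat j + of_nat m + 1) * of_nat ((j + m) choose j)"
    by (simp only: of_nat_mult) (simp add: algebra_simps)
  have 2: "(of_nat m + 1) * (of_nat ((2 * Suc m) choose Suc m) :: complex)
      = 2 * (2 * of_nat m + 1) * of_nat ((2 * m) choose m)"
    using central_binomial_Suc[of m] by (simp add: algebra_simps)
  have "(of_nat m + 1) ^ 3 * domb_term j (Suc m)
      = ((of_nat m + 1) * of_nat ((j + Suc m) choose j)) ^ 2 * of_nat ((2 * j) choose j)
        * ((of_nat m + 1) * of_nat ((2 * Suc m) choose Suc m))"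
    unfolding domb_term_def of_nat_mult of_nat_power by (simp add: power2_eq_square power3_eq_cube)
  then show ?thesis unfolding 1 2
    unfolding domb_term_def of_nat_mult of_nat_power by (simp add: power2_eq_square)
qed

lemma domb_term_Suc_left:
  "(of_nat j + 1) ^ 3 * domb_term (Suc j) m
     = 2 * (of_nat j + of_nat m + 1) ^ 2 * (2 * of_nat j + 1) * domb_term j m"
  using domb_term_Suc_right[of j m] by (simp add: domb_term_commute[of _ m] add.commute)

text \<open>The certificate returned by Zeilberger's algorithm for the summand of the Domb numbers.\<close>

definition domb_cert :: "complex \<Rightarrow> complex \<Rightarrow> complex" where
  "domb_cert n j = (n + 1) ^ 2 * (16 * j ^ 3 - 24 * (3 * n + 5) * j ^ 2
     + 4 * (26 * n ^ 2 + 89 * n + 74) * j - 8 * (6 * n ^ 3 + 31 * n ^ 2 + 52 * n + 28))"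

text \<open>The telescoping equation divided by the term t(j, m) and multiplied by (m + 1)^3 (m +
  2)^3. The left side uses the ratios t(j, m + 1) / t(j, m) and t(j, m + 2) / t(j, m). The right
  side is G(j + 1) - G(j) for G(j) = t(j, m) j^3 (2m + 1) C(n, j) / ((m + 1)^3 (m + 2)^3), with C =
  \<open>domb_cert\<close>.\<close>

lemma domb_cert_identity:
  fixes j m :: complex
  defines "n \<equiv> j + m"
  shows "(n + 2) ^ 3 * (4 * (n + 1) ^ 2 * (n + 2) ^ 2 * (2 * m + 1) * (2 * m + 3))
      - (2 * n + 3) * (10 * (n + 1) ^ 2 + 10 * (n + 1) + 4) * (2 * (n + 1) ^ 2 * (2 * m + 1) * (m + 2) ^ 3)
      + 64 * (n + 1) ^ 3 * ((m + 1) ^ 3 * (m + 2) ^ 3)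
    = (2 * j + 1) * domb_cert n (j + 1) * (m + 2) ^ 3 - j ^ 3 * (2 * m + 1) * domb_cert n j"
  unfolding n_def domb_cert_def by algebra

definition domb_summand :: "nat \<Rightarrow> nat \<Rightarrow> complex" where
  "domb_summand j m = (of_nat (j + m) + 2) ^ 3 * domb_term j (m + 2)
     - (2 * of_nat (j + m) + 3) * (10 * (of_nat (j + m) + 1) ^ 2 + 10 * (of_nat (j + m) + 1) + 4) * domb_term j (m + 1)
     + 64 * (of_nat (j + m) + 1) ^ 3 * domb_term j m"

lemma of_nat_Suc_neq_0: "(of_nat m + 1 :: complex) \<noteq> 0" "(of_nat m + 2 :: complex) \<noteq> 0"
  using of_nat_neq_0[of m, where 'a = complex] of_nat_neq_0[of "Suc m", where 'a = complex]
  by (simp_all add: add.commute)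

lemma domb_summand_eq:
  "domb_summand j m * ((of_nat m + 1) ^ 3 * (of_nat m + 2) ^ 3) = domb_term j m *
     ((2 * of_nat j + 1) * domb_cert (of_nat (j + m)) (of_nat j + 1) * (of_nat m + 2) ^ 3
       - of_nat j ^ 3 * (2 * of_nat m + 1) * domb_cert (of_nat (j + m)) (of_nat j))"
proof -
  have 1: "(of_nat m + 1) ^ 3 * domb_term j (m + 1)
     = 2 * (of_nat j + of_nat m + 1) ^ 2 * (2 * of_nat m + 1) * domb_term j m"
    using domb_term_Suc_right[of m j] by simp
  have 2: "(of_nat m + 2) ^ 3 * domb_term j (m + 2)
     = 2 * (of_nat j + of_nat m + 2) ^ 2 * (2 * of_nat m + 3) * domb_term j (m + 1)"
    using domb_term_Suc_right[of "Suc m" j] by (simp add: algebra_simps)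
  show ?thesis
    using domb_cert_identity[of "of_nat j" "of_nat m"] 1 2
    unfolding domb_summand_def of_nat_add by algebra
qed

text \<open>The summand is G(j + 1) - G(j), and G(0) = 0 because of the factor j^3. The partial sum
  is therefore G(k + 1), written through the term at index k and cleared of its denominator (n - k +
  1)^3.\<close>

lemma domb_summand_telescope:
  assumes "k \<le> n"
  shows "(\<Sum>j\<le>k. domb_summand j (n - j)) * (of_nat (n - k) + 1) ^ 3
           = domb_term k (n - k) * (2 * of_nat k + 1) * domb_cert (of_nat n) (of_nat k + 1)"
  using assms
proof (induction k)
  case 0
  have "(of_nat n + 2 :: complex) ^ 3 \<noteq> 0"
    using of_nat_Suc_neq_0 by simp
  moreover have "domb_summand 0 n * ((of_nat n + 1) ^ 3 * (of_nat n + 2) ^ 3)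
      = domb_term 0 n * domb_cert (of_nat n) 1 * (of_nat n + 2) ^ 3"
    using domb_summand_eq[of 0 n] by simp
  ultimately show ?case by simp
next
  case (Suc k)
  define m where "m = n - Suc k"
  have n: "n = Suc k + m" "n - k = Suc m" "n - Suc k = m" using Suc.prems by (auto simp: m_def)
  define N J M :: complex where "N = of_nat n" and "J = of_nat k" and "M = of_nat m"
  have NJM: "of_nat n = N" "of_nat k = J" "of_nat m = M" "of_nat (Suc k) = J + 1"
    by (simp_all add: N_def J_def M_def)
  define a where "a = domb_term k m"
  have nz: "J + 1 \<noteq> 0" "M + 1 \<noteq> 0" "M + 2 \<noteq> 0"
    using of_nat_Suc_neq_0 by (auto simp: J_def M_def)
  have 1: "(M + 1) ^ 3 * domb_term k (Suc m) = 2 * (J + M + 1) ^ 2 * (2 * M + 1) * a"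
    using domb_term_Suc_right[of m k] by (simp add: J_def M_def a_def)
  have 2: "(J + 1) ^ 3 * domb_term (Suc k) m = 2 * (J + M + 1) ^ 2 * (2 * J + 1) * a"
    using domb_term_Suc_left[of k m] by (simp add: J_def M_def a_def)
  have IH: "(\<Sum>j\<le>k. domb_summand j (n - j)) * (M + 2) ^ 3
       = domb_term k (Suc m) * (2 * J + 1) * domb_cert N (J + 1)"
    using Suc.IH Suc.prems unfolding n(2) NJM by (simp add: M_def algebra_simps)
  have T: "domb_summand (Suc k) m * ((M + 1) ^ 3 * (M + 2) ^ 3) = domb_term (Suc k) m *
     ((2 * (J + 1) + 1) * domb_cert N (J + 1 + 1) * (M + 2) ^ 3
       - (J + 1) ^ 3 * (2 * M + 1) * domb_cert N (J + 1))"
    using domb_summand_eq[of "Suc k" m] n(1) unfolding NJM n(1)[symmetric] by simp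
  have "((\<Sum>j\<le>k. domb_summand j (n - j)) + domb_summand (Suc k) m) * (M + 1) ^ 3 * (M + 2) ^ 3
     = domb_term (Suc k) m * (2 * (J + 1) + 1) * domb_cert N (J + 1 + 1) * (M + 2) ^ 3"
  proof -
    \<comment> \<open>G(k + 1) expressed by the term at k equals G(k + 1) expressed by the term at k
      + 1. This cancels the old boundary value against the lower end of the new summand.\<close>
    have "domb_term (Suc k) m * ((J + 1) ^ 3 * (2 * M + 1)) = (M + 1) ^ 3 * domb_term k (Suc m) * (2 * J + 1)"
      using 1 2 by algebra
    then show ?thesis using IH T by algebra
  qed
  then have "((\<Sum>j\<le>k. domb_summand j (n - j)) + domb_summand (Suc k) m) * (M + 1) ^ 3
     = domb_term (Suc k) m * (2 * (J + 1) + 1) * domb_cert N (J + 1 + 1)"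
    using nz by simp
  then show ?case unfolding n(3) NJM by (simp add: n(3) M_def)
qed

lemma of_nat_domb: "of_nat (domb n) = (\<Sum>j\<le>n. domb_term j (n - j))"
  by (simp add: domb_def domb_term_def of_nat_sum)

lemma domb_recurrence:
  "(of_nat n + 2 :: complex) ^ 3 * of_nat (domb (n + 2))
     = (2 * of_nat n + 3) * (10 * (of_nat n + 1) ^ 2 + 10 * (of_nat n + 1) + 4) * of_nat (domb (n + 1))
       - 64 * (of_nat n + 1) ^ 3 * of_nat (domb n)"
proof -
  define N :: complex where "N = of_nat n"
  define A B where "A = (N + 2) ^ 3" and "B = (2 * N + 3) * (10 * (N + 1) ^ 2 + 10 * (N + 1) + 4)"
  define c where "c = domb_term n 0"
  have nz: "N + 1 \<noteq> 0" "N + 2 \<noteq> 0" using of_nat_Suc_neq_0 by (auto simp: N_def)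
  have sum: "(\<Sum>j\<le>n. domb_summand j (n - j)) = c * (2 * N + 1) * domb_cert N (N + 1)"
    using domb_summand_telescope[of n n] by (simp add: N_def c_def)
  have "(\<Sum>j\<le>n. domb_summand j (n - j)) =
     (\<Sum>j\<le>n. A * domb_term j (n + 2 - j) - B * domb_term j (n + 1 - j) + 64 * (N + 1) ^ 3 * domb_term j (n - j))"
    by (intro sum.cong) (auto simp: domb_summand_def A_def B_def N_def Suc_diff_le numeral_2_eq_2)
  also have "\<dots> = A * (\<Sum>j\<le>n. domb_term j (n + 2 - j)) - B * (\<Sum>j\<le>n. domb_term j (n + 1 - j))
       + 64 * (N + 1) ^ 3 * (\<Sum>j\<le>n. domb_term j (n - j))"
    by (simp add: sum.distrib sum_subtractf sum_distrib_left)
  \<comment> \<open>The telescoped sum stops at j = n, while the Domb numbers at n + 1 and n + 2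
    have one and two terms more. These extra terms cancel the boundary value G(n + 1).\<close>
  also have "(\<Sum>j\<le>n. domb_term j (n + 2 - j)) = of_nat (domb (n + 2)) - domb_term (Suc n) 1 - domb_term (n + 2) 0"
    by (simp add: of_nat_domb numeral_2_eq_2)
  also have "(\<Sum>j\<le>n. domb_term j (n + 1 - j)) = of_nat (domb (n + 1)) - domb_term (Suc n) 0"
    by (simp add: of_nat_domb)
  also have "(\<Sum>j\<le>n. domb_term j (n - j)) = of_nat (domb n)"
    by (simp add: of_nat_domb)
  finally have eq: "c * (2 * N + 1) * domb_cert N (N + 1)
      = A * (of_nat (domb (n + 2)) - domb_term (Suc n) 1 - domb_term (n + 2) 0)
        - B * (of_nat (domb (n + 1)) - domb_term (Suc n) 0) + 64 * (N + 1) ^ 3 * of_nat (domb n)"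
    using sum by simp
  have 1: "(N + 1) * domb_term (Suc n) 0 = 2 * (2 * N + 1) * c"
    using domb_term_Suc_left[of n 0] nz by (simp add: N_def c_def power2_eq_square power3_eq_cube)
  have 2: "(N + 2) * domb_term (n + 2) 0 = 2 * (2 * N + 3) * domb_term (Suc n) 0"
  proof -
    have "(N + 2) ^ 2 * ((N + 2) * domb_term (n + 2) 0) = (N + 2) ^ 2 * (2 * (2 * N + 3) * domb_term (Suc n) 0)"
      using domb_term_Suc_left[of "Suc n" 0]
      by (simp add: N_def power2_eq_square power3_eq_cube algebra_simps)
    then show ?thesis using nz by simp
  qed
  have 3: "domb_term (Suc n) 1 = 2 * (N + 2) ^ 2 * domb_term (Suc n) 0"
    using domb_term_Suc_right[of 0 "Suc n"] by (simp add: N_def add.commute)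
  \<comment> \<open>Every boundary term, taken with its coefficient, is a polynomial in N times c /
    (N + 1), so the remaining cancellation becomes polynomial.\<close>
  define d where "d = c / (N + 1)"
  have c: "c = (N + 1) * d" using nz by (simp add: d_def)
  have d1: "domb_term (Suc n) 0 = 2 * (2 * N + 1) * d" using 1 nz unfolding c by simp
  have "A * domb_term (n + 2) 0 = (N + 2) ^ 2 * (2 * (2 * N + 3) * domb_term (Suc n) 0)"
    unfolding A_def 2[symmetric] by (simp add: power2_eq_square power3_eq_cube)
  then have "A * of_nat (domb (n + 2)) - B * of_nat (domb (n + 1)) + 64 * (N + 1) ^ 3 * of_nat (domb n) = 0"
    using eq 3 unfolding d1 c A_def B_def domb_cert_def by algebra
  then show ?thesis unfolding A_def B_def N_def by (simp add: algebra_simps)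
qed

subsection \<open>From a nonlinear to a linear differential equation\<close>

lemma fps_XD_mult: "fps_XD (a * b) = fps_XD a * b + a * fps_XD (b :: complex fps)"
  by (simp add: fps_XD_def algebra_simps)

lemma fps_XD_diff: "fps_XD (a - b) = fps_XD a - fps_XD (b :: complex fps)"
  by (simp add: fps_XD_def algebra_simps)

lemma fps_XD_power2: "fps_XD (a ^ 2) = 2 * a * fps_XD (a :: complex fps)"
  by (simp add: power2_eq_square fps_XD_mult algebra_simps)

text \<open>Chain rule in logarithmic form: \<open>g\<close> is theta X / X, introduced by a product
  because X has no inverse as a power series.\<close>

lemma fps_XD_compose:
  fixes w X g :: "complex fps"
  assumes "X $ 0 = 0" and "fps_XD X = X * g"
  shows "fps_XD (w oo X) = g * (fps_XD w oo X)"
proof -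
  have "fps_XD (w oo X) = (fps_deriv w oo X) * fps_XD X"
    using assms(1) by (simp add: fps_XD_def fps_compose_deriv algebra_simps)
  also have "\<dots> = g * ((fps_X oo X) * (fps_deriv w oo X))"
    using assms by simp
  also have "(fps_X oo X) * (fps_deriv w oo X) = fps_XD w oo X"
    using assms(1) by (simp add: fps_XD_def fps_compose_mult_distrib)
  finally show ?thesis .
qed

text \<open>Differentiating g^2 = u^2 W(X) expresses theta g without g. Inserted in the second
  relation and divided by u^2, it gives, with D = \<open>fps_XD\<close>, 2 W w D^2 w - W (D w)^2 + D
  W w D w = R w^2. In the derivative of this equation the terms without a factor w cancel, so w can
  be divided out. Behind this, w = f^2 turns the nonlinear equation into 4 W D^2 f + 2 D W D f = R
  f, and the result is the symmetric square of that equation.\<close>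

lemma linear_ode_of_modular_relations:
  fixes w X g u W R :: "complex fps"
  assumes X: "X $ 0 = 0" "X \<noteq> 0" "fps_XD X = X * g" "g \<noteq> 0"
    and u: "u = w oo X" "w \<noteq> 0"
    and g: "g ^ 2 = u ^ 2 * (W oo X)"
    and R: "2 * u * fps_XD (fps_XD u) - 3 * fps_XD u ^ 2 = u ^ 4 * (R oo X)"
  shows "2 * W * fps_XD (fps_XD (fps_XD w)) + 3 * fps_XD W * fps_XD (fps_XD w) + fps_XD (fps_XD W) * fps_XD w
           = 2 * R * fps_XD w + fps_XD R * w"
proof -
  note comp = fps_XD_compose[OF X(1,3)]
  define u1 u2 W0 W1 R0 where defs: "u1 = fps_XD w oo X" "u2 = fps_XD (fps_XD w) oo X"
    "W0 = W oo X" "W1 = fps_XD W oo X" "R0 = R oo X"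
  have u0: "u \<noteq> 0" using u X by (simp add: fps_compose_eq_0_iff)
  have Du: "fps_XD u = g * u1" by (simp add: u comp defs)
  have DDu: "fps_XD (fps_XD u) = fps_XD g * u1 + g * (g * u2)"
    unfolding Du fps_XD_mult by (simp add: defs comp)
  have "2 * g * fps_XD g = fps_XD (u ^ 2 * W0)"
    using arg_cong[OF g, of fps_XD] by (simp add: fps_XD_power2 defs)
  also have "\<dots> = g * (2 * u * u1 * W0 + u ^ 2 * W1)"
    unfolding fps_XD_mult fps_XD_power2 Du by (simp add: defs comp algebra_simps)
  finally have "g * (2 * fps_XD g) = g * (2 * u * u1 * W0 + u ^ 2 * W1)"
    by (simp add: algebra_simps)
  then have Dg: "2 * fps_XD g = 2 * u * u1 * W0 + u ^ 2 * W1"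
    using X(4) by (simp only: mult_cancel_left) simp
  have g': "g ^ 2 = u ^ 2 * W0" using g by (simp add: defs)
  have R': "2 * u * (fps_XD g * u1 + g * (g * u2)) - 3 * (g * u1) ^ 2 = u ^ 4 * R0"
    using R unfolding DDu unfolding Du by (simp add: defs)
  have "u ^ 2 * (2 * W0 * u * u2 - W0 * u1 ^ 2 + W1 * u * u1 - R0 * u ^ 2) = 0"
    using Dg g' R' by algebra
  then have "2 * W0 * u * u2 - W0 * u1 ^ 2 + W1 * u * u1 - R0 * u ^ 2 = 0"
    using u0 by simp
  then have "(2 * W * w * fps_XD (fps_XD w) - W * fps_XD w ^ 2 + fps_XD W * w * fps_XD w - R * w ^ 2) oo X = 0"
    using X(1) by (simp add: defs u fps_compose_mult_distrib fps_compose_add_distrib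
        fps_compose_sub_distrib fps_compose_power)
  then have "2 * W * w * fps_XD (fps_XD w) - W * fps_XD w ^ 2 + fps_XD W * w * fps_XD w - R * w ^ 2 = 0"
    using X by (simp add: fps_compose_eq_0_iff)
  then have "fps_XD (2 * W * w * fps_XD (fps_XD w) - W * fps_XD w ^ 2 + fps_XD W * w * fps_XD w - R * w ^ 2) = 0"
    by (simp add: fps_XD_def)
  then have "w * (2 * W * fps_XD (fps_XD (fps_XD w)) + 3 * fps_XD W * fps_XD (fps_XD w)
      + fps_XD (fps_XD W) * fps_XD w - (2 * R * fps_XD w + fps_XD R * w)) = 0"
    unfolding fps_XD_diff fps_XD_add fps_XD_mult fps_XD_power2
    by (simp add: fps_XD_def algebra_simps power2_eq_square)
  then show ?thesis using u(2) by simp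
qed

text \<open>For m = N - k the coefficient of W_k w_m is 2 m^3 + 3 k m^2 + k^2 m = N m (2 N - k), and
  that of R_k w_m is 2 m + k = 2 N - k. This is the common factor.\<close>

lemma linear_ode_recurrence:
  fixes w W R :: "complex fps"
  assumes "2 * W * fps_XD (fps_XD (fps_XD w)) + 3 * fps_XD W * fps_XD (fps_XD w) + fps_XD (fps_XD W) * fps_XD w
           = 2 * R * fps_XD w + fps_XD R * w"
  shows "(\<Sum>k\<le>N. (2 * of_nat N - of_nat k) * (of_nat N * of_nat (N - k) * W $ k - R $ k) * w $ (N - k)) = 0"
proof -
  have coeff: "(2 * of_nat N - of_nat k) * (of_nat N * of_nat (N - k) * W $ k - R $ k) * w $ (N - k)
      = (2 * W) $ k * fps_XD (fps_XD (fps_XD w)) $ (N - k) + (3 * fps_XD W) $ k * fps_XD (fps_XD w) $ (N - k)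
        + fps_XD (fps_XD W) $ k * fps_XD w $ (N - k)
        - ((2 * R) $ k * fps_XD w $ (N - k) + fps_XD R $ k * w $ (N - k))" if "k \<le> N" for k
  proof -
    have nth: "(2 * W) $ k = 2 * W $ k" "(3 * fps_XD W) $ k = 3 * fps_XD W $ k" "(2 * R) $ k = 2 * R $ k"
      by (simp_all add: fps_numeral_fps_const)
    define m where "m = N - k"
    have N: "N = m + k" using that by (simp add: m_def)
    show ?thesis unfolding nth fps_XD_nth m_def[symmetric] unfolding N of_nat_add by (simp add: algebra_simps)
  qed
  have "(2 * W * fps_XD (fps_XD (fps_XD w)) + 3 * fps_XD W * fps_XD (fps_XD w) + fps_XD (fps_XD W) * fps_XD w
           - (2 * R * fps_XD w + fps_XD R * w)) $ N = 0"
    using assms by simp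
  then have "(\<Sum>k\<le>N. (2 * W) $ k * fps_XD (fps_XD (fps_XD w)) $ (N - k) + (3 * fps_XD W) $ k * fps_XD (fps_XD w) $ (N - k)
        + fps_XD (fps_XD W) $ k * fps_XD w $ (N - k)
        - ((2 * R) $ k * fps_XD w $ (N - k) + fps_XD R $ k * w $ (N - k))) = 0"
    unfolding fps_sub_nth fps_add_nth fps_mult_nth atLeast0AtMost sum.distrib sum_subtractf .
  then show ?thesis by (subst sum.cong[OF refl coeff]) simp_all
qed

section \<open>The operator q d/dq near 0 and expansions in a local parameter\<close>

definition theta_at :: "(complex \<Rightarrow> complex) \<Rightarrow> complex \<Rightarrow> complex \<Rightarrow> bool" where
  "theta_at f q a \<longleftrightarrow> (\<exists>d. (f has_field_derivative d) (at q) \<and> q * d = a)"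

text \<open>As a relation, \<open>theta_at\<close> carries differentiability together with the
  value, and it forces the value 0 at q = 0. Demanding it at every point near 0 makes
  \<open>f\<close> analytic there.\<close>

definition has_theta :: "(complex \<Rightarrow> complex) \<Rightarrow> (complex \<Rightarrow> complex) \<Rightarrow> bool" where
  "has_theta f f1 \<longleftrightarrow> (\<forall>\<^sub>F q in nhds 0. theta_at f q (f1 q))"

lemma has_theta_analytic:
  assumes "has_theta f f1"
  shows "f analytic_on {0}"
proof -
  from assms obtain S where S: "open S" "0 \<in> S"
    "\<And>q. q \<in> S \<Longrightarrow> \<exists>d. (f has_field_derivative d) (at q) \<and> q * d = f1 q"
    unfolding has_theta_def theta_at_def eventually_nhds by blast
  then have "f holomorphic_on S"
    by (meson field_differentiable_at_within field_differentiable_def holomorphic_on_def)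
  then show ?thesis using S(1,2) analytic_at by blast
qed

lemma has_theta_fps:
  assumes "has_theta f f1" and "f has_fps_expansion F"
  shows "f1 has_fps_expansion fps_XD F"
proof -
  have "(\<lambda>q. q * deriv f q) has_fps_expansion fps_XD F"
    unfolding fps_XD_def o_def by (intro fps_expansion_intros assms)
  moreover have "\<forall>\<^sub>F q in nhds 0. q * deriv f q = f1 q"
    using assms(1) unfolding has_theta_def theta_at_def by eventually_elim (auto dest: DERIV_imp_deriv)
  ultimately show ?thesis using has_fps_expansion_cong[of "\<lambda>q. q * deriv f q" f1] by blast
qed

lemma poly_has_fps_expansion: "poly p has_fps_expansion fps_of_poly (p :: complex poly)"
  by (simp add: has_fps_expansion_def)

text \<open>X is locally invertible, and the coefficients are the Taylor coefficients of Z composed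
  with the inverse of X.\<close>

lemma exists_expansion_in_parameter:
  assumes Z: "Z analytic_on {0}" and X: "X analytic_on {0}" "X 0 = 0" "deriv X 0 \<noteq> 0"
  shows "\<exists>w. \<forall>\<^sub>F q in nhds 0. (\<lambda>n. w n * X q ^ n) sums (Z q :: complex)"
proof -
  from Z obtain S1 where S1: "open S1" "0 \<in> S1" "Z holomorphic_on S1"
    unfolding analytic_at by blast
  from X obtain S2 where S2: "open S2" "0 \<in> S2" "X holomorphic_on S2"
    unfolding analytic_at by blast
  have hX: "X holomorphic_on S1 \<inter> S2" and hZ: "Z holomorphic_on S1 \<inter> S2"
    using holomorphic_on_subset[OF S2(3)] holomorphic_on_subset[OF S1(3)] by auto
  obtain r where r: "r > 0" "ball 0 r \<subseteq> S1 \<inter> S2" "open (X ` ball 0 r)" "inj_on X (ball 0 r)"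
    using has_complex_derivative_locally_invertible[OF hX, of 0] S1(1,2) S2(1,2) X(3) by (metis IntI open_Int)
  obtain g where g: "g holomorphic_on (X ` ball 0 r)" "\<And>z. z \<in> ball 0 r \<Longrightarrow> g (X z) = z"
    using holomorphic_has_inverse[OF holomorphic_on_subset[OF hX r(2)] open_ball r(4)] by metis
  have "0 \<in> X ` ball 0 r" using r(1) X(2) by force
  then obtain e where e: "e > 0" "ball 0 e \<subseteq> X ` ball 0 r"
    using r(3) open_contains_ball by blast
  have "(Z \<circ> g) holomorphic_on ball 0 e"
  proof (rule holomorphic_on_compose_gen)
    show "g holomorphic_on ball 0 e" by (rule holomorphic_on_subset[OF g(1) e(2)])
    show "Z holomorphic_on ball 0 r" by (rule holomorphic_on_subset[OF hZ r(2)])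
    show "g ` ball 0 e \<subseteq> ball 0 r" using e(2) g(2) by force
  qed
  then have sums: "(\<lambda>n. (deriv ^^ n) (Z \<circ> g) 0 / fact n * x ^ n) sums (Z \<circ> g) x" if "x \<in> ball 0 e" for x
    using holomorphic_power_series[of "Z \<circ> g" 0 e x] that by simp
  have "isCont X 0"
    using X(1) analytic_at_imp_isCont by blast
  then have "\<forall>\<^sub>F q in nhds 0. X q \<in> ball 0 e"
    using X(2) e(1) by (intro topological_tendstoD[of X "X 0"]) (auto simp: isCont_def tendsto_nhds_iff)
  moreover have "\<forall>\<^sub>F q in nhds (0 :: complex). q \<in> ball 0 r"
    using r(1) by (intro eventually_nhds_in_open) auto
  ultimately have "\<forall>\<^sub>F q in nhds 0. (\<lambda>n. (deriv ^^ n) (Z \<circ> g) 0 / fact n * X q ^ n) sums Z q"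
    by eventually_elim (use sums g(2) in force)
  then show ?thesis
    by (rule exI[where x = "\<lambda>n. (deriv ^^ n) (Z \<circ> g) 0 / fact n"])
qed

text \<open>Passing from pointwise sums to formal composition requires a positive radius of
  convergence of \<open>w\<close>. It comes from convergence at a single point with X q different
  from 0, which exists since X is not identically 0 near 0.\<close>

lemma expansion_in_parameter_fps:
  fixes F G :: "complex fps"
  assumes Z: "Z has_fps_expansion F" and X: "X has_fps_expansion G" "G $ 0 = 0" "G \<noteq> 0"
    and sums: "\<forall>\<^sub>F q in nhds 0. (\<lambda>n. w n * X q ^ n) sums (Z q :: complex)"
  shows "F = Abs_fps w oo G"
proof -
  have "\<not> (\<forall>\<^sub>F q in nhds 0. X q = 0)"
    using X fps_expansion_unique_complex has_fps_expansion_0_iff by blast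
  then have "\<exists>q. (\<lambda>n. w n * X q ^ n) sums Z q \<and> X q \<noteq> 0"
    using sums by (metis (mono_tags, lifting) eventually_mono)
  then obtain q0 where q0: "(\<lambda>n. w n * X q0 ^ n) sums Z q0" "X q0 \<noteq> 0" by blast
  have "conv_radius w \<ge> norm (X q0)"
    using q0(1) by (intro conv_radius_geI) (auto simp: sums_iff)
  then have "fps_conv_radius (Abs_fps w) > 0"
    unfolding fps_conv_radius_def using q0(2) by (auto simp: less_le_trans[of _ "ereal (norm (X q0))"])
  then have "(eval_fps (Abs_fps w) \<circ> X) has_fps_expansion (Abs_fps w oo G)"
    by (intro has_fps_expansion_compose eval_fps_has_fps_expansion X)
  moreover have "\<forall>\<^sub>F q in nhds 0. (eval_fps (Abs_fps w) \<circ> X) q = Z q"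
    using sums by eventually_elim (auto simp: eval_fps_def sums_iff)
  ultimately have "Z has_fps_expansion (Abs_fps w oo G)"
    using has_fps_expansion_cong by blast
  then show ?thesis using Z fps_expansion_unique_complex by blast
qed

text \<open>All three expansions are instances of this. The term k = 0 is 2 N (N^2 W_0 - R_0) w_N;
  where R_0 = 0, the recurrence together with w_0 = Z(0) determines every coefficient.\<close>

lemma modular_recurrence:
  fixes Z X G Z1 Z2 :: "complex \<Rightarrow> complex" and W R :: "complex poly"
  assumes X: "has_theta X (\<lambda>q. X q * G q)" "X 0 = 0" "deriv X 0 \<noteq> 0" and G: "G analytic_on {0}"
    and Z: "has_theta Z Z1" "has_theta Z1 Z2" "Z 0 \<noteq> 0" and W: "coeff W 0 \<noteq> 0"
    and eqW: "\<forall>\<^sub>F q in nhds 0. G q ^ 2 = Z q ^ 2 * poly W (X q)"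
    and eqR: "\<forall>\<^sub>F q in nhds 0. 2 * Z q * Z2 q - 3 * Z1 q ^ 2 = Z q ^ 4 * poly R (X q)"
    and sums: "\<forall>\<^sub>F q in nhds 0. (\<lambda>n. w n * X q ^ n) sums Z q"
  shows "(\<Sum>k\<le>N. (2 * of_nat N - of_nat k) * (of_nat N * of_nat (N - k) * coeff W k - coeff R k) * w (N - k)) = 0"
    and "w 0 = Z 0"
proof -
  define Xf Zf Gf where "Xf = fps_expansion X 0" "Zf = fps_expansion Z 0" "Gf = fps_expansion G 0"
  have Xf: "X has_fps_expansion Xf" and Zf: "Z has_fps_expansion Zf" and Gf: "G has_fps_expansion Gf"
    unfolding Xf_Zf_Gf_def
    by (intro analytic_at_imp_has_fps_expansion_0 has_theta_analytic[OF X(1)] has_theta_analytic[OF Z(1)] G)+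
  have Z1f: "Z1 has_fps_expansion fps_XD Zf" by (rule has_theta_fps[OF Z(1) Zf])
  have Z2f: "Z2 has_fps_expansion fps_XD (fps_XD Zf)" by (rule has_theta_fps[OF Z(2) Z1f])
  have X0: "Xf $ 0 = 0" using has_fps_expansion_imp_0_eq_fps_nth_0[OF Xf] X(2) by simp
  have "deriv X 0 = fps_deriv Xf $ 0"
    using has_fps_expansion_imp_0_eq_fps_nth_0[OF has_fps_expansion_deriv[OF Xf]] .
  then have Xn0: "Xf \<noteq> 0" using X(3) by auto
  have XD: "fps_XD Xf = Xf * Gf"
    using has_theta_fps[OF X(1) Xf] has_fps_expansion_mult[OF Xf Gf] fps_expansion_unique_complex by blast
  have poly: "(\<lambda>q. poly p (X q)) has_fps_expansion (fps_of_poly p oo Xf)" for p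
    using has_fps_expansion_compose[OF poly_has_fps_expansion Xf X0, of p] by (simp add: o_def)
  have "(\<lambda>q. G q ^ 2) has_fps_expansion Gf ^ 2" by (intro fps_expansion_intros Gf)
  moreover have "(\<lambda>q. Z q ^ 2 * poly W (X q)) has_fps_expansion Zf ^ 2 * (fps_of_poly W oo Xf)"
    by (intro fps_expansion_intros Zf poly)
  ultimately have eqW': "Gf ^ 2 = Zf ^ 2 * (fps_of_poly W oo Xf)"
    using has_fps_expansion_cong[OF eqW refl] fps_expansion_unique_complex by blast
  have "(\<lambda>q. 2 * Z q * Z2 q - 3 * Z1 q ^ 2) has_fps_expansion 2 * Zf * fps_XD (fps_XD Zf) - 3 * fps_XD Zf ^ 2"
    by (intro fps_expansion_intros Zf Z1f Z2f)
  moreover have "(\<lambda>q. Z q ^ 4 * poly R (X q)) has_fps_expansion Zf ^ 4 * (fps_of_poly R oo Xf)"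
    by (intro fps_expansion_intros Zf poly)
  ultimately have eqR': "2 * Zf * fps_XD (fps_XD Zf) - 3 * fps_XD Zf ^ 2 = Zf ^ 4 * (fps_of_poly R oo Xf)"
    using has_fps_expansion_cong[OF eqR refl] fps_expansion_unique_complex by blast
  have Zw: "Zf = Abs_fps w oo Xf"
    by (rule expansion_in_parameter_fps[OF Zf Xf X0 Xn0 sums])
  have Z0: "Zf $ 0 = Z 0" using has_fps_expansion_imp_0_eq_fps_nth_0[OF Zf] by simp
  then show "w 0 = Z 0" unfolding Zw by simp
  then have wn0: "Abs_fps w \<noteq> 0" using Z(3) by (metis fps_nth_Abs_fps fps_zero_nth)
  have "Gf \<noteq> 0"
  proof
    assume "Gf = 0"
    moreover have "Zf \<noteq> 0" using Z0 Z(3) by auto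
    ultimately have "fps_of_poly W oo Xf = 0" using eqW' by simp
    then have "fps_of_poly W = 0" using X0 Xn0 by (simp add: fps_compose_eq_0_iff)
    then show False using W by (metis fps_of_poly_nth fps_zero_nth)
  qed
  from linear_ode_recurrence[OF linear_ode_of_modular_relations[OF X0 Xn0 XD this Zw wn0 eqW' eqR'], of N]
  show "(\<Sum>k\<le>N. (2 * of_nat N - of_nat k) * (of_nat N * of_nat (N - k) * coeff W k - coeff R k) * w (N - k)) = 0"
    by simp
qed

subsection \<open>Lambert series in two variables\<close>

lemma powser_theta:
  fixes c :: "nat \<Rightarrow> complex"
  assumes sm: "\<And>t. norm t < K \<Longrightarrow> summable (\<lambda>n. c n * t ^ n)" and x: "norm x < K"
  shows "summable (\<lambda>n. of_nat n * c n * x ^ n)"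
    and "\<exists>d. ((\<lambda>t. \<Sum>n. c n * t ^ n) has_field_derivative d) (at x) \<and> x * d = (\<Sum>n. of_nat n * c n * x ^ n)"
proof -
  have s: "summable (\<lambda>n. diffs c n * x ^ n)" by (rule termdiff_converges[OF x sm])
  then have "summable (\<lambda>n. x * (diffs c n * x ^ n))" by (rule summable_mult)
  moreover have eq: "x * (diffs c n * x ^ n) = of_nat (Suc n) * c (Suc n) * x ^ Suc n" for n
    by (simp add: diffs_def algebra_simps)
  ultimately have s2: "summable (\<lambda>n. of_nat (Suc n) * c (Suc n) * x ^ Suc n)" by simp
  then show s3: "summable (\<lambda>n. of_nat n * c n * x ^ n)"
    by (subst summable_Suc_iff[symmetric])
  have "x * (\<Sum>n. diffs c n * x ^ n) = (\<Sum>n. of_nat (Suc n) * c (Suc n) * x ^ Suc n)"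
    unfolding suminf_mult[OF s, symmetric] eq ..
  also have "\<dots> = (\<Sum>n. of_nat n * c n * x ^ n)"
    using suminf_split_head[OF s3] by simp
  finally show "\<exists>d. ((\<lambda>t. \<Sum>n. c n * t ^ n) has_field_derivative d) (at x) \<and> x * d = (\<Sum>n. of_nat n * c n * x ^ n)"
    using termdiffs_strong'[OF sm x] by blast
qed

definition two_sided :: "(nat \<Rightarrow> complex) \<Rightarrow> complex \<Rightarrow> complex \<Rightarrow> complex" where
  "two_sided c \<sigma> x = (\<Sum>n. c n * x ^ n) + \<sigma> * (\<Sum>n. c n * inverse x ^ n)"

definition annulus :: "complex \<Rightarrow> complex set" where
  "annulus q = {x. norm q < norm x \<and> norm q * norm x < 1}"

text \<open>Exactly what makes both halves of \<open>two_sided\<close> converge on the annulus. As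
  in \<open>annulus\<close>, a product replaces the bound 1 / |q|, so that q = 0 allows every
  t.\<close>

definition lau_coeffs :: "complex \<Rightarrow> (nat \<Rightarrow> complex) \<Rightarrow> bool" where
  "lau_coeffs q c \<longleftrightarrow> (\<forall>t. norm q * norm t < 1 \<longrightarrow> summable (\<lambda>n. c n * t ^ n))"

lemma lau_coeffs_of_nat_mult:
  assumes "lau_coeffs q c"
  shows "lau_coeffs q (\<lambda>n. of_nat n * c n)"
  unfolding lau_coeffs_def
proof (intro allI impI)
  fix t :: complex assume t: "norm q * norm t < 1"
  show "summable (\<lambda>n. of_nat n * c n * t ^ n)"
  proof (cases "q = 0")
    case True
    then show ?thesis
      using assms by (intro powser_theta[of "norm t + 1"]) (auto simp: lau_coeffs_def)
  next
    case False
    then show ?thesis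
      using assms t by (intro powser_theta[of "1 / norm q"]) (auto simp: lau_coeffs_def field_simps)
  qed
qed

text \<open>The operator x d/dx multiplies x^n by n and x^(-n) by -n, hence the change of sign of
  \<open>\<sigma>\<close>.\<close>

lemma two_sided_deriv:
  assumes c: "lau_coeffs q c" and x: "x \<in> annulus q" and q: "q \<noteq> 0"
  shows "(two_sided c \<sigma> has_field_derivative two_sided (\<lambda>n. of_nat n * c n) (- \<sigma>) x / x) (at x)"
proof -
  have x0: "x \<noteq> 0" using x by (auto simp: annulus_def)
  have sm: "summable (\<lambda>n. c n * t ^ n)" if "norm t < 1 / norm q" for t
    using c that q by (auto simp: lau_coeffs_def field_simps)
  have x1: "norm x < 1 / norm q"
    using x q by (simp add: annulus_def pos_less_divide_eq mult.commute)
  have x2: "norm (inverse x) < 1 / norm q"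
    using x q unfolding annulus_def inverse_eq_divide norm_divide norm_one by (auto intro!: divide_strict_left_mono mult_pos_pos)
  obtain d where d: "((\<lambda>t. \<Sum>n. c n * t ^ n) has_field_derivative d) (at x)"
      "x * d = (\<Sum>n. of_nat n * c n * x ^ n)"
    using powser_theta(2)[OF sm x1] by blast
  obtain e where e: "((\<lambda>t. \<Sum>n. c n * t ^ n) has_field_derivative e) (at (inverse x))"
      "inverse x * e = (\<Sum>n. of_nat n * c n * inverse x ^ n)"
    using powser_theta(2)[OF sm x2] by blast
  have "((\<lambda>x. \<Sum>n. c n * inverse x ^ n) has_field_derivative e * (- (inverse x * 1 * inverse x))) (at x)"
    by (rule DERIV_chain2[where g = inverse, OF e(1)]) (use x0 in \<open>auto intro!: derivative_eq_intros simp: power2_eq_square\<close>)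
  then have "((\<lambda>x. (\<Sum>n. c n * x ^ n) + \<sigma> * (\<Sum>n. c n * inverse x ^ n)) has_field_derivative
      d + \<sigma> * (e * (- (inverse x * 1 * inverse x)))) (at x)"
    by (intro DERIV_add d DERIV_cmult)
  moreover have "d + \<sigma> * (e * (- (inverse x * 1 * inverse x))) = two_sided (\<lambda>n. of_nat n * c n) (- \<sigma>) x / x"
    unfolding two_sided_def d(2)[symmetric] e(2)[symmetric] using x0 by (simp add: field_simps)
  ultimately show ?thesis unfolding two_sided_def[abs_def] by simp
qed

text \<open>The exponent i = 1 belongs to S and i = 2 to its q-derivative, while k counts the
  applications of x d/dx. For i > 0 the denominator vanishes at n = 0, so that term has the value 0
  and sums may start there.\<close>

definition lam :: "nat \<Rightarrow> nat \<Rightarrow> complex \<Rightarrow> nat \<Rightarrow> complex" where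
  "lam i k q n = of_nat n ^ k * q ^ n / (1 - q ^ n) ^ i"

lemma lam_Suc: "lam i (Suc k) q = (\<lambda>n. of_nat n * lam i k q n)"
  by (auto simp: lam_def)

lemma norm_one_minus_power_ge:
  assumes "norm (q :: complex) \<le> r" "r < 1" "n > 0"
  shows "norm (1 - q ^ n) \<ge> 1 - r"
proof -
  have "norm (q ^ n) \<le> norm q" unfolding norm_power
    using assms by (intro power_le_one_iff[THEN iffD2] power_decreasing[of 1 n "norm q", simplified]) auto
  then show ?thesis using norm_triangle_ineq2[of 1 "q ^ n"] assms(1) by simp
qed

lemma lau_coeffs_lam:
  assumes q: "norm q < 1" and i: "i > 0"
  shows "lau_coeffs q (lam i k q)"
proof (induction k)
  case 0
  show ?case unfolding lau_coeffs_def
  proof (intro allI impI)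
    fix t :: complex assume t: "norm q * norm t < 1"
    show "summable (\<lambda>n. lam i 0 q n * t ^ n)"
    proof (rule summable_comparison_test'[where N = 1])
      show "summable (\<lambda>n. (norm q * norm t) ^ n / (1 - norm q) ^ i)"
        using t by (intro summable_divide summable_geometric) simp
      fix n :: nat assume n: "n \<ge> 1"
      have le: "(1 - norm q) ^ i \<le> norm (1 - q ^ n) ^ i"
        using norm_one_minus_power_ge[of q "norm q" n] q n by (intro power_mono) auto
      have pos: "0 < (1 - norm q) ^ i" using q by simp
      have "norm (lam i 0 q n * t ^ n) = (norm q * norm t) ^ n / norm (1 - q ^ n) ^ i"
        by (simp add: lam_def norm_mult norm_divide norm_power power_mult_distrib)
      also have "\<dots> \<le> (norm q * norm t) ^ n / (1 - norm q) ^ i"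
        by (rule divide_left_mono[OF le _ mult_pos_pos[OF less_le_trans[OF pos le] pos]]) simp
      finally show "norm (lam i 0 q n * t ^ n) \<le> (norm q * norm t) ^ n / (1 - norm q) ^ i" .
    qed
  qed
next
  case (Suc k)
  then show ?case unfolding lam_Suc by (rule lau_coeffs_of_nat_mult)
qed

text \<open>Iterates of x d/dx on (1 + x) / (2 (1 - x)), which for x = e^(iu) equals (i/2) cot(u/2).
  Every index from 3 on repeats the third iterate, hence the bound k < 3 in the derivative
  rules.\<close>

fun cot_part :: "nat \<Rightarrow> complex \<Rightarrow> complex" where
  "cot_part 0 x = (1 + x) / (2 * (1 - x))"
| "cot_part (Suc 0) x = x / (1 - x) ^ 2"
| "cot_part (Suc (Suc 0)) x = x * (1 + x) / (1 - x) ^ 3"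
| "cot_part (Suc (Suc (Suc k))) x = x * (1 + 4 * x + x ^ 2) / (1 - x) ^ 4"

lemma cot_part_deriv:
  assumes "x \<noteq> 1" "x \<noteq> 0" "k < 3"
  shows "(cot_part k has_field_derivative cot_part (Suc k) x / x) (at x)"
proof -
  have x: "1 - x \<noteq> 0" using assms by simp
  consider "k = 0" | "k = 1" | "k = 2" using assms by linarith
  then show ?thesis
  proof cases
    case 1
    have "((\<lambda>x. (1 + x) / (2 * (1 - x))) has_field_derivative x / (1 - x) ^ 2 / x) (at x)"
      using x assms by (auto intro!: derivative_eq_intros simp: divide_simps) (simp add: algebra_simps power2_eq_square)
    moreover have "cot_part k = (\<lambda>x. (1 + x) / (2 * (1 - x)))" "cot_part (Suc k) x = x / (1 - x) ^ 2"
      using 1 by (auto simp: numeral_2_eq_2)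
    ultimately show ?thesis by simp
  next
    case 2
    have "((\<lambda>x. x / (1 - x) ^ 2) has_field_derivative x * (1 + x) / (1 - x) ^ 3 / x) (at x)"
      using x assms by (auto intro!: derivative_eq_intros simp: divide_simps) algebra
    moreover have "cot_part k = (\<lambda>x. x / (1 - x) ^ 2)" "cot_part (Suc k) x = x * (1 + x) / (1 - x) ^ 3"
      using 2 by (auto simp: numeral_2_eq_2)
    ultimately show ?thesis by simp
  next
    case 3
    have "((\<lambda>x. x * (1 + x) / (1 - x) ^ 3) has_field_derivative x * (1 + 4 * x + x ^ 2) / (1 - x) ^ 4 / x) (at x)"
      using x assms by (auto intro!: derivative_eq_intros simp: divide_simps) algebra
    moreover have "cot_part k = (\<lambda>x. x * (1 + x) / (1 - x) ^ 3)" "cot_part (Suc k) x = x * (1 + 4 * x + x ^ 2) / (1 - x) ^ 4"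
      using 3 by (auto simp: numeral_2_eq_2)
    ultimately show ?thesis by simp
  qed
qed

text \<open>With $x = e^{u}$, \<open>zeta_q 0 q x\<close> is the Weierstrass zeta function in $u$ up to sign and a linear
  term, and the index \<open>k\<close> counts derivatives in $u$. On the unit circle $q \partial_q$ maps
  \<open>zeta_q k\<close> to \<open>phi_q (Suc k)\<close>.\<close>

definition zeta_q :: "nat \<Rightarrow> complex \<Rightarrow> complex \<Rightarrow> complex" where
  "zeta_q k q x = cot_part k x + two_sided (lam 1 k q) (- ((-1) ^ k)) x"

definition phi_q :: "nat \<Rightarrow> complex \<Rightarrow> complex \<Rightarrow> complex" where
  "phi_q k q x = two_sided (lam 2 k q) ((-1) ^ k) x"

lemma zeta_q_deriv:
  assumes "x \<in> annulus q" "x \<noteq> 1" "q \<noteq> 0" "norm q < 1" "k < 3"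
  shows "(zeta_q k q has_field_derivative zeta_q (Suc k) q x / x) (at x)"
proof -
  have "x \<noteq> 0" using assms by (auto simp: annulus_def)
  then have "((\<lambda>x. cot_part k x + two_sided (lam 1 k q) (- ((-1) ^ k)) x) has_field_derivative
      cot_part (Suc k) x / x + two_sided (lam 1 (Suc k) q) (- (- ((-1) ^ k))) x / x) (at x)"
    unfolding lam_Suc using assms
    by (intro DERIV_add cot_part_deriv two_sided_deriv[where q = q] lau_coeffs_lam) auto
  then show ?thesis unfolding zeta_q_def[abs_def] by (simp add: add_divide_distrib)
qed

lemma phi_q_deriv:
  assumes "x \<in> annulus q" "q \<noteq> 0" "norm q < 1"
  shows "(phi_q k q has_field_derivative phi_q (Suc k) q x / x) (at x)"
  using two_sided_deriv[OF lau_coeffs_lam[of q 2 k] assms(1,2)] assms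
  unfolding phi_q_def[abs_def] lam_Suc by simp

subsection \<open>The addition formula\<close>

lemma int_has_sum:
  fixes f :: "int \<Rightarrow> complex"
  assumes "summable (\<lambda>n. norm (f (int n)))" "(\<lambda>n. f (int n)) sums a"
    and "summable (\<lambda>n. norm (f (- int (Suc n))))" "(\<lambda>n. f (- int (Suc n))) sums b"
  shows "(f has_sum (a + b)) UNIV"
proof -
  have "(f has_sum a) (range int)"
    using norm_summable_imp_has_sum[OF assms(1,2)] by (subst has_sum_reindex) (auto simp: o_def)
  moreover have "(f has_sum b) (range (\<lambda>n. - int (Suc n)))"
    using norm_summable_imp_has_sum[OF assms(3,4)] by (subst has_sum_reindex) (auto simp: o_def inj_def)
  moreover have "range int \<inter> range (\<lambda>n. - int (Suc n)) = {}" by auto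
  moreover have "range int \<union> range (\<lambda>n. - int (Suc n)) = UNIV"
  proof -
    have "m \<in> range int \<union> range (\<lambda>n. - int (Suc n))" for m
    proof (cases m rule: int_cases)
      case (nonneg n) then show ?thesis by auto
    next
      case (neg n) then show ?thesis by auto
    qed
    then show ?thesis by blast
  qed
  ultimately show ?thesis using has_sum_Un_disjoint by metis
qed

lemma has_sum_product:
  fixes f :: "'a \<Rightarrow> complex" and g :: "'b \<Rightarrow> complex"
  assumes f: "(f has_sum a) A" and g: "(g has_sum b) B"
  shows "((\<lambda>(m, n). f m * g n) has_sum (a * b)) (A \<times> B)"
proof (rule has_sum_SigmaI)
  show "((\<lambda>n. case (m, n) of (m, n) \<Rightarrow> f m * g n) has_sum f m * b) B" for m
    using has_sum_cmult_right[OF g, of "f m"] by simp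
  show "((\<lambda>m. f m * b) has_sum a * b) A"
    by (rule has_sum_cmult_left[OF f])
  have f': "(\<lambda>m. norm (f m)) summable_on A" and g': "(\<lambda>n. norm (g n)) summable_on B"
    using f g summable_on_iff_abs_summable_on_complex has_sum_imp_summable by blast+
  have "(\<lambda>p. norm (case p of (m, n) \<Rightarrow> f m * g n)) summable_on A \<times> B"
    unfolding Infinite_Sum.abs_summable_on_Sigma_iff
    using f' g' by (auto simp: norm_mult infsum_cmult_right' abs_mult infsum_nonneg
        intro!: summable_on_cmult_right summable_on_cmult_left)
  then show "(\<lambda>(m, n). f m * g n) summable_on A \<times> B"
    by (rule abs_summable_summable)
qed

lemma lau_coeffs_norm_summable:
  assumes c: "lau_coeffs q c" and q: "q \<noteq> 0" and t: "norm q * norm t < 1"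
  shows "summable (\<lambda>n. norm (c n * t ^ n))"
proof -
  define s where "s = (norm t + 1 / norm q) / 2"
  have "norm t < 1 / norm q" using t q by (simp add: field_simps)
  then have s: "norm t < s" "s < 1 / norm q" "0 \<le> s" using q by (auto simp: s_def field_simps)
  then have "norm q * norm (complex_of_real s) < 1" using q by (simp add: field_simps)
  then have "summable (\<lambda>n. c n * complex_of_real s ^ n)"
    using c by (simp add: lau_coeffs_def)
  then show ?thesis using s by (intro powser_insidea) auto
qed

lemma power_neq_1:
  assumes "norm (q :: complex) < 1" "n > 0"
  shows "q ^ n \<noteq> 1"
  using norm_one_minus_power_ge[of q "norm q" n] assms by auto

lemma power_int_neg_Suc: "(x :: complex) powi (- int (Suc n)) = inverse x ^ Suc n"
  by (simp only: power_int_minus power_int_of_nat power_inverse)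

text \<open>For m different from 0 the coefficients satisfy c_m + c_(-m) = 1; the value 1/2
  continues this to m = 0.\<close>

definition zeta_coeff :: "complex \<Rightarrow> int \<Rightarrow> complex" where
  "zeta_coeff q m = (if m = 0 then 1 / 2 else 1 / (1 - q powi m))"

text \<open>For |x| < 1 the elementary part is the geometric series minus 1/2. Its terms merge with
  the Lambert terms by 1 + q^n / (1 - q^n) = 1 / (1 - q^n); negative exponents use 1 / (1 - q^(-n))
  = - q^n / (1 - q^n).\<close>

lemma zeta_q_bilateral:
  assumes q: "q \<noteq> 0" "norm q < norm x" "norm x < 1"
  shows "((\<lambda>m. zeta_coeff q m * x powi m) has_sum zeta_q 0 q x) UNIV"
proof -
  have q1: "norm q < 1" using q by simp
  have x0: "x \<noteq> 0" using q by auto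
  have qx: "norm q * norm x < 1" using q q1 mult_strict_mono[of "norm q" 1 "norm x" 1] by simp
  have qi: "norm q * norm (inverse x) < 1" using q x0 by (simp add: norm_divide field_simps)
  let ?c = "lam 1 0 q"
  have c: "lau_coeffs q ?c" using lau_coeffs_lam[of q 1 0] q1 by simp
  have c0: "?c 0 = 0" by (simp add: lam_def)
  have pos: "zeta_coeff q (int n) * x powi int n = (x ^ n + ?c n * x ^ n) - (if n = 0 then 1 / 2 else 0)" for n
    using power_neq_1[OF q1, of n] by (auto simp: zeta_coeff_def lam_def field_simps)
  have neg: "zeta_coeff q (- int (Suc n)) * x powi (- int (Suc n)) = - (?c (Suc n) * inverse x ^ Suc n)" for n
  proof -
    have "q ^ Suc n \<noteq> 1" "q ^ Suc n \<noteq> 0" using power_neq_1[OF q1, of "Suc n"] q(1) by auto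
    then have "1 / (1 - inverse q ^ Suc n) = - (q ^ Suc n / (1 - q ^ Suc n))"
      unfolding power_inverse by (simp add: divide_simps del: power_Suc) (simp add: algebra_simps del: power_Suc)
    then show ?thesis
      unfolding power_int_neg_Suc zeta_coeff_def by (simp add: lam_def del: power_Suc)
  qed
  have "((\<lambda>m. zeta_coeff q m * x powi m) has_sum
     ((1 / (1 - x) + (\<Sum>n. ?c n * x ^ n) - 1 / 2) + - (\<Sum>n. ?c n * inverse x ^ n))) UNIV"
  proof (rule int_has_sum)
    have e: "(\<lambda>n. if n = 0 then 1 / 2 else 0) sums (1 / 2 :: complex)"
      using sums_single[of 0 "\<lambda>_. 1 / 2 :: complex"] by simp
    have e': "summable (\<lambda>n. norm (if n = 0 then 1 / 2 else 0 :: complex))"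
      by (rule summable_finite[of "{0}"]) auto
    show "(\<lambda>n. zeta_coeff q (int n) * x powi int n) sums (1 / (1 - x) + (\<Sum>n. ?c n * x ^ n) - 1 / 2)"
      unfolding pos using c qx q(3)
      by (intro sums_diff sums_add geometric_sums summable_sums e) (auto simp: lau_coeffs_def)
    show "summable (\<lambda>n. norm (zeta_coeff q (int n) * x powi int n))"
      unfolding pos
    proof (rule summable_comparison_test')
      show "summable (\<lambda>n. norm (x ^ n) + norm (?c n * x ^ n) + norm (if n = 0 then 1 / 2 else 0 :: complex))"
        using q(3) by (intro summable_add lau_coeffs_norm_summable[OF c q(1) qx] e')
          (simp add: norm_power summable_geometric)
      show "norm (norm (x ^ n + ?c n * x ^ n - (if n = 0 then 1 / 2 else 0)))
          \<le> norm (x ^ n) + norm (?c n * x ^ n) + norm (if n = 0 then 1 / 2 else 0 :: complex)" if "n \<ge> 0" for n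
        using norm_triangle_ineq4[of "x ^ n + ?c n * x ^ n" "if n = 0 then 1 / 2 else 0 :: complex"]
          norm_triangle_ineq[of "x ^ n" "?c n * x ^ n"] by simp
    qed
    have "(\<lambda>n. ?c n * inverse x ^ n) sums (\<Sum>n. ?c n * inverse x ^ n)"
      using c qi by (intro summable_sums) (simp add: lau_coeffs_def)
    then have "(\<lambda>n. ?c (Suc n) * inverse x ^ Suc n) sums (\<Sum>n. ?c n * inverse x ^ n)"
      using c0 by (subst sums_Suc_iff) simp
    then show "(\<lambda>n. zeta_coeff q (- int (Suc n)) * x powi (- int (Suc n))) sums - (\<Sum>n. ?c n * inverse x ^ n)"
      unfolding neg by (rule sums_minus)
    show "summable (\<lambda>n. norm (zeta_coeff q (- int (Suc n)) * x powi (- int (Suc n))))"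
      unfolding neg norm_minus_cancel
      using lau_coeffs_norm_summable[OF c q(1) qi] by (subst summable_Suc_iff)
  qed
  moreover have "(1 / (1 - x) + (\<Sum>n. ?c n * x ^ n) - 1 / 2) + - (\<Sum>n. ?c n * inverse x ^ n) = zeta_q 0 q x"
  proof -
    have "x \<noteq> 1" using q by auto
    then have "1 / (1 - x) - 1 / 2 = cot_part 0 x" by (simp add: field_simps)
    then show ?thesis by (simp add: zeta_q_def two_sided_def)
  qed
  ultimately show ?thesis by simp
qed

text \<open>Q / (1 - Q)^2 is invariant under Q -> 1 / Q, so both halves have the same form. The term
  m = 0 is a division by zero and contributes 0.\<close>

lemma phi_q_bilateral:
  assumes q: "q \<noteq> 0" "norm q < norm x" "norm x < 1"
  shows "((\<lambda>m. q powi m / (1 - q powi m) ^ 2 * x powi m) has_sum phi_q 0 q x) UNIV"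
proof -
  have q1: "norm q < 1" using q by simp
  have x0: "x \<noteq> 0" using q by auto
  have qx: "norm q * norm x < 1" using q q1 mult_strict_mono[of "norm q" 1 "norm x" 1] by simp
  have qi: "norm q * norm (inverse x) < 1" using q x0 by (simp add: norm_divide field_simps)
  let ?c = "lam 2 0 q"
  have c: "lau_coeffs q ?c" using lau_coeffs_lam[of q 2 0] q1 by simp
  have c0: "?c 0 = 0" by (simp add: lam_def)
  have pos: "q powi int n / (1 - q powi int n) ^ 2 * x powi int n = ?c n * x ^ n" for n
    by (simp add: lam_def)
  have neg: "q powi (- int (Suc n)) / (1 - q powi (- int (Suc n))) ^ 2 * x powi (- int (Suc n))
      = ?c (Suc n) * inverse x ^ Suc n" for n
  proof -
    have *: "inverse Q / (1 - inverse Q) ^ 2 = Q / (1 - Q) ^ 2" if "Q \<noteq> 0" "Q \<noteq> 1" for Q :: complex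
    proof -
      have "1 - inverse Q = - ((1 - Q) / Q)" using that by (simp add: field_simps)
      then show ?thesis using that by (simp add: power_divide power2_eq_square)
    qed
    have "q ^ Suc n \<noteq> 1" "q ^ Suc n \<noteq> 0" using power_neq_1[OF q1, of "Suc n"] q(1) by auto
    then show ?thesis
      unfolding power_int_neg_Suc power_inverse[of q] using *[of "q ^ Suc n"] by (simp add: lam_def del: power_Suc)
  qed
  have "((\<lambda>m. q powi m / (1 - q powi m) ^ 2 * x powi m) has_sum
     ((\<Sum>n. ?c n * x ^ n) + (\<Sum>n. ?c n * inverse x ^ n))) UNIV"
  proof (rule int_has_sum)
    show "(\<lambda>n. q powi int n / (1 - q powi int n) ^ 2 * x powi int n) sums (\<Sum>n. ?c n * x ^ n)"
      unfolding pos using c qx by (intro summable_sums) (auto simp: lau_coeffs_def)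
    show "summable (\<lambda>n. norm (q powi int n / (1 - q powi int n) ^ 2 * x powi int n))"
      unfolding pos by (rule lau_coeffs_norm_summable[OF c q(1) qx])
    have "(\<lambda>n. ?c n * inverse x ^ n) sums (\<Sum>n. ?c n * inverse x ^ n)"
      using c qi by (intro summable_sums) (simp add: lau_coeffs_def)
    then show "(\<lambda>n. q powi (- int (Suc n)) / (1 - q powi (- int (Suc n))) ^ 2 * x powi (- int (Suc n)))
        sums (\<Sum>n. ?c n * inverse x ^ n)"
      unfolding neg using c0 by (subst sums_Suc_iff) simp
    show "summable (\<lambda>n. norm (q powi (- int (Suc n)) / (1 - q powi (- int (Suc n))) ^ 2 * x powi (- int (Suc n))))"
      unfolding neg using lau_coeffs_norm_summable[OF c q(1) qi] by (subst summable_Suc_iff)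
  qed
  then show ?thesis by (simp add: phi_q_def two_sided_def)
qed

lemma power_int_neq_1:
  assumes "norm (q :: complex) < 1" "q \<noteq> 0" "m \<noteq> 0"
  shows "q powi m \<noteq> 1"
proof (cases m rule: int_cases)
  case (nonneg n)
  then show ?thesis using power_neq_1[OF assms(1), of n] assms(3) by auto
next
  case (neg n)
  then show ?thesis using power_neq_1[OF assms(1), of "Suc n"]
    unfolding neg power_int_neg_Suc power_inverse by (metis inverse_1 inverse_inverse_eq zero_less_Suc)
qed

lemma has_sum_on_line:
  fixes f :: "int \<Rightarrow> complex"
  assumes f: "(f has_sum a) UNIV" and inj: "inj h"
    and g: "\<And>m. g (h m) = f m" "\<And>p. p \<notin> range h \<Longrightarrow> g p = 0"
  shows "(g has_sum a) (UNIV :: (int \<times> int) set)"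
proof -
  have "(g has_sum a) (range h)"
    using f inj by (subst has_sum_reindex) (auto simp: o_def g)
  then show ?thesis
    using has_sum_cong_neutral[of UNIV "range h" g g a] g(2) by auto
qed

text \<open>Comparing coefficients of $x^m y^n$, only those on the lines $m = 0$, $n = 0$ and $m = n$ survive, by
  $\frac{1}{(1-A)(1-B)} = \frac{1}{(1-A)(1-B/A)} + \frac{1}{(1-B)(1-A/B)}$ for $A = q^m$, $B = q^n$.\<close>

lemma zeta_q_addition_phi:
  assumes q: "q \<noteq> 0" and x: "norm q < norm x" "norm x < 1" and y: "norm q < norm y" "norm y < 1"
    and xy: "norm q < norm (x * y)"
  shows "zeta_q 0 q x * zeta_q 0 q y - zeta_q 0 q (x * y) * (zeta_q 0 q x + zeta_q 0 q y)
           = - 1 / 4 + phi_q 0 q x + phi_q 0 q y + phi_q 0 q (x * y)"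
proof -
  have x0: "x \<noteq> 0" "y \<noteq> 0" using x y by auto
  have q1: "norm q < 1" using x by simp
  have xy1: "norm (x * y) < 1" using x y mult_strict_mono[of "norm x" 1 "norm y" 1] by (simp add: norm_mult)
  let ?c = "zeta_coeff q" and ?S = "zeta_q 0 q" and ?p = "\<lambda>m. q powi m / (1 - q powi m) ^ 2"
  note Sx = zeta_q_bilateral[OF q x] and Sy = zeta_q_bilateral[OF q y] and Sxy = zeta_q_bilateral[OF q xy xy1]
  have T1: "((\<lambda>(m, n). (?c m * x powi m) * (?c n * y powi n)) has_sum ?S x * ?S y) UNIV"
    using has_sum_product[OF Sx Sy] by simp
  have "((\<lambda>(m, n). (?c m * (x * y) powi m) * (?c n * y powi n)) has_sum ?S (x * y) * ?S y) UNIV"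
    using has_sum_product[OF Sxy Sy] by simp
  \<comment> \<open>Since (x y)^m y^k = x^m y^(m + k), the coefficient of x^m y^n comes from k = n -
    m; T3 is the same with x and y exchanged.\<close>
  then have T2: "((\<lambda>(m, n). ?c m * ?c (n - m) * x powi m * y powi n) has_sum ?S (x * y) * ?S y) UNIV"
    by (subst has_sum_reindex_bij_witness[where S = UNIV and T = UNIV and i = "\<lambda>(m, n). (m, m + n)"
          and j = "\<lambda>(m, n). (m, n - m)" and h = "\<lambda>(m, n). (?c m * (x * y) powi m) * (?c n * y powi n)"])
      (use x0 in \<open>auto simp: power_int_mult_distrib power_int_diff\<close>)
  have "((\<lambda>(m, n). (?c m * (x * y) powi m) * (?c n * x powi n)) has_sum ?S (x * y) * ?S x) UNIV"
    using has_sum_product[OF Sxy Sx] by simp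
  then have T3: "((\<lambda>(m, n). ?c n * ?c (m - n) * x powi m * y powi n) has_sum ?S (x * y) * ?S x) UNIV"
    by (subst has_sum_reindex_bij_witness[where S = UNIV and T = UNIV and i = "\<lambda>(n, k). (n + k, n)"
          and j = "\<lambda>(m, n). (n, m - n)" and h = "\<lambda>(m, n). (?c m * (x * y) powi m) * (?c n * x powi n)"])
      (use x0 in \<open>auto simp: power_int_mult_distrib power_int_diff\<close>)
  define f where "f = (\<lambda>(m, n). (?c m * x powi m) * (?c n * y powi n)
      - (?c m * ?c (n - m) * x powi m * y powi n + ?c n * ?c (m - n) * x powi m * y powi n))"
  have "((\<lambda>p. (\<lambda>(m, n). (?c m * x powi m) * (?c n * y powi n)) p
      + - ((\<lambda>(m, n). ?c m * ?c (n - m) * x powi m * y powi n) p + (\<lambda>(m, n). ?c n * ?c (m - n) * x powi m * y powi n) p))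
      has_sum (?S x * ?S y + - (?S (x * y) * ?S y + ?S (x * y) * ?S x))) UNIV"
    by (intro has_sum_add has_sum_uminusI T1 T2 T3)
  then have F: "(f has_sum (?S x * ?S y - ?S (x * y) * (?S x + ?S y))) UNIV"
    by (simp add: f_def case_prod_unfold algebra_simps)
  have A: "((\<lambda>(m, n :: int). if n = 0 then ?p m * x powi m else 0) has_sum phi_q 0 q x) UNIV"
    by (rule has_sum_on_line[OF phi_q_bilateral[OF q x], where h = "\<lambda>m. (m, 0)"]) (auto simp: inj_def)
  have B: "((\<lambda>(m :: int, n). if m = 0 then ?p n * y powi n else 0) has_sum phi_q 0 q y) UNIV"
    by (rule has_sum_on_line[OF phi_q_bilateral[OF q y], where h = "\<lambda>n. (0, n)"]) (auto simp: inj_def)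
  have C: "((\<lambda>(m, n). if m = n then ?p m * (x * y) powi m else 0) has_sum phi_q 0 q (x * y)) UNIV"
    by (rule has_sum_on_line[OF phi_q_bilateral[OF q xy xy1], where h = "\<lambda>n. (n, n)"]) (auto simp: inj_def)
  \<comment> \<open>At the origin the three products of the values 1/2 leave 1/4 - 1/4 -
    1/4.\<close>
  have D: "((\<lambda>p. if p = (0, 0) then - 1 / 4 else 0) has_sum (- 1 / 4 :: complex)) (UNIV :: (int \<times> int) set)"
  proof -
    have "((\<lambda>p. if p = (0, 0) then - 1 / 4 else 0) has_sum (- 1 / 4 :: complex)) {(0 :: int, 0 :: int)}"
      by (rule has_sum_finiteI) auto
    then show ?thesis
      using has_sum_cong_neutral[of UNIV "{(0 :: int, 0 :: int)}" "\<lambda>p. if p = (0, 0) then - 1 / 4 else 0 :: complex"] by auto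
  qed
  have "f = (\<lambda>p. (if p = (0, 0) then - 1 / 4 else 0) + (\<lambda>(m, n). if n = 0 then ?p m * x powi m else 0) p
      + (\<lambda>(m, n). if m = 0 then ?p n * y powi n else 0) p + (\<lambda>(m, n). if m = n then ?p m * (x * y) powi m else 0) p)"
    (is "f = ?g")
  proof
    fix p :: "int \<times> int"
    obtain m n where p: "p = (m, n)" by force
    have cc: "- (?c k * ?c (- k)) = ?p k" if "k \<noteq> 0" for k
    proof -
      have "q powi k \<noteq> 1" "q powi k \<noteq> 0" using power_int_neq_1[OF q1 q that] q by auto
      then have "- (1 / (1 - q powi k) * (1 / (1 - inverse (q powi k)))) = ?p k"
        by (simp add: divide_simps power2_eq_square)
      then show ?thesis using that by (simp add: zeta_coeff_def power_int_minus)
    qed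
    have cd: "?c k * ?c k - ?c k = ?p k" if "k \<noteq> 0" for k
      using power_int_neq_1[OF q1 q that] that
      by (simp add: zeta_coeff_def divide_simps power2_eq_square)
    consider "m = 0" "n = 0" | "m = 0" "n \<noteq> 0" | "m \<noteq> 0" "n = 0" | "m \<noteq> 0" "m = n" | "m \<noteq> 0" "n \<noteq> 0" "m \<noteq> n"
      by blast
    then show "f p = ?g p"
    proof cases
      case 1
      then show ?thesis by (simp add: p f_def zeta_coeff_def)
    next
      case 2
      have "f p = - (?c n * ?c (- n)) * y powi n" using 2 by (simp add: p f_def zeta_coeff_def[of q 0])
      then show ?thesis using 2 cc[of n] by (simp add: p)
    next
      case 3
      have "f p = - (?c m * ?c (- m)) * x powi m" using 3 by (simp add: p f_def zeta_coeff_def[of q 0])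
      then show ?thesis using 3 cc[of m] by (simp add: p)
    next
      case 4
      have "f p = (?c m * ?c m - ?c m) * (x * y) powi m"
        using 4 by (simp add: p f_def zeta_coeff_def[of q 0] power_int_mult_distrib algebra_simps)
      then show ?thesis using 4 cd[of m] by (simp add: p)
    next
      case 5
      define A B where "A = q powi m" and "B = q powi n"
      have AB: "A \<noteq> 1" "B \<noteq> 1" "A \<noteq> 0" "B \<noteq> 0"
        using power_int_neq_1[OF q1 q] 5 q by (auto simp: A_def B_def)
      have d: "q powi (n - m) = B / A" "q powi (m - n) = A / B"
        using q by (simp_all add: A_def B_def power_int_diff)
      have "B / A \<noteq> 1" using power_int_neq_1[OF q1 q, of "n - m"] 5 d by auto
      then have "A \<noteq> B" using AB by auto
      then have "?c m * ?c n - (?c m * ?c (n - m) + ?c n * ?c (m - n)) = 0"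
        using 5 AB unfolding zeta_coeff_def d A_def[symmetric] B_def[symmetric]
        by (simp add: divide_simps) (simp add: algebra_simps)
      moreover have "f p = (?c m * ?c n - (?c m * ?c (n - m) + ?c n * ?c (m - n))) * x powi m * y powi n"
        by (simp add: p f_def algebra_simps)
      ultimately show ?thesis using 5 by (simp add: p)
    qed
  qed
  then have "(f has_sum (- 1 / 4 + phi_q 0 q x + phi_q 0 q y + phi_q 0 q (x * y))) UNIV"
    using has_sum_add[OF has_sum_add[OF has_sum_add[OF D A] B] C] by simp
  then show ?thesis using F has_sum_unique by blast
qed

section \<open>The Eisenstein series and Ramanujan's identity\<close>

lemma has_sum_geometric_deriv:
  fixes z :: "'a :: {real_normed_field, banach}"
  assumes z: "norm z < 1"
  shows "((\<lambda>k. of_nat (Suc k) * z ^ Suc k) has_sum z / (1 - z) ^ 2) UNIV"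
proof (rule norm_summable_imp_has_sum)
  show "(\<lambda>k. of_nat (Suc k) * z ^ Suc k) sums (z / (1 - z) ^ 2)"
    using sums_mult[OF geometric_deriv_sums[OF z], of z] by (simp add: algebra_simps)
  have "(\<lambda>k. norm z * (of_nat (Suc k) * norm z ^ k)) sums (norm z * (1 / (1 - norm z) ^ 2))"
    using z by (intro sums_mult geometric_deriv_sums) simp
  then show "summable (\<lambda>k. norm (of_nat (Suc k) * z ^ Suc k))"
    by (simp add: sums_iff norm_mult norm_power algebra_simps del: of_nat_Suc)
qed

lemma lam_0 [simp]: "i > 0 \<Longrightarrow> lam i k q 0 = 0"
  by (simp add: lam_def)

text \<open>Both sides are the double sum of k q^(nk) over n, k >= 1, summed in either order; the
  proof supplies absolute convergence.\<close>

lemma lambert_swap: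
  assumes q: "norm q < 1"
  shows "(\<Sum>n. lam 2 0 q n) = (\<Sum>n. lam 1 1 q n)"
proof -
  define f where "f = (\<lambda>(n, k). of_nat (Suc k) * (q ^ Suc n) ^ Suc k)"
  have qn: "norm (q ^ Suc n) < 1" for n
    using q power_less_one_iff[of "norm q" "Suc n"] unfolding norm_power by simp
  have sm: "summable (\<lambda>n. norm (lam i k q n))" if "i > 0" for i k
  proof (cases "q = 0")
    case True
    have "lam i k q n = 0" if "n \<notin> {0}" for n using that True by (simp add: lam_def power_0_left)
    then show ?thesis by (intro summable_finite[of "{0}"]) auto
  next
    case False
    then show ?thesis
      using lau_coeffs_norm_summable[OF lau_coeffs_lam[OF q that, of k] False, of 1] q by simp
  qed
  have sums: "(\<lambda>n. lam i k q (Suc n)) sums (\<Sum>n. lam i k q n)" if "i > 0" for i k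
    using summable_sums[OF summable_norm_cancel[OF sm[OF that]], of k] that
    by (subst sums_Suc_iff) simp
  have hs: "((\<lambda>n. lam i k q (Suc n)) has_sum (\<Sum>n. lam i k q n)) UNIV" if "i > 0" for i k
    using sm[OF that, of k] sums[OF that, of k] by (intro norm_summable_imp_has_sum) (auto simp: summable_Suc_iff[of "\<lambda>n. norm (lam i k q n)"])
  have row: "((\<lambda>k. f (n, k)) has_sum lam 2 0 q (Suc n)) UNIV" for n
    using has_sum_geometric_deriv[OF qn[of n]] by (simp add: f_def lam_def)
  have col: "((\<lambda>n. f (n, k)) has_sum lam 1 1 q (Suc k)) UNIV" for k
  proof -
    let ?w = "q ^ Suc k"
    have "((\<lambda>n. ?w * ?w ^ n) has_sum (?w * (1 / (1 - ?w)))) UNIV"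
      using qn[of k]
      by (intro has_sum_cmult_right norm_summable_imp_has_sum geometric_sums)
         (auto simp: norm_power[of ?w] summable_geometric simp del: power_Suc)
    then have "((\<lambda>n. of_nat (Suc k) * (?w * ?w ^ n)) has_sum (of_nat (Suc k) * (?w * (1 / (1 - ?w))))) UNIV"
      by (rule has_sum_cmult_right)
    moreover have "f (n, k) = of_nat (Suc k) * (?w * ?w ^ n)" for n
    proof -
      have "(q ^ Suc n) ^ Suc k = (q ^ Suc k) ^ Suc n" by (metis mult.commute power_mult)
      then show ?thesis unfolding f_def by (simp del: of_nat_Suc add: algebra_simps)
    qed
    ultimately show ?thesis by (simp add: lam_def del: of_nat_Suc power_Suc)
  qed
  have rown: "((\<lambda>k. norm (f (n, k))) has_sum (norm q ^ Suc n / (1 - norm q ^ Suc n) ^ 2)) UNIV" for n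
    using has_sum_geometric_deriv[of "norm q ^ Suc n"] qn[of n]
    by (simp add: f_def norm_mult norm_power del: of_nat_Suc power_Suc)
  have "(\<lambda>p. norm (f p)) summable_on UNIV \<times> UNIV"
    unfolding Infinite_Sum.abs_summable_on_Sigma_iff
  proof (intro conjI ballI)
    show "(\<lambda>k. norm (f (n, k))) summable_on UNIV" for n
      using rown[of n] has_sum_imp_summable by blast
    have "summable (\<lambda>n. norm q ^ Suc n / (1 - norm q) ^ 2)"
      using q by (intro summable_divide) (simp add: summable_geometric summable_mult)
    then have "summable (\<lambda>n. norm q ^ Suc n / (1 - norm q ^ Suc n) ^ 2)"
    proof (rule summable_comparison_test'[where N = 0])
      fix n :: nat
      have "norm q ^ Suc n \<le> norm q" using q power_decreasing[of 1 "Suc n" "norm q"] by simp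
      then have "(1 - norm q) ^ 2 \<le> (1 - norm q ^ Suc n) ^ 2" using q by (intro power_mono) auto
      moreover have "0 < (1 - norm q) ^ 2" using q by simp
      ultimately have "norm q ^ Suc n / (1 - norm q ^ Suc n) ^ 2 \<le> norm q ^ Suc n / (1 - norm q) ^ 2"
        by (intro divide_left_mono mult_pos_pos) (auto elim: less_le_trans simp del: power_Suc)
      then show "norm (norm q ^ Suc n / (1 - norm q ^ Suc n) ^ 2) \<le> norm q ^ Suc n / (1 - norm q) ^ 2"
        by (simp add: norm_divide norm_power)
    qed
    then show "(\<lambda>n. norm (infsum (\<lambda>k. norm (f (n, k))) UNIV)) summable_on UNIV"
      unfolding infsumI[OF rown] by (intro norm_summable_imp_summable_on) (simp add: norm_divide norm_power)
  qed
  then have "f summable_on UNIV \<times> UNIV" by (rule abs_summable_summable)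
  then have F: "(f has_sum (\<Sum>n. lam 2 0 q n)) (UNIV \<times> UNIV)"
    by (intro has_sum_SigmaI[where g = "\<lambda>n. lam 2 0 q (Suc n)"] row hs) auto
  then have "((\<lambda>(k, n). f (n, k)) has_sum (\<Sum>n. lam 2 0 q n)) (UNIV \<times> UNIV)"
    by (simp only: has_sum_swap[of f])
  then have "((\<lambda>k. lam 1 1 q (Suc k)) has_sum (\<Sum>n. lam 2 0 q n)) UNIV"
    by (rule has_sum_Sigma') (use col in auto)
  moreover have "((\<lambda>k. lam 1 1 q (Suc k)) has_sum (\<Sum>n. lam 1 1 q n)) UNIV"
    by (rule hs) simp
  ultimately show ?thesis by (rule has_sum_unique)
qed

lemma eisP_lam:
  assumes q: "norm q < 1"
  shows "eisP q = 1 - 24 * (\<Sum>n. lam 1 1 q n)"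
proof -
  have "summable (lam 1 1 q)"
    using lau_coeffs_lam[OF q, of 1 1, unfolded lau_coeffs_def, rule_format, of 1] q by simp
  from suminf_split_head[OF this] have "(\<Sum>n. lam 1 1 q (Suc n)) = (\<Sum>n. lam 1 1 q n)"
    by simp
  moreover have "lam 1 1 q (Suc n) = of_nat (Suc n) * q ^ Suc n / (1 - q ^ Suc n)" for n
    by (simp add: lam_def)
  ultimately show ?thesis by (simp only: eisP_def)
qed

lemma annulusI: "norm q < norm x \<Longrightarrow> norm x \<le> 1 \<Longrightarrow> x \<in> annulus q"
  unfolding annulus_def using mult_left_mono[of "norm x" 1 "norm q"] by auto

text \<open>The constant through which P enters the addition formula.\<close>

lemma phi_q_1:
  assumes "norm q < 1"
  shows "phi_q 0 q 1 = (1 - eisP q) / 12"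
  using eisP_lam[OF assms] lambert_swap[OF assms] by (simp add: phi_q_def two_sided_def)

lemma isCont_cot_part:
  assumes "x \<noteq> 1"
  shows "isCont (cot_part k) x"
proof -
  have "cot_part k = (\<lambda>x. (1 + x) / (2 * (1 - x))) \<or> cot_part k = (\<lambda>x. x / (1 - x) ^ 2)
    \<or> cot_part k = (\<lambda>x. x * (1 + x) / (1 - x) ^ 3) \<or> cot_part k = (\<lambda>x. x * (1 + 4 * x + x ^ 2) / (1 - x) ^ 4)"
    by (rule cot_part.cases[of "(k, x)"]) (auto simp: fun_eq_iff)
  then show ?thesis using assms by (elim disjE) (auto intro!: continuous_intros)
qed

lemma isCont_two_sided_lam:
  assumes "x \<in> annulus q" "q \<noteq> 0" "norm q < 1" "i > 0"
  shows "isCont (two_sided (lam i k q) \<sigma>) x"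
  using two_sided_deriv[OF lau_coeffs_lam[OF assms(3,4)] assms(1,2)] DERIV_isCont by blast

lemma isCont_zeta_q:
  assumes "x \<in> annulus q" "x \<noteq> 1" "q \<noteq> 0" "norm q < 1"
  shows "isCont (zeta_q k q) x"
  unfolding zeta_q_def[abs_def]
  by (intro continuous_intros isCont_cot_part isCont_two_sided_lam assms) simp

lemma isCont_phi_q:
  assumes "x \<in> annulus q" "q \<noteq> 0" "norm q < 1"
  shows "isCont (phi_q k q) x"
  unfolding phi_q_def[abs_def] by (intro isCont_two_sided_lam assms) simp

text \<open>The bound on t * t serves the product of the two points t x and t y, which must also
  stay outside the circle of radius |q|.\<close>

lemma eventually_at_left_1:
  fixes c :: real
  assumes "c < 1"
  shows "\<forall>\<^sub>F t in at_left 1. c < t \<and> c < t * t \<and> 0 < t \<and> t < 1"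
proof -
  have "((\<lambda>t. t * t) \<longlongrightarrow> 1 * 1) (at_left (1 :: real))" by (intro tendsto_intros)
  then have "\<forall>\<^sub>F t in at_left 1. c < t * t" using assms by (intro order_tendstoD) auto
  moreover have "\<forall>\<^sub>F t in at_left 1. max c 0 < t \<and> t < 1"
    unfolding eventually_at_left_field using assms by (intro exI[of _ "max c 0"]) auto
  ultimately show ?thesis by eventually_elim auto
qed

text \<open>Ramanujan's identity is the limit $y \to 1$ of the addition formula; the simple pole of \<open>zeta_q 0 q y\<close>
  turns the difference of the values at \<open>x\<close> and \<open>x * y\<close> into a derivative.\<close>

lemma zeta_q_square:
  assumes q: "q \<noteq> 0" and x: "norm q < norm x" "norm x < 1"
  shows "zeta_q 1 q x - zeta_q 0 q x ^ 2 = 2 * phi_q 0 q x - 1 / 4 + (1 - eisP q) / 12"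
proof -
  let ?S = "zeta_q 0 q"
  have q1: "norm q < 1" and x0: "x \<noteq> 0" "x \<noteq> 1" using x by auto
  have xa: "x \<in> annulus q" and a1: "1 \<in> annulus q" using x q1 by (auto intro!: annulusI)
  \<comment> \<open>The addition formula holds only for |y| < 1, so y tends to 1 along the reals
    from below.\<close>
  let ?F = "filtermap complex_of_real (at_left 1)"
  have F: "?F \<le> at 1"
    unfolding filterlim_def[symmetric] by (intro filterlim_atI tendsto_eq_intros) (auto simp: eventually_at_filter)
  have F': "?F \<noteq> bot" by (simp add: filtermap_bot_iff)
  have "(?S has_field_derivative zeta_q 1 q x / x) (at (x * 1))"
    using zeta_q_deriv[OF xa x0(2) q q1, of 0] by simp
  then have "((\<lambda>y. ?S (x * y)) has_field_derivative zeta_q 1 q x / x * x) (at 1)"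
    by (rule DERIV_chain2) (auto intro!: derivative_eq_intros)
  then have d: "((\<lambda>y. (?S (x * y) - ?S x) / (y - 1)) \<longlongrightarrow> zeta_q 1 q x) (at 1)"
    using x0(1) by (simp add: has_field_derivative_iff)
  have "isCont (two_sided (lam 1 0 q) (- 1)) 1"
    by (rule isCont_two_sided_lam) (use a1 q q1 in auto)
  then have "((\<lambda>y. (1 + y) / 2 + (1 - y) * two_sided (lam 1 0 q) (- 1) y) \<longlongrightarrow>
      (1 + 1) / 2 + (1 - 1) * two_sided (lam 1 0 q) (- 1) 1) (at 1)"
    by (intro tendsto_intros) (auto simp: isCont_def)
  moreover have "\<forall>\<^sub>F y in at 1. (1 + y) / 2 + (1 - y) * two_sided (lam 1 0 q) (- 1) y = (1 - y) * ?S y"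
    by (auto simp: eventually_at_filter zeta_q_def field_simps)
  ultimately have p: "((\<lambda>y. (1 - y) * ?S y) \<longlongrightarrow> 1) (at 1)"
    using tendsto_cong by force
  have xt: "((\<lambda>y. x * y) \<longlongrightarrow> x) (at 1)" by (auto intro!: tendsto_eq_intros)
  have Sxy: "((\<lambda>y. ?S (x * y)) \<longlongrightarrow> ?S x) (at 1)"
    by (rule isCont_tendsto_compose[OF isCont_zeta_q[OF xa x0(2) q q1] xt])
  \<comment> \<open>The pole is isolated: S(x) S(y) - S(x y) S(y) is the difference quotient of S
    times (1 - y) S(y), and both factors converge.\<close>
  have "((\<lambda>y. (?S (x * y) - ?S x) / (y - 1) * ((1 - y) * ?S y) - ?S (x * y) * ?S x) \<longlongrightarrow>
      zeta_q 1 q x * 1 - ?S x * ?S x) (at 1)"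
    by (intro tendsto_intros d p Sxy)
  then have L: "((\<lambda>y. (?S (x * y) - ?S x) / (y - 1) * ((1 - y) * ?S y) - ?S (x * y) * ?S x) \<longlongrightarrow>
      zeta_q 1 q x * 1 - ?S x * ?S x) ?F"
    using F by (rule tendsto_mono[rotated])
  have "((\<lambda>y. - 1 / 4 + phi_q 0 q x + phi_q 0 q y + phi_q 0 q (x * y)) \<longlongrightarrow>
      - 1 / 4 + phi_q 0 q x + phi_q 0 q 1 + phi_q 0 q x) (at 1)"
    using isCont_phi_q[OF a1 q q1]
    by (intro tendsto_intros isCont_tendsto_compose[OF isCont_phi_q[OF xa q q1] xt]) (auto simp: isCont_def)
  then have R: "((\<lambda>y. - 1 / 4 + phi_q 0 q x + phi_q 0 q y + phi_q 0 q (x * y)) \<longlongrightarrow>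
      - 1 / 4 + phi_q 0 q x + phi_q 0 q 1 + phi_q 0 q x) ?F"
    using F by (rule tendsto_mono[rotated])
  have "\<forall>\<^sub>F t in at_left 1. max (norm q) (norm q / norm x) < t \<and> t < 1"
    using eventually_at_left_1[of "max (norm q) (norm q / norm x)"] x q1 x0 by (auto elim: eventually_mono simp: field_simps)
  then have "\<forall>\<^sub>F y in ?F. (?S (x * y) - ?S x) / (y - 1) * ((1 - y) * ?S y) - ?S (x * y) * ?S x
      = - 1 / 4 + phi_q 0 q x + phi_q 0 q y + phi_q 0 q (x * y)"
    unfolding eventually_filtermap
  proof eventually_elim
    case (elim t)
    then have t: "norm q < t" "t < 1" "norm q < norm x * t" "0 \<le> t"
      using x0 le_less_trans[OF norm_ge_zero[of q], of t] by (auto simp: field_simps)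
    have "?S x * ?S (of_real t) - ?S (x * of_real t) * (?S x + ?S (of_real t))
        = - 1 / 4 + phi_q 0 q x + phi_q 0 q (of_real t) + phi_q 0 q (x * of_real t)"
      by (rule zeta_q_addition_phi) (use q x t in \<open>auto simp: norm_mult\<close>)
    moreover have "(a - b) / (y - 1) * ((1 - y) * c) - a * b = b * c - a * (b + c)" if "y \<noteq> 1" for a b c y :: complex
      using that by (simp add: divide_simps) (simp add: algebra_simps)
    moreover have "complex_of_real t \<noteq> 1" using t(2) by simp
    ultimately show ?case by presburger
  qed
  from tendsto_unique[OF F' L tendsto_cong[OF this, THEN iffD2, OF R]]
  have "zeta_q 1 q x * 1 - ?S x * ?S x = - 1 / 4 + phi_q 0 q x + phi_q 0 q 1 + phi_q 0 q x" .
  then show ?thesis unfolding phi_q_1[OF q1] by (simp add: power2_eq_square)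
qed

text \<open>Ramanujan's identity at x, y and x y expresses each value of \<open>phi_q 0\<close> by
  S' - S^2; substituting them completes the square.\<close>

lemma zeta_q_addition:
  assumes q: "q \<noteq> 0" and x: "norm q < norm x" "norm x < 1" and y: "norm q < norm y" "norm y < 1"
    and xy: "norm q < norm (x * y)"
  shows "(zeta_q 0 q x + zeta_q 0 q y - zeta_q 0 q (x * y)) ^ 2
           = zeta_q 1 q x + zeta_q 1 q y + zeta_q 1 q (x * y) + eisP q / 4"
proof -
  have xy1: "norm (x * y) < 1" using x y mult_strict_mono[of "norm x" 1 "norm y" 1] by (simp add: norm_mult)
  have *: "12 * (E - S ^ 2) = 24 * \<phi> - 2 - P" if "E - S ^ 2 = 2 * \<phi> - 1 / 4 + (1 - P) / 12" for P E S \<phi> :: complex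
    unfolding that by (simp add: field_simps)
  have "4 * (zeta_q 0 q x * zeta_q 0 q y - zeta_q 0 q (x * y) * (zeta_q 0 q x + zeta_q 0 q y))
           = - 1 + 4 * (phi_q 0 q x + phi_q 0 q y + phi_q 0 q (x * y))"
    unfolding zeta_q_addition_phi[OF assms] by simp
  with *[OF zeta_q_square[OF q x]] *[OF zeta_q_square[OF q y]] *[OF zeta_q_square[OF q xy xy1]]
  have "4 * (zeta_q 0 q x + zeta_q 0 q y - zeta_q 0 q (x * y)) ^ 2
           = 4 * (zeta_q 1 q x + zeta_q 1 q y + zeta_q 1 q (x * y)) + eisP q"
    by algebra
  then show ?thesis by (simp add: field_simps)
qed

text \<open>Licence to apply x d/dx to an identity that holds on an open set; the derivatives carry
  the factor 1 / x to match \<open>zeta_q_deriv\<close>.\<close>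

lemma theta_unique:
  fixes f g :: "complex \<Rightarrow> complex"
  assumes "open V" "x \<in> V" "x \<noteq> 0" "\<And>t. t \<in> V \<Longrightarrow> f t = g t"
    and "(f has_field_derivative a / x) (at x)" "(g has_field_derivative b / x) (at x)"
  shows "a = b"
proof -
  have "(g has_field_derivative a / x) (at x)"
    using assms(5,1,2,4) by (rule has_field_derivative_transform_within_open)
  then have "a / x = b / x" using assms(6) DERIV_unique by blast
  then show ?thesis using assms(3) by simp
qed

lemma zeta_q_deriv_mult:
  assumes "x * y \<in> annulus q" "x * y \<noteq> 1" "q \<noteq> 0" "norm q < 1" "k < 3"
  shows "((\<lambda>t. zeta_q k q (t * y)) has_field_derivative zeta_q (Suc k) q (x * y) / x) (at x)"
proof -
  have "x \<noteq> 0" "y \<noteq> 0" using assms(1) by (auto simp: annulus_def)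
  moreover have "((\<lambda>t. zeta_q k q (t * y)) has_field_derivative zeta_q (Suc k) q (x * y) / (x * y) * y) (at x)"
    by (rule DERIV_chain2[where g = "\<lambda>t. t * y", OF zeta_q_deriv[OF assms]]) (auto intro!: derivative_eq_intros)
  ultimately show ?thesis by simp
qed

lemma zeta_q_derivs:
  assumes "x \<in> annulus q" "x \<noteq> 1" "q \<noteq> 0" "norm q < 1"
  shows "(zeta_q 0 q has_field_derivative zeta_q 1 q x / x) (at x)"
    and "(zeta_q 1 q has_field_derivative zeta_q 2 q x / x) (at x)"
    and "(zeta_q 2 q has_field_derivative zeta_q 3 q x / x) (at x)"
  using zeta_q_deriv[OF assms, of 0] zeta_q_deriv[OF assms, of 1] zeta_q_deriv[OF assms, of 2]
  by (simp_all add: numeral_2_eq_2 numeral_3_eq_3)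

lemma zeta_q_derivs_mult:
  assumes "x * y \<in> annulus q" "x * y \<noteq> 1" "q \<noteq> 0" "norm q < 1"
  shows "((\<lambda>t. zeta_q 0 q (t * y)) has_field_derivative zeta_q 1 q (x * y) / x) (at x)"
    and "((\<lambda>t. zeta_q 1 q (t * y)) has_field_derivative zeta_q 2 q (x * y) / x) (at x)"
    and "((\<lambda>t. zeta_q 2 q (t * y)) has_field_derivative zeta_q 3 q (x * y) / x) (at x)"
  using zeta_q_deriv_mult[OF assms, of 0] zeta_q_deriv_mult[OF assms, of 1] zeta_q_deriv_mult[OF assms, of 2]
  by (simp_all add: numeral_2_eq_2 numeral_3_eq_3)

lemma open_norm_conditions:
  "open {t :: complex. norm q < norm t \<and> norm t < 1 \<and> norm q < norm (t * y)}"
  by (intro open_Collect_conj open_Collect_less continuous_intros)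

text \<open>The operator x d/dx applied to the addition formula with y fixed.\<close>

lemma zeta_q_addition_D:
  assumes q: "q \<noteq> 0" and x: "norm q < norm x" "norm x < 1" and y: "norm q < norm y" "norm y < 1"
    and xy: "norm q < norm (x * y)"
  shows "2 * (zeta_q 0 q x + zeta_q 0 q y - zeta_q 0 q (x * y)) * (zeta_q 1 q x - zeta_q 1 q (x * y))
           = zeta_q 2 q x + zeta_q 2 q (x * y)"
proof (rule theta_unique[OF open_norm_conditions[of q y]])
  have xy1: "norm (x * y) < 1" using x y mult_strict_mono[of "norm x" 1 "norm y" 1] by (simp add: norm_mult)
  have q1: "norm q < 1" using x by simp
  have x0: "x \<noteq> 0" "x \<noteq> 1" "x * y \<noteq> 1" using x xy1 by auto
  have xa: "x \<in> annulus q" and xya: "x * y \<in> annulus q" using x xy xy1 by (auto intro!: annulusI)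
  note d = zeta_q_derivs[OF xa x0(2) q q1] and m = zeta_q_derivs_mult[OF xya x0(3) q q1]
  show "x \<in> {t. norm q < norm t \<and> norm t < 1 \<and> norm q < norm (t * y)}" "x \<noteq> 0" using x xy x0 by auto
  show "(zeta_q 0 q t + zeta_q 0 q y - zeta_q 0 q (t * y)) ^ 2
           = zeta_q 1 q t + zeta_q 1 q y + zeta_q 1 q (t * y) + eisP q / 4"
    if "t \<in> {t. norm q < norm t \<and> norm t < 1 \<and> norm q < norm (t * y)}" for t
    using zeta_q_addition[OF q _ _ y, of t] that by simp
  show "((\<lambda>t. (zeta_q 0 q t + zeta_q 0 q y - zeta_q 0 q (t * y)) ^ 2) has_field_derivative
     2 * (zeta_q 0 q x + zeta_q 0 q y - zeta_q 0 q (x * y)) * (zeta_q 1 q x - zeta_q 1 q (x * y)) / x) (at x)"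
    by (rule DERIV_cong[OF DERIV_power[OF DERIV_diff[OF DERIV_add[OF d(1) DERIV_const] m(1)]]])
      (simp add: divide_inverse algebra_simps)
  show "((\<lambda>t. zeta_q 1 q t + zeta_q 1 q y + zeta_q 1 q (t * y) + eisP q / 4) has_field_derivative
     (zeta_q 2 q x + zeta_q 2 q (x * y)) / x) (at x)"
    by (rule DERIV_cong[OF DERIV_add[OF DERIV_add[OF DERIV_add[OF d(2) DERIV_const] m(2)] DERIV_const]])
      (simp add: add_divide_distrib)
qed

text \<open>The mixed second derivative: the once differentiated formula, with x and y exchanged, is
  differentiated in x.\<close>

lemma zeta_q_addition_DD:
  assumes q: "q \<noteq> 0" and x: "norm q < norm x" "norm x < 1" and y: "norm q < norm y" "norm y < 1"
    and xy: "norm q < norm (x * y)"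
  shows "2 * (zeta_q 1 q x - zeta_q 1 q (x * y)) * (zeta_q 1 q y - zeta_q 1 q (x * y))
           - 2 * (zeta_q 0 q x + zeta_q 0 q y - zeta_q 0 q (x * y)) * zeta_q 2 q (x * y) = zeta_q 3 q (x * y)"
proof (rule theta_unique[OF open_norm_conditions[of q y]])
  have xy1: "norm (x * y) < 1" using x y mult_strict_mono[of "norm x" 1 "norm y" 1] by (simp add: norm_mult)
  have q1: "norm q < 1" using x by simp
  have x0: "x \<noteq> 0" "x \<noteq> 1" "x * y \<noteq> 1" using x xy1 by auto
  have xa: "x \<in> annulus q" and xya: "x * y \<in> annulus q" using x xy xy1 by (auto intro!: annulusI)
  note d = zeta_q_derivs[OF xa x0(2) q q1] and m = zeta_q_derivs_mult[OF xya x0(3) q q1]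
  show "x \<in> {t. norm q < norm t \<and> norm t < 1 \<and> norm q < norm (t * y)}" "x \<noteq> 0" using x xy x0 by auto
  show "2 * (zeta_q 0 q y + zeta_q 0 q t - zeta_q 0 q (t * y)) * (zeta_q 1 q y - zeta_q 1 q (t * y))
           = zeta_q 2 q y + zeta_q 2 q (t * y)"
    if "t \<in> {t. norm q < norm t \<and> norm t < 1 \<and> norm q < norm (t * y)}" for t
    using zeta_q_addition_D[OF q y, of t] that by (simp add: mult.commute)
  show "((\<lambda>t. 2 * (zeta_q 0 q y + zeta_q 0 q t - zeta_q 0 q (t * y)) * (zeta_q 1 q y - zeta_q 1 q (t * y))) has_field_derivative
     (2 * (zeta_q 1 q x - zeta_q 1 q (x * y)) * (zeta_q 1 q y - zeta_q 1 q (x * y))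
           - 2 * (zeta_q 0 q x + zeta_q 0 q y - zeta_q 0 q (x * y)) * zeta_q 2 q (x * y)) / x) (at x)"
    by (rule DERIV_cong[OF DERIV_mult[OF DERIV_cmult[OF DERIV_diff[OF DERIV_add[OF DERIV_const d(1)] m(1)]]
            DERIV_diff[OF DERIV_const m(2)]]])
      (simp add: divide_inverse algebra_simps)
  show "((\<lambda>t. zeta_q 2 q y + zeta_q 2 q (t * y)) has_field_derivative zeta_q 3 q (x * y) / x) (at x)"
    by (rule DERIV_cong[OF DERIV_add[OF DERIV_const m(3)]]) simp
qed

text \<open>Applying x d/dx once and twice to Ramanujan's identity removes its constants, P
  included. Read with q d/dq in place of the shift from \<open>zeta_q k\<close> to
  \<open>phi_q (Suc k)\<close>, the first equation is the Burgers-type equation.\<close>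

lemma zeta_q_heat:
  assumes q: "q \<noteq> 0" and x: "norm q < norm x" "norm x < 1"
  shows "zeta_q 2 q x - 2 * zeta_q 0 q x * zeta_q 1 q x = 2 * phi_q 1 q x" (is ?th1)
    and "zeta_q 3 q x - 2 * zeta_q 1 q x ^ 2 - 2 * zeta_q 0 q x * zeta_q 2 q x = 2 * phi_q 2 q x" (is ?th2)
proof -
  have 1: "zeta_q 2 q x - 2 * zeta_q 0 q x * zeta_q 1 q x = 2 * phi_q 1 q x"
    if x: "norm q < norm x" "norm x < 1" for x
  proof (rule theta_unique[OF open_norm_conditions[of q 1]])
    have q1: "norm q < 1" and x0: "x \<noteq> 1" using x by auto
    have xa: "x \<in> annulus q" using x by (auto intro!: annulusI)
    note d = zeta_q_derivs[OF xa x0 q q1] and p = phi_q_deriv[OF xa q q1]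
    show "x \<in> {t. norm q < norm t \<and> norm t < 1 \<and> norm q < norm (t * 1)}" "x \<noteq> 0" using x by auto
    show "zeta_q 1 q t - zeta_q 0 q t ^ 2 = 2 * phi_q 0 q t - 1 / 4 + (1 - eisP q) / 12"
      if "t \<in> {t. norm q < norm t \<and> norm t < 1 \<and> norm q < norm (t * 1)}" for t
      using zeta_q_square[OF q, of t] that by simp
    show "((\<lambda>t. zeta_q 1 q t - zeta_q 0 q t ^ 2) has_field_derivative
       (zeta_q 2 q x - 2 * zeta_q 0 q x * zeta_q 1 q x) / x) (at x)"
      by (rule DERIV_cong[OF DERIV_diff[OF d(2) DERIV_power[OF d(1)]]]) (simp add: diff_divide_distrib)
    show "((\<lambda>t. 2 * phi_q 0 q t - 1 / 4 + (1 - eisP q) / 12) has_field_derivative 2 * phi_q 1 q x / x) (at x)"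
      by (rule DERIV_cong[OF DERIV_add[OF DERIV_diff[OF DERIV_cmult[OF p] DERIV_const] DERIV_const]]) simp
  qed
  from 1[OF x] show ?th1 .
  show ?th2
  proof (rule theta_unique[OF open_norm_conditions[of q 1]])
    have q1: "norm q < 1" and x0: "x \<noteq> 1" using x by auto
    have xa: "x \<in> annulus q" using x by (auto intro!: annulusI)
    note d = zeta_q_derivs[OF xa x0 q q1] and p = phi_q_deriv[OF xa q q1]
    show "x \<in> {t. norm q < norm t \<and> norm t < 1 \<and> norm q < norm (t * 1)}" "x \<noteq> 0" using x by auto
    show "zeta_q 2 q t - 2 * zeta_q 0 q t * zeta_q 1 q t = 2 * phi_q 1 q t"
      if "t \<in> {t. norm q < norm t \<and> norm t < 1 \<and> norm q < norm (t * 1)}" for t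
      using 1[of t] that by simp
    show "((\<lambda>t. zeta_q 2 q t - 2 * zeta_q 0 q t * zeta_q 1 q t) has_field_derivative
       (zeta_q 3 q x - 2 * zeta_q 1 q x ^ 2 - 2 * zeta_q 0 q x * zeta_q 2 q x) / x) (at x)"
      by (rule DERIV_cong[OF DERIV_diff[OF d(3) DERIV_mult[OF DERIV_cmult[OF d(1)] d(2)]]])
        (simp add: divide_inverse algebra_simps power2_eq_square)
    show "((\<lambda>t. 2 * phi_q 1 q t) has_field_derivative 2 * phi_q 2 q x / x) (at x)"
      by (rule DERIV_cong[OF DERIV_cmult[OF p]]) (simp add: numeral_2_eq_2)
  qed
qed

subsection \<open>Values at sixth roots of unity\<close>

lemma radial_tendsto:
  assumes "norm x = 1" "x \<noteq> 1" "q \<noteq> 0" "norm q < 1" "(c \<longlongrightarrow> 1) (at_left (1 :: real))"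
  shows "((\<lambda>t. zeta_q k q (complex_of_real (c t) * x)) \<longlongrightarrow> zeta_q k q x) (at_left 1)"
proof (rule isCont_tendsto_compose[OF isCont_zeta_q])
  show "x \<in> annulus q" using assms by (intro annulusI) auto
  have "((\<lambda>t. complex_of_real (c t) * x) \<longlongrightarrow> complex_of_real 1 * x) (at_left 1)"
    by (intro tendsto_intros assms)
  then show "((\<lambda>t. complex_of_real (c t) * x) \<longlongrightarrow> x) (at_left 1)" by simp
qed (use assms in auto)

lemma radial_tendsto_phi:
  assumes "norm x = 1" "q \<noteq> 0" "norm q < 1"
  shows "((\<lambda>t. phi_q k q (complex_of_real t * x)) \<longlongrightarrow> phi_q k q x) (at_left 1)"
proof (rule isCont_tendsto_compose[OF isCont_phi_q])
  show "x \<in> annulus q" using assms by (intro annulusI) auto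
  have "((\<lambda>t. complex_of_real t * x) \<longlongrightarrow> complex_of_real 1 * x) (at_left 1)"
    by (intro tendsto_intros)
  then show "((\<lambda>t. complex_of_real t * x) \<longlongrightarrow> x) (at_left 1)" by simp
qed (use assms in auto)

context
  fixes q x y :: complex
  assumes q: "q \<noteq> 0" "norm q < 1" and x: "norm x = 1" "x \<noteq> 1" and y: "norm y = 1" "y \<noteq> 1"
    and xy: "x * y \<noteq> 1"
begin

private lemma radial_limits:
  "((\<lambda>t. zeta_q k q (complex_of_real t * x)) \<longlongrightarrow> zeta_q k q x) (at_left 1)"
  "((\<lambda>t. zeta_q k q (complex_of_real t * y)) \<longlongrightarrow> zeta_q k q y) (at_left 1)"
  "((\<lambda>t. zeta_q k q (complex_of_real t * x * (complex_of_real t * y))) \<longlongrightarrow> zeta_q k q (x * y)) (at_left 1)"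
proof -
  have "((\<lambda>t. t * t) \<longlongrightarrow> 1 * 1) (at_left (1 :: real))" by (intro tendsto_intros)
  then have "((\<lambda>t. zeta_q k q (complex_of_real (t * t) * (x * y))) \<longlongrightarrow> zeta_q k q (x * y)) (at_left 1)"
    using q x y xy by (intro radial_tendsto) (auto simp: norm_mult)
  then show "((\<lambda>t. zeta_q k q (complex_of_real t * x * (complex_of_real t * y))) \<longlongrightarrow> zeta_q k q (x * y)) (at_left 1)"
    by (simp add: mult_ac)
qed (intro radial_tendsto q x y tendsto_ident_at)+

private lemma radial_conditions:
  "\<forall>\<^sub>F t in at_left 1. norm q < norm (complex_of_real t * x) \<and> norm (complex_of_real t * x) < 1 \<and>
     norm q < norm (complex_of_real t * y) \<and> norm (complex_of_real t * y) < 1 \<and>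
     norm q < norm (complex_of_real t * x * (complex_of_real t * y))"
  using eventually_at_left_1[OF q(2)] by eventually_elim (use x y in \<open>auto simp: norm_mult\<close>)

private lemma radial_eqI:
  assumes "(f \<longlongrightarrow> a) (at_left (1 :: real))" "(g \<longlongrightarrow> b) (at_left 1)" "\<forall>\<^sub>F t in at_left 1. f t = (g t :: complex)"
  shows "a = b"
  using tendsto_unique[OF _ assms(1) tendsto_cong[OF assms(3), THEN iffD2, OF assms(2)]] by simp

text \<open>The bilateral expansions fail for |x| = 1, but away from x = 1 both sides of each
  identity are continuous across the circle. The identities at t x and t y therefore pass to the
  limit as t increases to 1.\<close>

lemma zeta_q_addition_circle:
  "(zeta_q 0 q x + zeta_q 0 q y - zeta_q 0 q (x * y)) ^ 2
     = zeta_q 1 q x + zeta_q 1 q y + zeta_q 1 q (x * y) + eisP q / 4"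
  "2 * (zeta_q 0 q x + zeta_q 0 q y - zeta_q 0 q (x * y)) * (zeta_q 1 q x - zeta_q 1 q (x * y))
     = zeta_q 2 q x + zeta_q 2 q (x * y)"
  "2 * (zeta_q 1 q x - zeta_q 1 q (x * y)) * (zeta_q 1 q y - zeta_q 1 q (x * y))
     - 2 * (zeta_q 0 q x + zeta_q 0 q y - zeta_q 0 q (x * y)) * zeta_q 2 q (x * y) = zeta_q 3 q (x * y)"
  "zeta_q 2 q x - 2 * zeta_q 0 q x * zeta_q 1 q x = 2 * phi_q 1 q x"
  "zeta_q 3 q x - 2 * zeta_q 1 q x ^ 2 - 2 * zeta_q 0 q x * zeta_q 2 q x = 2 * phi_q 2 q x"
proof -
  let ?x = "\<lambda>t. complex_of_real t * x" and ?y = "\<lambda>t. complex_of_real t * y"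
  have "\<forall>\<^sub>F t in at_left 1. (zeta_q 0 q (?x t) + zeta_q 0 q (?y t) - zeta_q 0 q (?x t * ?y t)) ^ 2 = zeta_q 1 q (?x t) + zeta_q 1 q (?y t) + zeta_q 1 q (?x t * ?y t) + eisP q / 4"
    using radial_conditions by eventually_elim (use zeta_q_addition[OF q(1)] in blast)
  then show "(zeta_q 0 q x + zeta_q 0 q y - zeta_q 0 q (x * y)) ^ 2 = zeta_q 1 q x + zeta_q 1 q y + zeta_q 1 q (x * y) + eisP q / 4"
    by (rule radial_eqI[rotated 2]) (intro tendsto_intros radial_limits radial_tendsto_phi q x)+
  have "\<forall>\<^sub>F t in at_left 1. 2 * (zeta_q 0 q (?x t) + zeta_q 0 q (?y t) - zeta_q 0 q (?x t * ?y t)) * (zeta_q 1 q (?x t) - zeta_q 1 q (?x t * ?y t)) = zeta_q 2 q (?x t) + zeta_q 2 q (?x t * ?y t)"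
    using radial_conditions by eventually_elim (use zeta_q_addition_D[OF q(1)] in blast)
  then show "2 * (zeta_q 0 q x + zeta_q 0 q y - zeta_q 0 q (x * y)) * (zeta_q 1 q x - zeta_q 1 q (x * y)) = zeta_q 2 q x + zeta_q 2 q (x * y)"
    by (rule radial_eqI[rotated 2]) (intro tendsto_intros radial_limits radial_tendsto_phi q x)+
  have "\<forall>\<^sub>F t in at_left 1. 2 * (zeta_q 1 q (?x t) - zeta_q 1 q (?x t * ?y t)) * (zeta_q 1 q (?y t) - zeta_q 1 q (?x t * ?y t))
     - 2 * (zeta_q 0 q (?x t) + zeta_q 0 q (?y t) - zeta_q 0 q (?x t * ?y t)) * zeta_q 2 q (?x t * ?y t) = zeta_q 3 q (?x t * ?y t)"
    using radial_conditions by eventually_elim (use zeta_q_addition_DD[OF q(1)] in blast)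
  then show "2 * (zeta_q 1 q x - zeta_q 1 q (x * y)) * (zeta_q 1 q y - zeta_q 1 q (x * y))
     - 2 * (zeta_q 0 q x + zeta_q 0 q y - zeta_q 0 q (x * y)) * zeta_q 2 q (x * y) = zeta_q 3 q (x * y)"
    by (rule radial_eqI[rotated 2]) (intro tendsto_intros radial_limits radial_tendsto_phi q x)+
  have "\<forall>\<^sub>F t in at_left 1. zeta_q 2 q (?x t) - 2 * zeta_q 0 q (?x t) * zeta_q 1 q (?x t) = 2 * phi_q 1 q (?x t)"
    using radial_conditions by eventually_elim (use zeta_q_heat(1)[OF q(1)] in blast)
  then show "zeta_q 2 q x - 2 * zeta_q 0 q x * zeta_q 1 q x = 2 * phi_q 1 q x"
    by (rule radial_eqI[rotated 2]) (intro tendsto_intros radial_limits radial_tendsto_phi q x)+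
  have "\<forall>\<^sub>F t in at_left 1. zeta_q 3 q (?x t) - 2 * zeta_q 1 q (?x t) ^ 2 - 2 * zeta_q 0 q (?x t) * zeta_q 2 q (?x t) = 2 * phi_q 2 q (?x t)"
    using radial_conditions by eventually_elim (use zeta_q_heat(2)[OF q(1)] in blast)
  then show "zeta_q 3 q x - 2 * zeta_q 1 q x ^ 2 - 2 * zeta_q 0 q x * zeta_q 2 q x = 2 * phi_q 2 q x"
    by (rule radial_eqI[rotated 2]) (intro tendsto_intros radial_limits radial_tendsto_phi q x)+
qed

end

section \<open>The primitive sixth root of unity and the parity of S\<close>

definition \<omega> :: complex where "\<omega> = Complex (1 / 2) (sqrt 3 / 2)"

lemma omega_sq: "\<omega> ^ 2 = \<omega> - 1"
  by (simp add: \<omega>_def complex_eq_iff power2_eq_square)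

lemma norm_omega: "norm \<omega> = 1"
  by (simp add: \<omega>_def cmod_def power_divide)

lemma omega_neq: "\<omega> \<noteq> 1" "\<omega> \<noteq> 0" "\<omega> ^ 2 \<noteq> 1" "\<omega> \<noteq> - 1"
  by (simp_all add: omega_sq) (simp_all add: \<omega>_def complex_eq_iff)

lemma omega_powers: "\<omega> * \<omega> ^ 2 = - 1" "\<omega> ^ 2 * \<omega> ^ 2 = inverse (\<omega> ^ 2)" "inverse \<omega> = 1 - \<omega>" "\<omega> ^ 6 = 1"
proof -
  show 1: "\<omega> * \<omega> ^ 2 = - 1" using omega_sq by algebra
  have "\<omega> ^ 2 * \<omega> ^ 2 * \<omega> ^ 2 = 1" using omega_sq by algebra
  then show "\<omega> ^ 2 * \<omega> ^ 2 = inverse (\<omega> ^ 2)" by (metis inverse_unique mult.commute)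
  have "\<omega> * (1 - \<omega>) = 1" using omega_sq by algebra
  then show "inverse \<omega> = 1 - \<omega>" by (rule inverse_unique)
  show "\<omega> ^ 6 = 1" using omega_sq by algebra
qed

lemma cot_part_inverse:
  assumes "x \<noteq> 0" "x \<noteq> 1"
  shows "cot_part 0 (inverse x) = - cot_part 0 x" "cot_part 1 (inverse x) = cot_part 1 x"
    "cot_part 2 (inverse x) = - cot_part 2 x" "cot_part 3 (inverse x) = cot_part 3 x"
proof -
  have i: "1 - inverse x = - ((1 - x) / x)" "1 - x \<noteq> 0" using assms by (auto simp: field_simps)
  show "cot_part 0 (inverse x) = - cot_part 0 x"
    using assms i(2) by (simp add: i(1)) (simp add: field_simps)
  show "cot_part 1 (inverse x) = cot_part 1 x"
    using assms i(2) by (simp add: i(1) power_divide power2_eq_square)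
  show "cot_part 2 (inverse x) = - cot_part 2 x"
    using assms i(2) unfolding numeral_2_eq_2 cot_part.simps i(1)
    by (simp add: power_divide power3_eq_cube) (simp add: field_simps)
  show "cot_part 3 (inverse x) = cot_part 3 x"
    using assms i(2) unfolding numeral_3_eq_3 cot_part.simps i(1)
    by (simp add: power_divide power4_eq_xxxx power2_eq_square) (simp add: field_simps)
qed

lemma two_sided_inverse: "\<sigma> * \<sigma> = 1 \<Longrightarrow> two_sided c \<sigma> (inverse x) = \<sigma> * two_sided c \<sigma> x"
  by (simp add: two_sided_def algebra_simps flip: mult.assoc)

lemma zeta_q_inverse:
  assumes "x \<noteq> 0" "x \<noteq> 1"
  shows "zeta_q 0 q (inverse x) = - zeta_q 0 q x" "zeta_q 1 q (inverse x) = zeta_q 1 q x"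
    "zeta_q 2 q (inverse x) = - zeta_q 2 q x" "zeta_q 3 q (inverse x) = zeta_q 3 q x"
  unfolding zeta_q_def cot_part_inverse[OF assms] by (simp_all add: two_sided_inverse)

text \<open>These two forms of weight one generate the ring of modular forms for $\Gamma_1(6)$, so every identity
  below becomes a polynomial identity in them and the Eisenstein series $P$.\<close>

definition r_form :: "complex \<Rightarrow> complex" where "r_form q = zeta_q 0 q \<omega>"
definition s_form :: "complex \<Rightarrow> complex" where "s_form q = zeta_q 0 q (\<omega> ^ 2)"

text \<open>The pairs from \<omega> and \<omega>^2 have products \<omega>^2, -1 and \<omega>^(-2).
  Oddness gives S(-1) = 0 and S(\<omega>^(-2)) = -s, so the addition formula becomes three linear
  equations for S' at \<omega>, \<omega>^2 and -1. Its derivatives then give S'' and S''', and the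
  heat relations give \<open>phi_q\<close>.\<close>

lemma torsion_relations:
  assumes q: "q \<noteq> 0" "norm q < 1"
  defines "r \<equiv> r_form q" and "s \<equiv> s_form q" and "P \<equiv> eisP q"
  shows "zeta_q 1 q \<omega> = 2 * r ^ 2 - 2 * r * s - s ^ 2 - P / 12"
    and "zeta_q 1 q (\<omega> ^ 2) = 3 * s ^ 2 - P / 12"
    and "zeta_q 1 q (- 1) = - (r ^ 2) + 4 * r * s - s ^ 2 - P / 12"
    and "phi_q 1 q \<omega> = r * P / 12 + r * (r ^ 2 - r * s - 5 * s ^ 2)"
    and "phi_q 1 q (\<omega> ^ 2) = s * P / 12 + r ^ 3 - 3 * r ^ 2 * s + s ^ 3"
    and "phi_q 2 q (\<omega> ^ 2) = 4 * s * (r + s) * (r - 2 * s) ^ 2 - (3 * s ^ 2 - P / 12) ^ 2"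
proof -
  have n: "norm \<omega> = 1" "norm (\<omega> ^ 2) = 1" by (simp_all add: norm_power norm_omega)
  have m1: "zeta_q 0 q (- 1) = 0" "zeta_q 2 q (- 1) = 0"
    using zeta_q_inverse(1,3)[of "-1" q] by (simp_all add: eq_neg_iff_add_eq_0)
  have w4: "inverse (\<omega> ^ 2) \<noteq> 1" "\<omega> ^ 2 \<noteq> 0" using omega_neq by (auto simp: inverse_eq_1_iff)
  note inv = zeta_q_inverse[OF w4(2) omega_neq(3), of q]
  have w2: "\<omega> * \<omega> = \<omega> ^ 2" by (simp add: power2_eq_square)
  note w3 = omega_powers(1) omega_powers(1)[unfolded mult.commute[of \<omega>]]
  have ne: "\<omega> * \<omega> \<noteq> 1" "\<omega> * \<omega> ^ 2 \<noteq> 1" "\<omega> ^ 2 * \<omega> \<noteq> 1" "\<omega> ^ 2 * \<omega> ^ 2 \<noteq> 1"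
    unfolding w2 w3 omega_powers(2) using omega_neq w4 by auto
  note A11 = zeta_q_addition_circle[OF q n(1) omega_neq(1) n(1) omega_neq(1) ne(1), unfolded w2]
  note A12 = zeta_q_addition_circle[OF q n(1) omega_neq(1) n(2) omega_neq(3) ne(2), unfolded w3 m1]
  note A21 = zeta_q_addition_circle[OF q n(2) omega_neq(3) n(1) omega_neq(1) ne(3), unfolded w3 m1]
  note A22 = zeta_q_addition_circle[OF q n(2) omega_neq(3) n(2) omega_neq(3) ne(4), unfolded omega_powers(2) inv]
  define p where "p = P / 12"
  have P: "eisP q / 4 = 3 * p" by (simp add: p_def P_def)
  define e1 e2 e3 where e: "e1 = zeta_q 1 q \<omega>" "e2 = zeta_q 1 q (\<omega> ^ 2)" "e3 = zeta_q 1 q (- 1)"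
  note f = r_def[unfolded r_form_def, symmetric] s_def[unfolded s_form_def, symmetric] e[symmetric]
  have "(3 * s) ^ 2 = 3 * e2 + 3 * p" using A22(1) unfolding P f by simp
  then have "3 * e2 = 3 * (3 * s ^ 2 - p)" by algebra
  then have E2: "e2 = 3 * s ^ 2 - p" by (simp only: mult_cancel_left) simp
  have "(2 * r - s) ^ 2 = 2 * e1 + e2 + 3 * p" using A11(1) unfolding P f by simp
  then have "2 * e1 = 2 * (2 * r ^ 2 - 2 * r * s - s ^ 2 - p)" unfolding E2 by algebra
  then have E1: "e1 = 2 * r ^ 2 - 2 * r * s - s ^ 2 - p" by (simp only: mult_cancel_left) simp
  have "(r + s) ^ 2 = e1 + e2 + e3 + 3 * p" using A12(1) unfolding P f by simp
  then have E3: "e3 = - (r ^ 2) + 4 * r * s - s ^ 2 - p" unfolding E1 E2 by algebra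
  have D1: "zeta_q 2 q \<omega> = 2 * (r + s) * (e1 - e3)" using A12(2) unfolding f by simp
  have D2: "zeta_q 2 q (\<omega> ^ 2) = 2 * (r + s) * (e2 - e3)" using A21(2) unfolding f by (simp add: algebra_simps)
  \<comment> \<open>For x = y = \<omega>^2 the product of first differences vanishes because S' is
    even, and S + S - S(\<omega>^(-2)) is 3 s.\<close>
  have DD2: "zeta_q 3 q (\<omega> ^ 2) = 6 * s * zeta_q 2 q (\<omega> ^ 2)" using A22(3) unfolding f by simp
  show "e1 = 2 * r ^ 2 - 2 * r * s - s ^ 2 - P / 12" "e2 = 3 * s ^ 2 - P / 12"
    "e3 = - (r ^ 2) + 4 * r * s - s ^ 2 - P / 12"
    using E1 E2 E3 unfolding p_def .
  have "2 * phi_q 1 q \<omega> = 2 * (r * p + r * (r ^ 2 - r * s - 5 * s ^ 2))"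
    using A11(4) unfolding D1 f E1 E3 by algebra
  then show "phi_q 1 q \<omega> = r * P / 12 + r * (r ^ 2 - r * s - 5 * s ^ 2)"
    unfolding p_def mult_cancel_left by simp
  have "2 * phi_q 1 q (\<omega> ^ 2) = 2 * (s * p + r ^ 3 - 3 * r ^ 2 * s + s ^ 3)"
    using A22(4) unfolding D2 f E2 E3 by algebra
  then show "phi_q 1 q (\<omega> ^ 2) = s * P / 12 + r ^ 3 - 3 * r ^ 2 * s + s ^ 3"
    unfolding p_def mult_cancel_left by simp
  have "2 * phi_q 2 q (\<omega> ^ 2) = 2 * (4 * s * (r + s) * (r - 2 * s) ^ 2 - (3 * s ^ 2 - p) ^ 2)"
    using A22(5) unfolding DD2 D2 f E2 E3 by algebra
  then show "phi_q 2 q (\<omega> ^ 2) = 4 * s * (r + s) * (r - 2 * s) ^ 2 - (3 * s ^ 2 - P / 12) ^ 2"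
    unfolding p_def mult_cancel_left by simp
qed

subsection \<open>Differentiation in the nome\<close>

text \<open>At q = 0 the equation for q * d says nothing about d, so the derivative there is
  recorded separately; it later fixes the leading coefficient of y z.\<close>

lemma lambert_deriv:
  fixes a :: "nat \<Rightarrow> complex"
  assumes a: "\<And>r. 0 \<le> r \<Longrightarrow> r < 1 \<Longrightarrow> summable (\<lambda>n. norm (a n) * r ^ n)" and q: "norm q < 1"
  shows "\<exists>d. ((\<lambda>q. \<Sum>n. a n * (q ^ n / (1 - q ^ n))) has_field_derivative d) (at q)
           \<and> q * d = (\<Sum>n. of_nat n * a n * (q ^ n / (1 - q ^ n) ^ 2)) \<and> (q = 0 \<longrightarrow> d = a 1)"
proof -
  define r where "r = (norm q + 1) / 2"
  have r: "norm q < r" "r < 1" "0 \<le> r" using q by (auto simp: r_def)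
  let ?f = "\<lambda>n q. a n * (q ^ n / (1 - q ^ n))"
  let ?f' = "\<lambda>n q. a n * (of_nat n * q ^ (n - 1) / (1 - q ^ n) ^ 2)"
  have der: "(?f n has_field_derivative ?f' n x) (at x)" if "x \<in> ball 0 r" for n x
  proof (cases "n = 0")
    case False
    have "1 - x ^ n \<noteq> 0" using power_neq_1[of x n] that r False by simp
    then show ?thesis
      by (auto intro!: derivative_eq_intros simp: divide_simps power2_eq_square) (simp add: algebra_simps)
  qed simp
  have bound: "\<forall>\<^sub>F n in sequentially. \<forall>x\<in>ball 0 r. norm (?f n x) \<le> norm (a n) * r ^ n / (1 - r)"
    using eventually_gt_at_top[of 0]
  proof eventually_elim
    case (elim n)
    show ?case
    proof
      fix x :: complex assume "x \<in> ball 0 r"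
      then have x: "norm x \<le> r" by simp
      have "norm x ^ n / norm (1 - x ^ n) \<le> r ^ n / (1 - r)"
        using norm_one_minus_power_ge[OF x r(2) elim] x r by (intro frac_le power_mono) auto
      then show "norm (?f n x) \<le> norm (a n) * r ^ n / (1 - r)"
        using mult_left_mono[of _ _ "norm (a n)"] by (fastforce simp: norm_mult norm_divide norm_power)
    qed
  qed
  have "summable (\<lambda>n. norm (a n) * r ^ n / (1 - r))"
    using a[of r] r by (intro summable_divide) auto
  then obtain g g' where g: "\<forall>x\<in>ball 0 r. (\<lambda>n. ?f n x) sums g x \<and> (\<lambda>n. ?f' n x) sums g' x
      \<and> (g has_field_derivative g' x) (at x)"
    using series_and_derivative_comparison[OF open_ball _ der bound] by blast
  have qr: "q \<in> ball 0 r" using r by simp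
  have "(g has_field_derivative g' q) (at q)" using g qr by blast
  then have "((\<lambda>q. \<Sum>n. ?f n q) has_field_derivative g' q) (at q)"
    by (rule has_field_derivative_transform_within_open[OF _ open_ball qr]) (use g sums_unique in blast)
  moreover have "q * g' q = (\<Sum>n. of_nat n * a n * (q ^ n / (1 - q ^ n) ^ 2))"
  proof -
    have "(\<lambda>n. q * ?f' n q) sums (q * g' q)"
      using g qr by (intro sums_mult) auto
    moreover have "q * ?f' n q = of_nat n * a n * (q ^ n / (1 - q ^ n) ^ 2)" for n
      by (cases n) simp_all
    ultimately have "(\<lambda>n. of_nat n * a n * (q ^ n / (1 - q ^ n) ^ 2)) sums (q * g' q)" by (simp only:)
    then show ?thesis by (rule sums_unique)
  qed
  moreover have "g' q = a 1" if "q = 0"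
  proof -
    have "?f' n q = (if n = 1 then a n else 0)" for n
      using that by (auto simp: power_0_left)
    moreover have "(\<lambda>n. ?f' n q) sums g' q" using g qr by blast
    ultimately have "(\<lambda>n. if n = 1 then a n else 0) sums g' q" by simp
    then show ?thesis using sums_single[of 1 a] sums_unique2 by blast
  qed
  ultimately show ?thesis by blast
qed

lemma lau_coeffs_1_power: "lau_coeffs 1 (\<lambda>n. of_nat n ^ k)"
proof (induction k)
  case 0
  show ?case by (simp add: lau_coeffs_def summable_geometric)
next
  case (Suc k)
  from lau_coeffs_of_nat_mult[OF this] show ?case by simp
qed

lemma two_sided_unit_circle:
  assumes c: "lau_coeffs q c" and "norm q < 1" "norm x = 1"
  shows "(\<lambda>n. c n * (x ^ n + \<sigma> * inverse x ^ n)) sums two_sided c \<sigma> x"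
proof -
  have "(\<lambda>n. c n * x ^ n + \<sigma> * (c n * inverse x ^ n)) sums two_sided c \<sigma> x"
    unfolding two_sided_def using assms
    by (intro sums_add sums_mult summable_sums) (auto simp: lau_coeffs_def norm_inverse)
  then show ?thesis by (simp add: algebra_simps)
qed

text \<open>On the unit circle x^n and x^(-n) are bounded, so for fixed x the function is a Lambert
  series in q on the whole unit disc and can be differentiated termwise.\<close>

lemma zeta_q_theta:
  assumes x: "norm x = 1" and q: "norm q < 1"
  shows "\<exists>d. ((\<lambda>q. zeta_q k q x) has_field_derivative d) (at q) \<and> q * d = phi_q (Suc k) q x
           \<and> (q = 0 \<and> k = 0 \<longrightarrow> d = x - inverse x)"
proof -
  define a where "a = (\<lambda>n. of_nat n ^ k * (x ^ n + - ((-1) ^ k) * inverse x ^ n))"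
  have "summable (\<lambda>n. norm (a n) * r ^ n)" if r: "0 \<le> r" "r < 1" for r :: real
  proof (rule summable_comparison_test'[where N = 0])
    show "summable (\<lambda>n. 2 * norm (of_nat n ^ k * complex_of_real r ^ n))"
      using r by (intro summable_mult lau_coeffs_norm_summable[OF lau_coeffs_1_power]) auto
    fix n
    have "norm (x ^ n + - ((-1) ^ k) * inverse x ^ n) \<le> 2"
      using norm_triangle_ineq[of "x ^ n" "- ((-1) ^ k) * inverse x ^ n"] x
      by (simp add: norm_mult norm_power norm_inverse norm_divide)
    then show "norm (norm (a n) * r ^ n) \<le> 2 * norm (of_nat n ^ k * complex_of_real r ^ n)"
      using r mult_right_mono[of "norm (x ^ n + - ((-1) ^ k) * inverse x ^ n)" 2 "real n ^ k * r ^ n"]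
      unfolding a_def norm_mult norm_power by (simp add: mult_ac)
  qed
  from lambert_deriv[of a, OF this q] obtain d where
    d: "((\<lambda>q. \<Sum>n. a n * (q ^ n / (1 - q ^ n))) has_field_derivative d) (at q)"
      "q * d = (\<Sum>n. of_nat n * a n * (q ^ n / (1 - q ^ n) ^ 2))" "q = 0 \<longrightarrow> d = a 1" by blast
  have eq: "cot_part k x + (\<Sum>n. a n * (q ^ n / (1 - q ^ n))) = zeta_q k q x" if "norm q < 1" for q
    using two_sided_unit_circle[OF lau_coeffs_lam[of q 1 k] that x, of "- ((-1) ^ k)"] that
    by (simp add: zeta_q_def sums_iff a_def lam_def mult_ac)
  have "((\<lambda>q. cot_part k x + (\<Sum>n. a n * (q ^ n / (1 - q ^ n)))) has_field_derivative 0 + d) (at q)"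
    by (intro DERIV_add DERIV_const d)
  then have "((\<lambda>q. zeta_q k q x) has_field_derivative 0 + d) (at q)"
    by (rule has_field_derivative_transform_within_open[OF _ open_ball[of 0 1]]) (use q in simp, rule eq, simp)
  moreover have "q * d = phi_q (Suc k) q x"
    unfolding d(2) phi_q_def using two_sided_unit_circle[OF lau_coeffs_lam[of q 2 "Suc k"] q x, of "(-1) ^ Suc k"] q
    by (simp add: sums_iff a_def lam_def mult_ac)
  moreover have "q = 0 \<and> k = 0 \<longrightarrow> d = x - inverse x"
    using d(3) by (auto simp: a_def)
  ultimately show ?thesis by auto
qed

lemma summable_lam: "norm q < 1 \<Longrightarrow> i > 0 \<Longrightarrow> summable (lam i k q)"
  using lau_coeffs_lam[of q i k, unfolded lau_coeffs_def, rule_format, of 1] by simp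

lemma lam_multiples_sums:
  assumes q: "norm q < 1" and N: "N > 0"
  shows "(\<lambda>n. if N dvd n then lam 1 1 q n else 0) sums (of_nat N * (\<Sum>n. lam 1 1 (q ^ N) n))"
proof -
  have "norm (q ^ N) < 1" using q N power_less_one_iff[of "norm q" N] by (simp add: norm_power)
  then have "(\<lambda>n. of_nat N * lam 1 1 (q ^ N) n) sums (of_nat N * (\<Sum>n. lam 1 1 (q ^ N) n))"
    by (intro sums_mult summable_sums summable_lam) auto
  moreover have "of_nat N * lam 1 1 (q ^ N) n = (if N dvd N * n then lam 1 1 q (N * n) else 0)" for n
    by (simp add: lam_def power_mult)
  ultimately have "(\<lambda>n. if N dvd N * n then lam 1 1 q (N * n) else 0) sums (of_nat N * (\<Sum>n. lam 1 1 (q ^ N) n))"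
    by simp
  then show ?thesis
    by (subst (asm) sums_mono_reindex[of "\<lambda>n. N * n"]) (use N in \<open>auto simp: strict_mono_def elim!: dvdE\<close>)
qed

text \<open>The additional factor N is the weight with which the indicator of N dvd n occurs in sums
  of roots of unity.\<close>

lemma eisP_multiple:
  assumes q: "norm q < 1" and N: "N > 0"
  shows "(\<lambda>n. of_nat N * (if N dvd n then lam 1 1 q n else 0)) sums (of_nat N ^ 2 * (1 - eisP (q ^ N)) / 24)"
proof -
  have "norm (q ^ N) < 1" using q N power_less_one_iff[of "norm q" N] by (simp add: norm_power)
  then have "(\<Sum>n. lam 1 1 (q ^ N) n) = (1 - eisP (q ^ N)) / 24" by (simp add: eisP_lam)
  then show ?thesis using sums_mult[OF lam_multiples_sums[OF assms], of "of_nat N"]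
    by (simp only: power2_eq_square mult.assoc times_divide_eq_right)
qed

lemma dvd_iff_mod_6:
  fixes n :: nat
  shows "6 dvd n \<longleftrightarrow> n mod 6 = 0" "3 dvd n \<longleftrightarrow> n mod 6 = 0 \<or> n mod 6 = 3"
    "2 dvd n \<longleftrightarrow> n mod 6 = 0 \<or> n mod 6 = 2 \<or> n mod 6 = 4"
  by presburger+

lemma omega_power_mod: "\<omega> ^ n = \<omega> ^ (n mod 6)"
proof -
  have "\<omega> ^ n = (\<omega> ^ 6) ^ (n div 6) * \<omega> ^ (n mod 6)"
    by (metis div_mult_mod_eq mult.commute power_add power_mult)
  then show ?thesis by (simp add: omega_powers)
qed

text \<open>Ramanujan sums: the sum of x^n over the primitive N-th roots of unity x is the sum of
  \<mu>(N/d) d over the d dividing both N and n, here for N = 6 and N = 3. At -1 the single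
  primitive root is counted twice.\<close>

lemma root_of_unity_sums:
  "\<omega> ^ n + inverse \<omega> ^ n = 6 * of_bool (6 dvd n) - 3 * of_bool (3 dvd n) - 2 * of_bool (2 dvd n) + 1"
  "(\<omega> ^ 2) ^ n + inverse (\<omega> ^ 2) ^ n = 3 * of_bool (3 dvd n) - (1 :: complex)"
  "(- 1) ^ n + inverse (- 1) ^ n = 4 * of_bool (2 dvd n) - (2 :: complex)"
proof -
  define k where "k = n mod 6"
  have k: "k = 0 \<or> k = 1 \<or> k = 2 \<or> k = 3 \<or> k = 4 \<or> k = 5" unfolding k_def by presburger
  have w: "\<omega> ^ n = \<omega> ^ k" by (simp add: k_def omega_power_mod[of n])
  have p: "\<omega> ^ 3 = - 1" "\<omega> ^ 4 = - \<omega>" "\<omega> ^ 5 = 1 - \<omega>"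
    using omega_sq by algebra+
  have i: "inverse \<omega> ^ n = inverse (\<omega> ^ k)" by (simp add: power_inverse w)
  have iw: "inverse (1 - \<omega>) = \<omega>" "inverse (\<omega> - 1) = - \<omega>"
    using omega_powers(3) by (metis inverse_inverse_eq, metis inverse_inverse_eq inverse_minus_eq minus_diff_eq)
  show 1: "\<omega> ^ n + inverse \<omega> ^ n = 6 * of_bool (6 dvd n) - 3 * of_bool (3 dvd n) - 2 * of_bool (2 dvd n) + 1"
    unfolding w i dvd_iff_mod_6 k_def[symmetric] using k
    by (elim disjE) (simp_all add: p omega_sq omega_powers(3) iw inverse_minus_eq)
  have w2: "(\<omega> ^ 2) ^ n = (\<omega> ^ k) ^ 2" by (metis power_commutes power_mult mult.commute w)
  have i2: "inverse (\<omega> ^ 2) ^ n = inverse ((\<omega> ^ k) ^ 2)" by (simp add: power_inverse w2)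
  have p2: "(\<omega> - 1) ^ 2 = - \<omega>" "(1 - \<omega>) ^ 2 = - \<omega>" using omega_sq by algebra+
  show "(\<omega> ^ 2) ^ n + inverse (\<omega> ^ 2) ^ n = 3 * of_bool (3 dvd n) - (1 :: complex)"
    unfolding w2 i2 dvd_iff_mod_6 k_def[symmetric] using k
    by (elim disjE) (simp_all add: p p2 omega_sq omega_powers(3) iw inverse_minus_eq)
  show "(- 1) ^ n + inverse (- 1) ^ n = 4 * of_bool (2 dvd n) - (2 :: complex)"
    by (cases "even n") auto
qed

lemma cot_part_omega: "cot_part 1 \<omega> = - 1" "cot_part 1 (\<omega> ^ 2) = - 1 / 3" "cot_part 1 (- 1) = - 1 / 4"
proof -
  have "(1 - \<omega>) ^ 2 = - \<omega>" using omega_sq by algebra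
  then show "cot_part 1 \<omega> = - 1" using omega_neq by simp
  have "(1 - \<omega> ^ 2) ^ 2 = - 3 * \<omega> ^ 2" using omega_sq by algebra
  then show "cot_part 1 (\<omega> ^ 2) = - 1 / 3" using omega_neq by simp
qed simp

text \<open>In S' the Lambert coefficients carry x^n + x^(-n). At these roots of unity this is a
  combination of indicators of d dvd n, and each indicator selects P(q^d).\<close>

lemma zeta_q_1_torsion:
  assumes q: "norm q < 1"
  shows "zeta_q 1 q \<omega> = (9 * eisP (q ^ 3) + 4 * eisP (q ^ 2) - 36 * eisP (q ^ 6) - eisP q) / 24"
    and "zeta_q 1 q (\<omega> ^ 2) = (eisP q - 9 * eisP (q ^ 3)) / 24"
    and "zeta_q 1 q (- 1) = (eisP q - 4 * eisP (q ^ 2)) / 12"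
proof -
  define D where "D = (\<lambda>N n. of_nat N * (if N dvd n then lam 1 1 q n else 0))"
  have D: "D N sums (of_nat N ^ 2 * (1 - eisP (q ^ N)) / 24)" if "N > 0" for N
    unfolding D_def by (rule eisP_multiple[OF q that])
  have Z: "(\<lambda>n. lam 1 1 q n * (x ^ n + 1 * inverse x ^ n)) sums (zeta_q 1 q x - cot_part 1 x)" if "norm x = 1" for x
    using two_sided_unit_circle[OF lau_coeffs_lam[OF q, of 1 1] q that, of 1] by (simp add: zeta_q_def)
  have "zeta_q 1 q \<omega> - cot_part 1 \<omega> = of_nat 6 ^ 2 * (1 - eisP (q ^ 6)) / 24 - of_nat 3 ^ 2 * (1 - eisP (q ^ 3)) / 24
      - of_nat 2 ^ 2 * (1 - eisP (q ^ 2)) / 24 + of_nat 1 ^ 2 * (1 - eisP (q ^ 1)) / 24"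
  proof (rule sums_unique2)
    show "(\<lambda>n. D 6 n - D 3 n - D 2 n + D 1 n) sums (of_nat 6 ^ 2 * (1 - eisP (q ^ 6)) / 24 - of_nat 3 ^ 2 * (1 - eisP (q ^ 3)) / 24
      - of_nat 2 ^ 2 * (1 - eisP (q ^ 2)) / 24 + of_nat 1 ^ 2 * (1 - eisP (q ^ 1)) / 24)"
      by (intro sums_add sums_diff D) auto
    have "lam 1 1 q n * (\<omega> ^ n + 1 * inverse \<omega> ^ n) = D 6 n - D 3 n - D 2 n + D 1 n" for n
      unfolding mult_1 root_of_unity_sums D_def by (simp add: algebra_simps of_bool_def)
    then show "(\<lambda>n. D 6 n - D 3 n - D 2 n + D 1 n) sums (zeta_q 1 q \<omega> - cot_part 1 \<omega>)"
      using Z[OF norm_omega] by simp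
  qed
  then show "zeta_q 1 q \<omega> = (9 * eisP (q ^ 3) + 4 * eisP (q ^ 2) - 36 * eisP (q ^ 6) - eisP q) / 24"
    unfolding cot_part_omega diff_eq_eq by (simp add: diff_divide_distrib add_divide_distrib right_diff_distrib)
  have "zeta_q 1 q (\<omega> ^ 2) - cot_part 1 (\<omega> ^ 2) = of_nat 3 ^ 2 * (1 - eisP (q ^ 3)) / 24 - of_nat 1 ^ 2 * (1 - eisP (q ^ 1)) / 24"
  proof (rule sums_unique2)
    show "(\<lambda>n. D 3 n - D 1 n) sums (of_nat 3 ^ 2 * (1 - eisP (q ^ 3)) / 24 - of_nat 1 ^ 2 * (1 - eisP (q ^ 1)) / 24)"
      by (intro sums_diff D) auto
    have "lam 1 1 q n * ((\<omega> ^ 2) ^ n + 1 * inverse (\<omega> ^ 2) ^ n) = D 3 n - D 1 n" for n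
      unfolding mult_1 root_of_unity_sums D_def by (simp add: algebra_simps of_bool_def)
    moreover have "norm (\<omega> ^ 2) = 1" by (simp add: norm_power norm_omega)
    ultimately show "(\<lambda>n. D 3 n - D 1 n) sums (zeta_q 1 q (\<omega> ^ 2) - cot_part 1 (\<omega> ^ 2))"
      using Z[of "\<omega> ^ 2"] by simp
  qed
  then show "zeta_q 1 q (\<omega> ^ 2) = (eisP q - 9 * eisP (q ^ 3)) / 24"
    unfolding cot_part_omega diff_eq_eq by (simp add: diff_divide_distrib add_divide_distrib right_diff_distrib)
  have "zeta_q 1 q (- 1) - cot_part 1 (- 1) = 2 * (of_nat 2 ^ 2 * (1 - eisP (q ^ 2)) / 24) - 2 * (of_nat 1 ^ 2 * (1 - eisP (q ^ 1)) / 24)"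
  proof (rule sums_unique2)
    show "(\<lambda>n. 2 * D 2 n - 2 * D 1 n) sums (2 * (of_nat 2 ^ 2 * (1 - eisP (q ^ 2)) / 24) - 2 * (of_nat 1 ^ 2 * (1 - eisP (q ^ 1)) / 24))"
      by (intro sums_diff sums_mult D) auto
    have "lam 1 1 q n * ((- 1) ^ n + 1 * inverse (- 1) ^ n) = 2 * D 2 n - 2 * D 1 n" for n
      unfolding mult_1 root_of_unity_sums D_def by (simp add: algebra_simps of_bool_def)
    then show "(\<lambda>n. 2 * D 2 n - 2 * D 1 n) sums (zeta_q 1 q (- 1) - cot_part 1 (- 1))"
      using Z[of "- 1"] by simp
  qed
  then show "zeta_q 1 q (- 1) = (eisP q - 4 * eisP (q ^ 2)) / 12"
    unfolding cot_part_omega diff_eq_eq by (simp add: diff_divide_distrib add_divide_distrib right_diff_distrib)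
qed

section \<open>Rules of calculus for q d/dq\<close>

lemma theta_at_const: "theta_at (\<lambda>_. c) q 0"
  unfolding theta_at_def by (rule exI[of _ 0]) simp

lemma theta_at_ident: "theta_at (\<lambda>q. q) q q"
  unfolding theta_at_def by (rule exI[of _ 1]) simp

lemma theta_at_add:
  assumes "theta_at f q a" "theta_at g q b"
  shows "theta_at (\<lambda>q. f q + g q) q (a + b)"
  using assms unfolding theta_at_def by (metis DERIV_add distrib_left)

lemma theta_at_diff:
  assumes "theta_at f q a" "theta_at g q b"
  shows "theta_at (\<lambda>q. f q - g q) q (a - b)"
  using assms unfolding theta_at_def by (metis DERIV_diff right_diff_distrib)

lemma theta_at_mult:
  assumes "theta_at f q a" "theta_at g q b"
  shows "theta_at (\<lambda>q. f q * g q) q (a * g q + f q * b)"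
proof -
  from assms obtain d e where d: "(f has_field_derivative d) (at q)" "q * d = a"
    and e: "(g has_field_derivative e) (at q)" "q * e = b" unfolding theta_at_def by blast
  show ?thesis unfolding theta_at_def
    by (rule exI[of _ "d * g q + e * f q"], rule conjI, rule DERIV_mult[OF d(1) e(1)])
      (simp add: d(2)[symmetric] e(2)[symmetric] algebra_simps)
qed

lemma theta_at_power:
  assumes "theta_at f q a"
  shows "theta_at (\<lambda>q. f q ^ n) q (of_nat n * f q ^ (n - 1) * a)"
proof -
  from assms obtain d where d: "(f has_field_derivative d) (at q)" "q * d = a"
    unfolding theta_at_def by blast
  show ?thesis unfolding theta_at_def
    by (rule exI[of _ "of_nat n * (d * f q ^ (n - Suc 0))"], rule conjI, rule DERIV_power[OF d(1)])
      (simp add: d(2)[symmetric] algebra_simps)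
qed

lemma theta_at_inverse:
  assumes "theta_at f q a" "f q \<noteq> 0"
  shows "theta_at (\<lambda>q. inverse (f q)) q (- a / f q ^ 2)"
proof -
  from assms obtain d where d: "(f has_field_derivative d) (at q)" "q * d = a"
    unfolding theta_at_def by blast
  show ?thesis unfolding theta_at_def
    by (rule exI[of _ "- (d * inverse (f q ^ Suc (Suc 0)))"], rule conjI, rule DERIV_inverse_fun[OF d(1) assms(2)])
      (simp add: d(2)[symmetric] power2_eq_square divide_inverse)
qed

lemma theta_at_arg_power:
  assumes "theta_at f (q ^ N) a" "N > 0"
  shows "theta_at (\<lambda>q. f (q ^ N)) q (of_nat N * a)"
proof -
  from assms obtain d where d: "(f has_field_derivative d) (at (q ^ N))" "q ^ N * d = a"
    unfolding theta_at_def by blast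
  have "((\<lambda>q. f (q ^ N)) has_field_derivative d * (of_nat N * (1 * q ^ (N - Suc 0)))) (at q)"
    by (rule DERIV_chain2[where g = "\<lambda>q. q ^ N", OF d(1)]) (rule DERIV_power[OF DERIV_ident])
  moreover have "q * (d * (of_nat N * (1 * q ^ (N - Suc 0)))) = of_nat N * a"
    using assms(2) unfolding d(2)[symmetric] by (cases N) (simp_all add: algebra_simps)
  ultimately show ?thesis unfolding theta_at_def by blast
qed

lemma theta_at_cong:
  assumes "theta_at f q a" "norm q < 1" "\<And>t. norm t < 1 \<Longrightarrow> f t = g t" "a = b"
  shows "theta_at g q b"
proof -
  from assms obtain d where d: "(f has_field_derivative d) (at q)" "q * d = b"
    unfolding theta_at_def by blast
  have "(g has_field_derivative d) (at q)"
    by (rule has_field_derivative_transform_within_open[OF d(1) open_ball[of 0 1]]) (use assms in auto)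
  then show ?thesis using d(2) unfolding theta_at_def by blast
qed

text \<open>With the derivative in the form f * a, logarithmic derivatives add, which handles an eta
  quotient factor by factor without a logarithm.\<close>

lemma theta_at_log_mult:
  assumes "theta_at f q (f q * a)" "theta_at g q (g q * b)"
  shows "theta_at (\<lambda>q. f q * g q) q (f q * g q * (a + b))"
  using theta_at_mult[OF assms] by (simp add: algebra_simps)

lemma theta_at_log_power:
  assumes "theta_at f q (f q * a)" "n > 0"
  shows "theta_at (\<lambda>q. f q ^ n) q (f q ^ n * (of_nat n * a))"
  using theta_at_power[OF assms(1), of n] assms(2) by (cases n) (simp_all add: algebra_simps)

lemma theta_at_log_divide:
  assumes "theta_at f q (f q * a)" "theta_at g q (g q * b)" "g q \<noteq> 0"
  shows "theta_at (\<lambda>q. f q / g q) q (f q / g q * (a - b))"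
  using theta_at_mult[OF assms(1) theta_at_inverse[OF assms(2,3)]] assms(3)
  by (simp add: divide_inverse power2_eq_square algebra_simps)

subsection \<open>The differential ring generated by $r$, $s$ and $P$\<close>

lemma zeta_q_0: "zeta_q k 0 x = cot_part k x" "phi_q k 0 x = 0"
proof -
  have "lam i k 0 n = 0" if "i > 0" for i n
    using that by (cases n) (simp_all add: lam_def)
  then show "zeta_q k 0 x = cot_part k x" "phi_q k 0 x = 0"
    by (simp_all add: zeta_q_def phi_q_def two_sided_def)
qed

lemma eisP_0: "eisP 0 = 1"
  by (simp add: eisP_def)

text \<open>Only the cotangent part survives at q = 0: s = (i/2) cot(pi/3) = i / (2 sqrt 3) and r =
  (i/2) cot(pi/6) = i sqrt 3 / 2. These values are the origin of the negative constants -4 and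
  -12.\<close>

lemma forms_0: "s_form 0 = \<omega> / (2 * (2 - \<omega>))" "r_form 0 = 3 * s_form 0" "s_form 0 ^ 2 = - 1 / 12"
proof -
  have nz: "1 - \<omega> \<noteq> 0" "2 - \<omega> \<noteq> 0" "\<omega> \<noteq> 0"
    using omega_neq by (auto simp: \<omega>_def complex_eq_iff)
  show s: "s_form 0 = \<omega> / (2 * (2 - \<omega>))"
    by (simp add: s_form_def zeta_q_0 omega_sq)
  have "(1 + \<omega>) * (2 * (2 - \<omega>)) = 3 * \<omega> * (2 * (1 - \<omega>))" using omega_sq by algebra
  then have "(1 + \<omega>) / (2 * (1 - \<omega>)) = 3 * \<omega> / (2 * (2 - \<omega>))"
    by (rule frac_eq_eq[THEN iffD2, rotated 2]) (use nz in simp_all)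
  then show "r_form 0 = 3 * s_form 0"
    unfolding s by (simp add: r_form_def zeta_q_0)
  have "(2 * (2 - \<omega>)) ^ 2 = - 12 * \<omega> ^ 2" using omega_sq by algebra
  then show "s_form 0 ^ 2 = - 1 / 12" unfolding s power_divide using nz by simp
qed

text \<open>The bilateral expansion excludes q = 0; there the relations are checked on the explicit
  values of the forms.\<close>

lemma torsion_relations_disc:
  assumes q: "norm q < 1"
  defines "r \<equiv> r_form q" and "s \<equiv> s_form q" and "P \<equiv> eisP q"
  shows "zeta_q 1 q \<omega> = 2 * r ^ 2 - 2 * r * s - s ^ 2 - P / 12"
    and "zeta_q 1 q (\<omega> ^ 2) = 3 * s ^ 2 - P / 12"
    and "zeta_q 1 q (- 1) = - (r ^ 2) + 4 * r * s - s ^ 2 - P / 12"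
    and "phi_q 1 q \<omega> = r * P / 12 + r * (r ^ 2 - r * s - 5 * s ^ 2)"
    and "phi_q 1 q (\<omega> ^ 2) = s * P / 12 + r ^ 3 - 3 * r ^ 2 * s + s ^ 3"
    and "phi_q 2 q (\<omega> ^ 2) = 4 * s * (r + s) * (r - 2 * s) ^ 2 - (3 * s ^ 2 - P / 12) ^ 2"
proof -
  consider "q \<noteq> 0" | "q = 0" by blast
  then have "zeta_q 1 q \<omega> = 2 * r ^ 2 - 2 * r * s - s ^ 2 - P / 12 \<and>
     zeta_q 1 q (\<omega> ^ 2) = 3 * s ^ 2 - P / 12 \<and>
     zeta_q 1 q (- 1) = - (r ^ 2) + 4 * r * s - s ^ 2 - P / 12 \<and>
     phi_q 1 q \<omega> = r * P / 12 + r * (r ^ 2 - r * s - 5 * s ^ 2) \<and>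
     phi_q 1 q (\<omega> ^ 2) = s * P / 12 + r ^ 3 - 3 * r ^ 2 * s + s ^ 3 \<and>
     phi_q 2 q (\<omega> ^ 2) = 4 * s * (r + s) * (r - 2 * s) ^ 2 - (3 * s ^ 2 - P / 12) ^ 2"
  proof cases
    case 1
    then show ?thesis unfolding r_def s_def P_def using torsion_relations[OF 1 q] by blast
  next
    case 2
    have r: "r = 3 * s" and s2: "s * s = - 1 / 12" and P: "P = 1"
      using forms_0 by (simp_all add: r_def s_def P_def 2 eisP_0 power2_eq_square)
    have s3: "s * (s * c) = - c / 12" for c using s2 by (simp flip: mult.assoc)
    have *: "cot_part 1 \<omega> = - 1" "cot_part 1 (\<omega> ^ 2) = - 1 / 3" "cot_part 1 (- 1) = - 1 / 4"
      by (rule cot_part_omega)+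
    show ?thesis
      unfolding 2 zeta_q_0 * r P
      by (simp add: power2_eq_square power3_eq_cube algebra_simps s2 s3)
  qed
  then show "zeta_q 1 q \<omega> = 2 * r ^ 2 - 2 * r * s - s ^ 2 - P / 12"
     "zeta_q 1 q (\<omega> ^ 2) = 3 * s ^ 2 - P / 12"
     "zeta_q 1 q (- 1) = - (r ^ 2) + 4 * r * s - s ^ 2 - P / 12"
     "phi_q 1 q \<omega> = r * P / 12 + r * (r ^ 2 - r * s - 5 * s ^ 2)"
     "phi_q 1 q (\<omega> ^ 2) = s * P / 12 + r ^ 3 - 3 * r ^ 2 * s + s ^ 3"
     "phi_q 2 q (\<omega> ^ 2) = 4 * s * (r + s) * (r - 2 * s) ^ 2 - (3 * s ^ 2 - P / 12) ^ 2"
    by blast+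
qed

definition r_theta :: "complex \<Rightarrow> complex" where
  "r_theta q = r_form q * eisP q / 12 + r_form q * (r_form q ^ 2 - r_form q * s_form q - 5 * s_form q ^ 2)"

definition s_theta :: "complex \<Rightarrow> complex" where
  "s_theta q = s_form q * eisP q / 12 + r_form q ^ 3 - 3 * r_form q ^ 2 * s_form q + s_form q ^ 3"

text \<open>Solving S'(\<omega>^2) = 3 s^2 - P / 12 for P and applying q d/dq, with
  \<open>phi_q 2 q (\<omega> ^ 2)\<close> replaced by its polynomial.\<close>

definition P_theta :: "complex \<Rightarrow> complex" where
  "P_theta q = 72 * s_form q * s_theta q
     - 12 * (4 * s_form q * (r_form q + s_form q) * (r_form q - 2 * s_form q) ^ 2 - (3 * s_form q ^ 2 - eisP q / 12) ^ 2)"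

lemma norm_omega_sq: "norm (\<omega> ^ 2) = 1"
  by (simp add: norm_power norm_omega)

lemma theta_at_r_form: "norm q < 1 \<Longrightarrow> theta_at r_form q (r_theta q)"
  using zeta_q_theta[OF norm_omega, of q 0] torsion_relations_disc(4)[of q]
  unfolding theta_at_def r_theta_def r_form_def[abs_def] by auto

lemma theta_at_s_form: "norm q < 1 \<Longrightarrow> theta_at s_form q (s_theta q)"
  using zeta_q_theta[OF norm_omega_sq, of q 0] torsion_relations_disc(5)[of q]
  unfolding theta_at_def s_theta_def s_form_def[abs_def] by auto

lemma theta_at_eisP:
  assumes q: "norm q < 1"
  shows "theta_at eisP q (P_theta q)"
proof -
  have E: "theta_at (\<lambda>q. zeta_q 1 q (\<omega> ^ 2)) q (phi_q 2 q (\<omega> ^ 2))"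
    using zeta_q_theta[OF norm_omega_sq q, of 1] unfolding theta_at_def by (auto simp: numeral_2_eq_2)
  have "theta_at (\<lambda>q. 36 * s_form q ^ 2 - 12 * zeta_q 1 q (\<omega> ^ 2)) q
     (0 * s_form q ^ 2 + 36 * (of_nat 2 * s_form q ^ (2 - 1) * s_theta q)
       - (0 * zeta_q 1 q (\<omega> ^ 2) + 12 * phi_q 2 q (\<omega> ^ 2)))"
    by (intro theta_at_diff theta_at_mult theta_at_const theta_at_power theta_at_s_form q E)
  then show ?thesis
  proof (rule theta_at_cong[OF _ q])
    show "36 * s_form t ^ 2 - 12 * zeta_q 1 t (\<omega> ^ 2) = eisP t" if "norm t < 1" for t
      unfolding torsion_relations_disc(2)[OF that] by simp
    show "0 * s_form q ^ 2 + 36 * (of_nat 2 * s_form q ^ (2 - 1) * s_theta q)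
       - (0 * zeta_q 1 q (\<omega> ^ 2) + 12 * phi_q 2 q (\<omega> ^ 2)) = P_theta q"
      unfolding torsion_relations_disc(6)[OF q] P_theta_def by simp
  qed
qed

text \<open>S' at \<omega>, \<omega>^2 and -1 is known both as a combination of the P(q^d) and as a
  polynomial in r, s and P. Equating the two gives a linear system, solved in the order d = 2, 3,
  6.\<close>

lemma eisP_multiples:
  assumes q: "norm q < 1"
  defines "r \<equiv> r_form q" and "s \<equiv> s_form q" and "P \<equiv> eisP q"
  shows "eisP (q ^ 2) = (P - 6 * (- (r ^ 2) + 4 * r * s - s ^ 2)) / 2"
    and "eisP (q ^ 3) = (P - 24 * s ^ 2) / 3"
    and "eisP (q ^ 6) = (P - 6 * (r ^ 2 + s ^ 2)) / 6"
proof -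
  note z = zeta_q_1_torsion[OF q] and t = torsion_relations_disc(1-3)[OF q, folded r_def s_def P_def]
  define a b c where abc: "a = eisP (q ^ 2)" "b = eisP (q ^ 3)" "c = eisP (q ^ 6)"
  have *: "u = k * (w - P / 12)" if "u / k = w - P / 12" "k \<noteq> 0" for u w k
    using that by (simp add: divide_eq_eq mult.commute)
  have "P - 4 * a = 12 * ((- (r ^ 2) + 4 * r * s - s ^ 2) - P / 12)"
    using z(3) t(3) unfolding P_def[symmetric] abc by (intro *) simp_all
  then have "P - 4 * a = 12 * (- (r ^ 2) + 4 * r * s - s ^ 2) - P" by (simp add: right_diff_distrib)
  then have "2 * (2 * a) = 2 * (P - 6 * (- (r ^ 2) + 4 * r * s - s ^ 2))" by algebra
  then have P2: "2 * a = P - 6 * (- (r ^ 2) + 4 * r * s - s ^ 2)" by (simp only: mult_cancel_left) simp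
  show "eisP (q ^ 2) = (P - 6 * (- (r ^ 2) + 4 * r * s - s ^ 2)) / 2"
    unfolding abc[symmetric] P2[symmetric] by simp
  have "P - 9 * b = 24 * (3 * s ^ 2 - P / 12)"
    using z(2) t(2) unfolding P_def[symmetric] abc by (intro *) simp_all
  then have "P - 9 * b = 72 * s ^ 2 - 2 * P" by (simp add: right_diff_distrib)
  then have "3 * (3 * b) = 3 * (P - 24 * s ^ 2)" by algebra
  then have P3: "3 * b = P - 24 * s ^ 2" by (simp only: mult_cancel_left) simp
  show "eisP (q ^ 3) = (P - 24 * s ^ 2) / 3"
    unfolding abc[symmetric] P3[symmetric] by simp
  have "9 * b + 4 * a - 36 * c - P = 24 * ((2 * r ^ 2 - 2 * r * s - s ^ 2) - P / 12)"
    using z(1) t(1) unfolding P_def[symmetric] abc by (intro *) simp_all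
  then have "9 * b + 4 * a - 36 * c - P = 24 * (2 * r ^ 2 - 2 * r * s - s ^ 2) - 2 * P"
    by (simp add: right_diff_distrib)
  then have "6 * (6 * c) = 6 * (P - 6 * (r ^ 2 + s ^ 2))" using P2 P3 by algebra
  then have P6: "6 * c = P - 6 * (r ^ 2 + s ^ 2)" by (simp only: mult_cancel_left) simp
  show "eisP (q ^ 6) = (P - 6 * (r ^ 2 + s ^ 2)) / 6"
    unfolding abc[symmetric] P6[symmetric] by simp
qed

subsection \<open>Eta quotients\<close>

definition euler :: "complex \<Rightarrow> complex" where
  "euler q = (\<Prod>j. 1 - q ^ Suc j)"

lemma convergent_prod_euler: "norm (q :: complex) < 1 \<Longrightarrow> convergent_prod (\<lambda>j. 1 - q ^ Suc j)"
  by (intro abs_convergent_prod_imp_convergent_prod summable_imp_abs_convergent_prod)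
     (simp add: norm_mult norm_power summable_geometric summable_mult)

lemma one_minus_power_nz: "norm (q :: complex) < 1 \<Longrightarrow> 1 - q ^ Suc j \<noteq> 0"
  using power_neq_1[of q "Suc j"] by auto

lemma euler_nz: "norm q < 1 \<Longrightarrow> euler q \<noteq> 0"
  unfolding euler_def by (intro prodinf_nonzero convergent_prod_euler one_minus_power_nz)

lemma euler_uniform_limit:
  assumes r: "r < 1"
  shows "uniform_limit (cball 0 r) (\<lambda>N x. \<Prod>j<N. 1 - x ^ Suc j) euler sequentially"
proof -
  have "uniformly_convergent_on (cball 0 r) (\<lambda>N x :: complex. \<Sum>j<N. norm (1 - x ^ Suc j - 1))"
  proof (cases "r < 0")
    case True
    then show ?thesis by simp
  next
    case False
    show ?thesis
    proof (rule Weierstrass_m_test'_ev)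
      show "\<forall>\<^sub>F n in sequentially. \<forall>x\<in>cball 0 r. norm (norm (1 - x ^ Suc n - 1 :: complex)) \<le> r ^ Suc n"
        by (intro always_eventually allI ballI) (simp add: norm_mult norm_power mult_mono power_mono False del: power_Suc)
      show "summable (\<lambda>n. r ^ Suc n)"
        using r False by (simp add: summable_geometric summable_mult)
    qed
  qed
  then have "uniformly_convergent_on (cball 0 r) (\<lambda>N x :: complex. \<Prod>j<N. 1 - x ^ Suc j)"
    by (intro uniformly_convergent_on_prod' continuous_intros) auto
  then have "uniform_limit (cball 0 r) (\<lambda>N x :: complex. \<Prod>j<N. 1 - x ^ Suc j) (\<lambda>x. lim (\<lambda>N. \<Prod>j<N. 1 - x ^ Suc j)) sequentially"
    by (simp only: uniformly_convergent_uniform_limit_iff)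
  moreover have "lim (\<lambda>N. \<Prod>j<N. 1 - x ^ Suc j) = euler x" if "x \<in> cball 0 r" for x :: complex
    using that r unfolding euler_def
    by (intro prodinf_eq_lim'[symmetric] convergent_prod_euler one_minus_power_nz) auto
  ultimately show ?thesis unfolding uniform_limit_iff by (simp del: power_Suc)
qed

text \<open>Locally uniform convergence permits termwise logarithmic differentiation of the product,
  and the resulting Lambert series is the one in P.\<close>

lemma theta_at_euler:
  assumes q: "norm q < 1"
  shows "theta_at euler q (euler q * ((eisP q - 1) / 24))"
proof -
  define r where "r = (norm q + 1) / 2"
  have r: "norm q < r" "r < 1" using q by (auto simp: r_def)
  let ?f = "\<lambda>j x :: complex. 1 - x ^ Suc j"
  have lim: "uniform_limit (ball 0 r) (\<lambda>N x. \<Prod>j<N. ?f j x) euler sequentially"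
    by (rule uniform_limit_on_subset[OF euler_uniform_limit[OF r(2)]]) auto
  have qr: "q \<in> ball 0 r" using r by simp
  have "(\<lambda>j. deriv (?f j) q / ?f j q) sums (deriv euler q / euler q)"
    by (rule logderiv_prodinf_complex_uniform_limit[OF lim _ euler_nz[OF q] open_ball qr]) (intro holomorphic_intros)
  moreover have "deriv (?f j) q = - (of_nat (Suc j) * q ^ j)" for j
    by (rule DERIV_imp_deriv) (auto intro!: derivative_eq_intros simp del: power_Suc)
  ultimately have "(\<lambda>j. - (of_nat (Suc j) * q ^ j) / ?f j q) sums (deriv euler q / euler q)"
    by (simp only:)
  then have "(\<lambda>j. (- q) * (- (of_nat (Suc j) * q ^ j) / ?f j q)) sums ((- q) * (deriv euler q / euler q))"
    by (rule sums_mult)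
  moreover have "(- q) * (- (of_nat (Suc j) * q ^ j) / ?f j q) = of_nat (Suc j) * q ^ Suc j / (1 - q ^ Suc j)" for j
    by (simp add: algebra_simps)
  ultimately have "(\<lambda>j. of_nat (Suc j) * q ^ Suc j / (1 - q ^ Suc j)) sums ((- q) * (deriv euler q / euler q))"
    by (simp only:)
  then have "eisP q = 1 - 24 * ((- q) * (deriv euler q / euler q))"
    unfolding eisP_def by (simp only: sums_unique[symmetric])
  then have *: "q * deriv euler q = euler q * ((eisP q - 1) / 24)"
    using euler_nz[OF q] by (simp add: field_simps)
  have "euler holomorphic_on ball 0 r"
  proof (rule holomorphic_uniform_sequence[OF open_ball])
    show "(\<lambda>x. \<Prod>j<N. ?f j x) holomorphic_on ball 0 r" for N by (intro holomorphic_intros)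
    show "\<exists>d>0. cball x d \<subseteq> ball 0 r \<and> uniform_limit (cball x d) (\<lambda>N x. \<Prod>j<N. ?f j x) euler sequentially"
      if "x \<in> ball 0 r" for x
      using that uniform_limit_on_subset[OF lim] open_contains_cball_eq[OF open_ball] by metis
  qed
  then have "(euler has_field_derivative deriv euler q) (at q)"
    using holomorphic_derivI[OF _ open_ball qr] by blast
  then show ?thesis using * unfolding theta_at_def by blast
qed

lemma norm_power_less_1: "norm (q :: complex) < 1 \<Longrightarrow> N > 0 \<Longrightarrow> norm (q ^ N) < 1"
  using power_less_one_iff[of "norm q" N] by (simp add: norm_power)

lemma prod_quotient_euler:
  assumes q: "norm q < 1" and pos: "a > 0" "b > 0" "c > 0" "d > 0"
  shows "(\<Prod>j. ((1 - q ^ (a * Suc j)) ^ k * (1 - q ^ (b * Suc j)) ^ k) / ((1 - q ^ (c * Suc j)) ^ l * (1 - q ^ (d * Suc j)) ^ l))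
     = (euler (q ^ a) ^ k * euler (q ^ b) ^ k) / (euler (q ^ c) ^ l * euler (q ^ d) ^ l)"
proof -
  have conv: "convergent_prod (\<lambda>j. (1 - q ^ (N * Suc j)) ^ k)"
    and eq: "(\<Prod>j. (1 - q ^ (N * Suc j)) ^ k) = euler (q ^ N) ^ k" if "N > 0" for N k
    using convergent_prod_euler[OF norm_power_less_1[OF q that]]
    unfolding euler_def by (simp_all only: power_mult convergent_prod_power prodinf_power)
  show ?thesis
    using pos by (simp only: prodinf_divide[symmetric] prodinf_mult[symmetric] convergent_prod_mult conv eq)
qed

lemma z6_euler:
  assumes q: "norm q < 1"
  shows "z6 q = (euler (q ^ 1) ^ 4 * euler (q ^ 3) ^ 4) / (euler (q ^ 2) ^ 2 * euler (q ^ 6) ^ 2)"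
  using prod_quotient_euler[OF q, of 1 3 2 6 4 2] unfolding z6_def by simp

text \<open>y vanishes at q = 0 and cannot stand in a denominator there. This is y without its
  factor q, which lowers the logarithmic derivative by 1.\<close>

definition y6_unit :: "complex \<Rightarrow> complex" where
  "y6_unit q = (euler (q ^ 2) ^ 6 * euler (q ^ 6) ^ 6) / (euler (q ^ 1) ^ 6 * euler (q ^ 3) ^ 6)"

lemma y6_euler:
  assumes q: "norm q < 1"
  shows "y6 q = q * y6_unit q"
  using prod_quotient_euler[OF q, of 2 6 1 3 6 6] unfolding y6_def y6_unit_def by simp

lemma theta_at_euler_power:
  assumes q: "norm q < 1" and N: "N > 0"
  shows "theta_at (\<lambda>q. euler (q ^ N)) q (euler (q ^ N) * (of_nat N * (eisP (q ^ N) - 1) / 24))"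
  using theta_at_arg_power[OF theta_at_euler[OF norm_power_less_1[OF q N]] N] by (simp add: mult_ac)

lemma theta_at_z6:
  assumes q: "norm q < 1"
  shows "theta_at z6 q (z6 q * ((eisP q + 3 * eisP (q ^ 3) - eisP (q ^ 2) - 3 * eisP (q ^ 6)) / 6))"
proof -
  note [simp] = euler_nz[OF norm_power_less_1[OF q]]
  have "theta_at (\<lambda>q. (euler (q ^ 1) ^ 4 * euler (q ^ 3) ^ 4) / (euler (q ^ 2) ^ 2 * euler (q ^ 6) ^ 2)) q
     ((euler (q ^ 1) ^ 4 * euler (q ^ 3) ^ 4) / (euler (q ^ 2) ^ 2 * euler (q ^ 6) ^ 2) *
       ((of_nat 4 * (of_nat 1 * (eisP (q ^ 1) - 1) / 24) + of_nat 4 * (of_nat 3 * (eisP (q ^ 3) - 1) / 24))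
         - (of_nat 2 * (of_nat 2 * (eisP (q ^ 2) - 1) / 24) + of_nat 2 * (of_nat 6 * (eisP (q ^ 6) - 1) / 24))))"
    by (intro theta_at_log_divide theta_at_log_mult theta_at_log_power theta_at_euler_power q) simp_all
  then show ?thesis
    by (rule theta_at_cong[OF _ q]) (simp_all add: z6_euler q field_simps)
qed

lemma theta_at_y6_unit:
  assumes q: "norm q < 1"
  shows "theta_at y6_unit q (y6_unit q * ((2 * eisP (q ^ 2) + 6 * eisP (q ^ 6) - eisP q - 3 * eisP (q ^ 3)) / 4 - 1))"
proof -
  note [simp] = euler_nz[OF norm_power_less_1[OF q]] euler_nz[OF q]
  have "theta_at (\<lambda>q. (euler (q ^ 2) ^ 6 * euler (q ^ 6) ^ 6) / (euler (q ^ 1) ^ 6 * euler (q ^ 3) ^ 6)) q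
     ((euler (q ^ 2) ^ 6 * euler (q ^ 6) ^ 6) / (euler (q ^ 1) ^ 6 * euler (q ^ 3) ^ 6) *
       ((of_nat 6 * (of_nat 2 * (eisP (q ^ 2) - 1) / 24) + of_nat 6 * (of_nat 6 * (eisP (q ^ 6) - 1) / 24))
         - (of_nat 6 * (of_nat 1 * (eisP (q ^ 1) - 1) / 24) + of_nat 6 * (of_nat 3 * (eisP (q ^ 3) - 1) / 24))))"
    by (intro theta_at_log_divide theta_at_log_mult theta_at_log_power theta_at_euler_power q) simp_all
  then show ?thesis
    by (rule theta_at_cong[OF _ q]) (simp_all add: y6_unit_def field_simps)
qed

section \<open>Recognising functions by their logarithmic derivatives\<close>

lemma same_fps_eventually_eq:
  assumes "f has_fps_expansion F" "g has_fps_expansion F"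
  shows "\<forall>\<^sub>F q in nhds 0. f q = g q"
proof -
  have "\<forall>\<^sub>F q in nhds 0. eval_fps F q = f q" "\<forall>\<^sub>F q in nhds 0. eval_fps F q = g q"
    using assms by (auto simp: has_fps_expansion_def)
  then show ?thesis by eventually_elim simp
qed

lemma has_theta_0_imp_const:
  assumes "has_theta f (\<lambda>_. 0)"
  shows "\<forall>\<^sub>F q in nhds 0. f q = f 0"
proof -
  define F where "F = fps_expansion f 0"
  have F: "f has_fps_expansion F"
    unfolding F_def by (rule analytic_at_imp_has_fps_expansion_0[OF has_theta_analytic[OF assms]])
  have "(\<lambda>_. 0) has_fps_expansion fps_XD F" by (rule has_theta_fps[OF assms F])
  then have "fps_XD F = 0" using has_fps_expansion_0 fps_expansion_unique_complex by blast
  then have nth: "fps_nth F n = 0" if "n \<noteq> 0" for n using fps_XD_nth[of F n] that by simp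
  have "F = fps_const (fps_nth F 0)"
  proof (rule fps_ext)
    show "fps_nth F n = fps_nth (fps_const (fps_nth F 0)) n" for n by (cases "n = 0") (simp_all add: nth)
  qed
  moreover have "f 0 = fps_nth F 0" by (rule has_fps_expansion_imp_0_eq_fps_nth_0[OF F])
  ultimately have "f has_fps_expansion fps_const (f 0)" using F by simp
  then show ?thesis using has_fps_expansion_const same_fps_eventually_eq by blast
qed

text \<open>Comparing coefficients gives n f_n = f_n. This is the companion of the constant case for
  a quotient whose denominator lacks the factor q.\<close>

lemma has_theta_self_imp_linear:
  assumes "has_theta f f"
  shows "\<forall>\<^sub>F q in nhds 0. f q = deriv f 0 * q"
proof -
  define F where "F = fps_expansion f 0"
  have F: "f has_fps_expansion F"
    unfolding F_def by (rule analytic_at_imp_has_fps_expansion_0[OF has_theta_analytic[OF assms]])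
  have "f has_fps_expansion fps_XD F" by (rule has_theta_fps[OF assms F])
  then have XD: "fps_XD F = F" using F fps_expansion_unique_complex by blast
  have nth: "fps_nth F n = 0" if "n \<noteq> 1" for n
  proof -
    have "of_nat n * fps_nth F n = fps_nth F n" using fps_XD_nth[of F n] unfolding XD by simp
    then have "(of_nat n - 1) * fps_nth F n = 0" by (simp add: algebra_simps)
    then show ?thesis using that by simp
  qed
  have "F = fps_const (fps_nth F 1) * fps_X"
  proof (rule fps_ext)
    show "fps_nth F n = fps_nth (fps_const (fps_nth F 1) * fps_X) n" for n
      by (cases "n = 1") (simp_all add: nth)
  qed
  moreover have "fps_nth F 1 = deriv f 0" using fps_nth_fps_expansion[OF F, of 1] by simp
  ultimately have "f has_fps_expansion fps_const (deriv f 0) * fps_X" using F by simp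
  moreover have "(\<lambda>q. deriv f 0 * q) has_fps_expansion fps_const (deriv f 0) * fps_X"
    by (intro fps_expansion_intros)
  ultimately show ?thesis by (rule same_fps_eventually_eq)
qed

lemma eventually_unit_disc: "\<forall>\<^sub>F q :: complex in nhds 0. norm q < 1"
  using eventually_nhds_in_open[of "ball 0 1" "0 :: complex"] by simp

lemma has_thetaI: "(\<And>q. norm q < 1 \<Longrightarrow> theta_at f q (f1 q)) \<Longrightarrow> has_theta f f1"
  unfolding has_theta_def using eventually_unit_disc by (rule eventually_mono) simp

text \<open>theta z / z. The summand P / 6 reflects the weight 2 of z; its counterpart
  \<open>y_log\<close> contains no P because y has weight 0.\<close>

definition z_log :: "complex \<Rightarrow> complex" where
  "z_log q = eisP q / 6 - 4 * s_form q ^ 2 + 2 * r_form q * s_form q"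

definition y_log :: "complex \<Rightarrow> complex" where
  "y_log q = 6 * s_form q * (s_form q - r_form q)"

lemma theta_at_z6_form:
  assumes q: "norm q < 1"
  shows "theta_at z6 q (z6 q * z_log q)"
  using theta_at_z6[OF q] unfolding eisP_multiples[OF q]
  by (rule theta_at_cong[OF _ q]) (simp_all add: z_log_def field_simps power2_eq_square)

lemma theta_at_y6_unit_form:
  assumes q: "norm q < 1"
  shows "theta_at y6_unit q (y6_unit q * (y_log q - 1))"
  using theta_at_y6_unit[OF q] unfolding eisP_multiples[OF q]
  by (rule theta_at_cong[OF _ q]) (simp_all add: y_log_def field_simps power2_eq_square)

lemma theta_at_y6:
  assumes q: "norm q < 1"
  shows "theta_at y6 q (y6 q * y_log q)"
proof -
  have "theta_at (\<lambda>q. q) q (q * 1)" using theta_at_ident by simp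
  from theta_at_log_mult[OF this theta_at_y6_unit_form[OF q]]
  show ?thesis by (rule theta_at_cong[OF _ q]) (simp_all add: y6_euler q)
qed

lemma euler_0: "euler 0 = 1"
  by (simp add: euler_def)

lemma values_0: "z6 0 = 1" "y6_unit 0 = 1" "y6 0 = 0"
  by (simp_all add: z6_euler y6_unit_def y6_euler euler_0)

text \<open>A product of two general linear forms covers both quadratic forms below, which are
  therefore written with explicit coefficients 0 and 1.\<close>

lemma theta_at_quad:
  assumes q: "norm q < 1"
  shows "theta_at (\<lambda>q. (a * r_form q + b * s_form q) * (c * r_form q + d * s_form q)) q
    ((a * r_theta q + b * s_theta q) * (c * r_form q + d * s_form q)
      + (a * r_form q + b * s_form q) * (c * r_theta q + d * s_theta q))"
proof -
  have lin: "theta_at (\<lambda>q. a * r_form q + b * s_form q) q (a * r_theta q + b * s_theta q)" for a b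
    using theta_at_add[OF theta_at_mult[OF theta_at_const theta_at_r_form[OF q]] theta_at_mult[OF theta_at_const theta_at_s_form[OF q]], of a b]
    by simp
  show ?thesis by (rule theta_at_mult[OF lin lin])
qed

text \<open>The quotient of the two sides has logarithmic derivative 0. Each of r, r - 2s, r + s and
  r - 3s divides its own theta derivative, so products of them behave like eta quotients. The factor
  -4 gives the value 1 at q = 0, where r = 3s and s^2 = -1/12.\<close>

lemma z6_form: "\<forall>\<^sub>F q in nhds 0. z6 q = - 4 * r_form q * (r_form q - 2 * s_form q)"
proof -
  define T where "T = (\<lambda>q. (- 4 * r_form q + 0 * s_form q) * (1 * r_form q + (- 2) * s_form q))"
  have T: "theta_at T q (T q * z_log q)" if q: "norm q < 1" for q
  proof (rule theta_at_cong[OF theta_at_quad[OF q] q])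
    define p where "p = eisP q / 12"
    have p: "eisP q = 12 * p" by (simp add: p_def)
    show "(- 4 * r_theta q + 0 * s_theta q) * (1 * r_form q + - 2 * s_form q)
      + (- 4 * r_form q + 0 * s_form q) * (1 * r_theta q + - 2 * s_theta q) = T q * z_log q"
      unfolding T_def r_theta_def s_theta_def z_log_def p by simp algebra
  qed (simp add: T_def)
  have nz: "z6 q \<noteq> 0" if q: "norm q < 1" for q
    using euler_nz[OF norm_power_less_1[OF q]] euler_nz[OF q] by (simp add: z6_euler q)
  have "has_theta (\<lambda>q. T q / z6 q) (\<lambda>_. 0)"
    using theta_at_log_divide[OF T theta_at_z6_form nz] by (intro has_thetaI) simp
  moreover have "T 0 = 1"
    using forms_0(3) by (simp add: T_def forms_0(2) power2_eq_square mult.assoc)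
  ultimately have "\<forall>\<^sub>F q in nhds 0. T q / z6 q = 1"
    using has_theta_0_imp_const[of "\<lambda>q. T q / z6 q"] by (simp add: values_0)
  then show ?thesis using eventually_unit_disc
  proof eventually_elim
    case (elim q)
    then have "T q = z6 q" using nz[of q] by (simp add: divide_eq_eq)
    then show ?case by (simp add: T_def)
  qed
qed

lemma forms_deriv_0:
  "(r_form has_field_derivative (2 * \<omega> - 1)) (at 0)" "(s_form has_field_derivative (2 * \<omega> - 1)) (at 0)"
proof -
  have "(r_form has_field_derivative (\<omega> - inverse \<omega>)) (at 0)"
    using zeta_q_theta[OF norm_omega, of 0 0] unfolding r_form_def[abs_def] by auto
  moreover have "\<omega> - inverse \<omega> = 2 * \<omega> - 1" by (simp add: omega_powers)
  ultimately show "(r_form has_field_derivative (2 * \<omega> - 1)) (at 0)" by simp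
  have "(s_form has_field_derivative (\<omega> ^ 2 - inverse (\<omega> ^ 2))) (at 0)"
    using zeta_q_theta[OF norm_omega_sq, of 0 0] unfolding s_form_def[abs_def] by auto
  moreover have "\<omega> ^ 2 - inverse (\<omega> ^ 2) = 2 * \<omega> - 1"
    unfolding omega_powers(2)[symmetric] using omega_sq by algebra
  ultimately show "(s_form has_field_derivative (2 * \<omega> - 1)) (at 0)" by simp
qed

text \<open>Both sides vanish at q = 0, so the factor q is left out of the denominator N. Then T / N
  is fixed by q d/dq, hence linear in q, and its slope is T'(0) = 4.\<close>

lemma y6_z6_form: "\<forall>\<^sub>F q in nhds 0. 4 * (y6 q * z6 q) = (r_form q + s_form q) * (r_form q - 3 * s_form q)"
proof -
  define T where "T = (\<lambda>q. (1 * r_form q + 1 * s_form q) * (1 * r_form q + (- 3) * s_form q))"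
  have T: "theta_at T q (T q * (z_log q + y_log q))" if q: "norm q < 1" for q
  proof (rule theta_at_cong[OF theta_at_quad[OF q] q])
    define p where "p = eisP q / 12"
    have p: "eisP q = 12 * p" by (simp add: p_def)
    show "(1 * r_theta q + 1 * s_theta q) * (1 * r_form q + - 3 * s_form q)
      + (1 * r_form q + 1 * s_form q) * (1 * r_theta q + - 3 * s_theta q) = T q * (z_log q + y_log q)"
      unfolding T_def r_theta_def s_theta_def z_log_def y_log_def p by simp algebra
  qed (simp add: T_def)
  define N where "N = (\<lambda>q. y6_unit q * z6 q)"
  have N: "theta_at N q (N q * (y_log q - 1 + z_log q))" if q: "norm q < 1" for q
    unfolding N_def by (rule theta_at_log_mult[OF theta_at_y6_unit_form[OF q] theta_at_z6_form[OF q]])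
  have nz: "N q \<noteq> 0" if q: "norm q < 1" for q
    using euler_nz[OF norm_power_less_1[OF q]] euler_nz[OF q] by (simp add: N_def z6_euler y6_unit_def q)
  have "has_theta (\<lambda>q. T q / N q) (\<lambda>q. T q / N q)"
    using theta_at_log_divide[OF T N nz] by (intro has_thetaI) simp
  note lin = has_theta_self_imp_linear[OF this]
  obtain e where e: "(N has_field_derivative e) (at 0)" using N[of 0] by (auto simp: theta_at_def)
  have T0: "T 0 = 0" "N 0 = 1" by (simp_all add: T_def N_def forms_0 values_0)
  have "(T has_field_derivative (1 * (2 * \<omega> - 1) + 1 * (2 * \<omega> - 1)) * (1 * r_form 0 + (- 3) * s_form 0)
      + (1 * (2 * \<omega> - 1) + (- 3) * (2 * \<omega> - 1)) * (1 * r_form 0 + 1 * s_form 0)) (at 0)"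
    unfolding T_def by (intro DERIV_mult DERIV_add DERIV_cmult forms_deriv_0)
  \<comment> \<open>As r = 3s at q = 0, only the second product survives; it is 4 because 2\<omega>
    - 1 = i sqrt 3 and s = i / (2 sqrt 3).\<close>
  moreover have "(1 * (2 * \<omega> - 1) + 1 * (2 * \<omega> - 1)) * (1 * r_form 0 + (- 3) * s_form 0)
      + (1 * (2 * \<omega> - 1) + (- 3) * (2 * \<omega> - 1)) * (1 * r_form 0 + 1 * s_form 0) = 4"
  proof -
    have nz: "2 * (2 - \<omega>) \<noteq> 0" by (auto simp: \<omega>_def complex_eq_iff)
    have "- 8 * (2 * \<omega> - 1) * \<omega> = 4 * (2 * (2 - \<omega>))" using omega_sq by algebra
    then have "- 8 * (2 * \<omega> - 1) * (\<omega> / (2 * (2 - \<omega>))) = 4 * (2 * (2 - \<omega>)) / (2 * (2 - \<omega>))"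
      by (simp only: times_divide_eq_right)
    then have "- 8 * (2 * \<omega> - 1) * (\<omega> / (2 * (2 - \<omega>))) = 4"
      by (simp only: nonzero_mult_div_cancel_right[OF nz])
    moreover have "(1 * (2 * \<omega> - 1) + 1 * (2 * \<omega> - 1)) * (1 * r_form 0 + (- 3) * s_form 0)
      + (1 * (2 * \<omega> - 1) + (- 3) * (2 * \<omega> - 1)) * (1 * r_form 0 + 1 * s_form 0) = - 8 * (2 * \<omega> - 1) * s_form 0"
      unfolding forms_0(2) by algebra
    ultimately show ?thesis by (simp only: forms_0(1))
  qed
  ultimately have "(T has_field_derivative 4) (at 0)" by simp
  from DERIV_divide[OF this e] have "((\<lambda>q. T q / N q) has_field_derivative 4) (at 0)"
    by (simp add: T0)
  then have "deriv (\<lambda>q. T q / N q) 0 = 4" by (rule DERIV_imp_deriv)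
  with lin have "\<forall>\<^sub>F q in nhds 0. T q / N q = 4 * q" by simp
  then show ?thesis using eventually_unit_disc
  proof eventually_elim
    case (elim q)
    then have "T q = 4 * q * N q" using nz[of q] by (simp add: divide_eq_eq)
    then show ?case using y6_euler[OF elim(2)] by (simp add: T_def N_def)
  qed
qed

subsection \<open>The three expansions\<close>

definition z_log_theta :: "complex \<Rightarrow> complex" where
  "z_log_theta q = P_theta q / 6 - 8 * s_form q * s_theta q + 2 * (r_theta q * s_form q + r_form q * s_theta q)"

lemma theta_at_z_log:
  assumes q: "norm q < 1"
  shows "theta_at z_log q (z_log_theta q)"
proof -
  have "theta_at (\<lambda>q. (1 / 6) * eisP q - 4 * (s_form q * s_form q) + 2 * (r_form q * s_form q)) q
    ((0 * eisP q + (1 / 6) * P_theta q) - (0 * (s_form q * s_form q) + 4 * (s_theta q * s_form q + s_form q * s_theta q))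
      + (0 * (r_form q * s_form q) + 2 * (r_theta q * s_form q + r_form q * s_theta q)))"
    by (intro theta_at_add theta_at_diff theta_at_mult theta_at_const theta_at_eisP theta_at_s_form theta_at_r_form q)
  then show ?thesis
    by (rule theta_at_cong[OF _ q]) (simp_all add: z_log_def z_log_theta_def power2_eq_square mult.assoc)
qed

definition s_theta2 :: "complex \<Rightarrow> complex" where
  "s_theta2 q = (s_theta q * eisP q + s_form q * P_theta q) / 12 + 3 * r_form q ^ 2 * r_theta q
     - 3 * (2 * r_form q * r_theta q * s_form q + r_form q ^ 2 * s_theta q) + 3 * s_form q ^ 2 * s_theta q"

lemma theta_at_s_theta:
  assumes q: "norm q < 1"
  shows "theta_at s_theta q (s_theta2 q)"
proof -
  have "theta_at (\<lambda>q. (1 / 12) * (s_form q * eisP q) + r_form q ^ 3 - 3 * (r_form q ^ 2 * s_form q) + s_form q ^ 3) q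
    ((0 * (s_form q * eisP q) + (1 / 12) * (s_theta q * eisP q + s_form q * P_theta q))
      + of_nat 3 * r_form q ^ (3 - 1) * r_theta q
      - (0 * (r_form q ^ 2 * s_form q) + 3 * ((of_nat 2 * r_form q ^ (2 - 1) * r_theta q) * s_form q + r_form q ^ 2 * s_theta q))
      + of_nat 3 * s_form q ^ (3 - 1) * s_theta q)"
    by (intro theta_at_add theta_at_diff theta_at_mult theta_at_power theta_at_const theta_at_eisP theta_at_s_form theta_at_r_form q)
  then show ?thesis
    by (rule theta_at_cong[OF _ q]) (simp_all add: s_theta_def s_theta2_def mult.assoc)
qed

text \<open>The constant 16 is the one for which r drops out of z + 16 y z, leaving a multiple of
  s^2.\<close>

lemma Zstar_form:
  "\<forall>\<^sub>F q in nhds 0. Zstar q = - 12 * s_form q ^ 2 \<and> z6 q + 16 * (y6 q * z6 q) = - 12 * s_form q ^ 2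
     \<and> z6 q = - 4 * r_form q * (r_form q - 2 * s_form q)
     \<and> 4 * (y6 q * z6 q) = (r_form q + s_form q) * (r_form q - 3 * s_form q)"
  using z6_form y6_z6_form
proof eventually_elim
  case (elim q)
  have "16 * (y6 q * z6 q) = 4 * ((r_form q + s_form q) * (r_form q - 3 * s_form q))"
    unfolding elim(2)[symmetric] by simp
  then have "z6 q + 16 * (y6 q * z6 q) = - 12 * s_form q ^ 2" unfolding elim(1) by algebra
  moreover have "Zstar q = z6 q + 16 * (y6 q * z6 q)" by (simp add: Zstar_def algebra_simps)
  ultimately show ?case using elim by metis
qed

lemma y6_deriv_0: "deriv y6 0 = 1"
proof -
  obtain d where "(y6_unit has_field_derivative d) (at 0)"
    using theta_at_y6_unit_form[of 0] by (auto simp: theta_at_def)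
  then have "((\<lambda>q. q * y6_unit q) has_field_derivative 1 * y6_unit 0 + d * 0) (at 0)"
    by (intro DERIV_mult DERIV_ident)
  then have "(y6 has_field_derivative 1 * y6_unit 0 + d * 0) (at 0)"
    by (rule has_field_derivative_transform_within_open[OF _ open_ball[of 0 1]]) (simp_all add: y6_euler)
  then show ?thesis by (intro DERIV_imp_deriv) (simp add: values_0)
qed

lemma analytic_of_theta_at: "(\<And>q. norm q < 1 \<Longrightarrow> theta_at f q (f1 q)) \<Longrightarrow> f analytic_on {0}"
  using has_theta_analytic has_thetaI by blast

lemma analytic_forms: "r_form analytic_on {0}" "s_form analytic_on {0}" "y6 analytic_on {0}" "y_log analytic_on {0}"
proof -
  show rs: "r_form analytic_on {0}" "s_form analytic_on {0}"
    by (rule analytic_of_theta_at, rule theta_at_r_form theta_at_s_form, assumption)+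
  show "y6 analytic_on {0}"
    by (rule analytic_of_theta_at, rule theta_at_y6)
  show "y_log analytic_on {0}"
    unfolding y_log_def[abs_def] by (intro analytic_intros rs)
qed

text \<open>W and R have degree at most 3, so each recurrence has at most four terms; the conditions
  account for small N.\<close>

lemma sum_upto_3:
  fixes g :: "nat \<Rightarrow> complex"
  assumes "\<And>k. k > 3 \<Longrightarrow> g k = 0"
  shows "(\<Sum>k\<le>N. g k) = g 0 + (if 1 \<le> N then g 1 else 0) + (if 2 \<le> N then g 2 else 0) + (if 3 \<le> N then g 3 else 0)"
proof -
  have "(\<Sum>k\<le>N. g k) = sum g ({..3} \<inter> {..N})"
    by (rule sum.mono_neutral_right) (auto intro!: assms)
  also have "\<dots> = (\<Sum>k\<le>3. if k \<le> N then g k else 0)"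
    by (subst sum.inter_restrict) simp_all
  finally show ?thesis by (simp add: numeral_3_eq_3 numeral_2_eq_2)
qed

text \<open>z (1 + 16 y) = -12 s^2 and z (1 + 4 y) = -3 (r - s)^2. Their product is the square of
  \<open>y_log\<close>, hence W = (1 + 4 y)(1 + 16 y).\<close>

lemma z6_relations:
  "\<forall>\<^sub>F q in nhds 0. y_log q ^ 2 = z6 q ^ 2 * poly [:1, 20, 64:] (y6 q)"
  "\<forall>\<^sub>F q in nhds 0. 2 * z6 q * (z6 q * z_log q * z_log q + z6 q * z_log_theta q) - 3 * (z6 q * z_log q) ^ 2
     = z6 q ^ 4 * poly [:0, - 8, - 64:] (y6 q)"
proof -
  show "\<forall>\<^sub>F q in nhds 0. y_log q ^ 2 = z6 q ^ 2 * poly [:1, 20, 64:] (y6 q)"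
    using Zstar_form
  proof eventually_elim
    case (elim q)
    define r s z y where "r = r_form q" "s = s_form q" "z = z6 q" "y = y6 q"
    have z: "z = - 4 * r * (r - 2 * s)" "4 * (y * z) = (r + s) * (r - 3 * s)"
      unfolding r_s_z_y_def using elim by blast+
    have "(6 * s * (s - r)) ^ 2 = z ^ 2 + 20 * z * (y * z) + 64 * (y * z) ^ 2"
      using z by algebra
    then show ?case by (simp add: r_s_z_y_def y_log_def power2_eq_square algebra_simps)
  qed
  show "\<forall>\<^sub>F q in nhds 0. 2 * z6 q * (z6 q * z_log q * z_log q + z6 q * z_log_theta q) - 3 * (z6 q * z_log q) ^ 2
     = z6 q ^ 4 * poly [:0, - 8, - 64:] (y6 q)"
    using Zstar_form
  proof eventually_elim
    case (elim q)
    define r s z y p where "r = r_form q" "s = s_form q" "z = z6 q" "y = y6 q" "p = eisP q / 12"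
    have P: "eisP q = 12 * p" by (simp add: r_s_z_y_p_def)
    have z: "z = - 4 * r * (r - 2 * s)" "4 * (y * z) = (r + s) * (r - 3 * s)"
      unfolding r_s_z_y_p_def using elim by blast+
    define rt st where "rt = r * p + r * (r ^ 2 - r * s - 5 * s ^ 2)" and "st = s * p + r ^ 3 - 3 * r ^ 2 * s + s ^ 3"
    define Pt where "Pt = 12 * s * st - 2 * (4 * s * (r + s) * (r - 2 * s) ^ 2 - (3 * s ^ 2 - p) ^ 2)"
    have f: "z_log q = 2 * p - 4 * s ^ 2 + 2 * r * s"
      unfolding z_log_def P by (simp add: r_s_z_y_p_def(1,2))
    have ft: "z_log_theta q = Pt - 8 * s * st + 2 * (rt * s + r * st)"
      unfolding z_log_theta_def Pt_def rt_def st_def P_theta_def r_theta_def s_theta_def P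
      by (simp add: r_s_z_y_p_def(1,2) diff_divide_distrib right_diff_distrib)
    \<comment> \<open>With l = theta z / z the relation is z^2 (2 theta l - l^2) = z^4 R(y).
      Dividing by z^2 leaves an identity of weight 4 in which y occurs only through y z, so it is
      polynomial in r and s; p cancels.\<close>
    have "2 * z_log_theta q - z_log q ^ 2 = - 8 * z * (y * z) - 64 * (y * z) ^ 2"
      unfolding f ft Pt_def rt_def st_def using z by algebra
    then have "z ^ 2 * (2 * z_log_theta q - z_log q ^ 2) = z ^ 2 * (- 8 * z * (y * z) - 64 * (y * z) ^ 2)" by simp
    moreover have "poly [:0, - 8, - 64:] y = - 8 * y - 64 * y ^ 2" by (simp add: power2_eq_square algebra_simps)
    ultimately show ?case unfolding r_s_z_y_p_def(3,4)[symmetric] by algebra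
  qed
qed

lemma has_theta_z6:
  "has_theta z6 (\<lambda>q. z6 q * z_log q)"
  "has_theta (\<lambda>q. z6 q * z_log q) (\<lambda>q. z6 q * z_log q * z_log q + z6 q * z_log_theta q)"
  by (intro has_thetaI theta_at_z6_form theta_at_mult theta_at_z_log; assumption)+

text \<open>After the sign change w_n = (-1)^n u_n and division by 2, the recurrence from W and R is
  that of the Domb numbers. The initial values are w_0 = 1 and w_1 = -4.\<close>

lemma z6_domb: "\<forall>\<^sub>F q in nhds 0. (\<lambda>n. (-1) ^ n * of_nat (domb n) * y6 q ^ n) sums z6 q"
proof -
  obtain w where w: "\<forall>\<^sub>F q in nhds 0. (\<lambda>n. w n * y6 q ^ n) sums z6 q"
    using exists_expansion_in_parameter[OF has_theta_analytic[OF has_theta_z6(1)] analytic_forms(3)] values_0 y6_deriv_0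
    by auto
  have y: "has_theta y6 (\<lambda>q. y6 q * y_log q)" by (intro has_thetaI theta_at_y6)
  have nz: "deriv y6 0 \<noteq> 0" "z6 0 \<noteq> 0" "coeff [:1, 20, 64 :: complex:] 0 \<noteq> 0"
    by (simp_all add: y6_deriv_0 values_0)
  note rec = modular_recurrence[OF y values_0(3) nz(1) analytic_forms(4) has_theta_z6 nz(2,3) z6_relations w]
  have w0: "w 0 = 1" using rec(2) by (simp add: values_0)
  have R: "2 * of_nat N * (of_nat N * of_nat N) * w N
      + (if 1 \<le> N then (2 * of_nat N - 1) * (of_nat N * of_nat (N - 1) * 20 + 8) * w (N - 1) else 0)
      + (if 2 \<le> N then (2 * of_nat N - 2) * (of_nat N * of_nat (N - 2) * 64 + 64) * w (N - 2) else 0) = 0" for N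
  proof -
    define g where "g = (\<lambda>k. (2 * of_nat N - of_nat k) * (of_nat N * of_nat (N - k) * coeff [:1, 20, 64:] k
      - coeff [:0, - 8, - 64:] k) * w (N - k))"
    have g: "g 0 = 2 * of_nat N * (of_nat N * of_nat N) * w N"
      "g 1 = (2 * of_nat N - 1) * (of_nat N * of_nat (N - 1) * 20 + 8) * w (N - 1)"
      "g 2 = (2 * of_nat N - 2) * (of_nat N * of_nat (N - 2) * 64 + 64) * w (N - 2)" "g 3 = 0"
      by (simp_all add: g_def numeral_2_eq_2 numeral_3_eq_3)
    have "k > 3 \<Longrightarrow> g k = 0" for k by (simp add: g_def coeff_eq_0)
    from sum_upto_3[of g, OF this, of N] rec(1)[of N] show ?thesis unfolding g g_def[symmetric] by simp
  qed
  have "w n = (-1) ^ n * of_nat (domb n)" for n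
  proof (induction n rule: less_induct)
    case (less n)
    consider "n = 0" | "n = 1" | m where "n = m + 2" by (metis One_nat_def add_2_eq_Suc' not0_implies_Suc)
    then show ?case
    proof cases
      case 1
      then show ?thesis by (simp add: w0 domb_def)
    next
      case 2
      have "2 * w 1 + 8 = 0" using R[of 1] by (simp add: w0)
      then have "2 * (w 1 + 4) = 0" by algebra
      then have "w 1 + 4 = 0" by (simp only: mult_eq_0_iff) simp
      then have "w 1 = - 4" by (simp only: eq_neg_iff_add_eq_0)
      then show ?thesis using 2 by (simp add: domb_def)
    next
      case 3
      define M :: complex where "M = of_nat m"
      have M: "M + 2 \<noteq> 0" using of_nat_Suc_neq_0 by (simp add: M_def)
      define d where "d = (\<lambda>k. (of_nat (domb k) :: complex))"
      define e :: complex where "e = (-1) ^ m"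
      have "2 * (M + 2) ^ 3 * w (m + 2) + (2 * M + 3) * ((M + 2) * (M + 1) * 20 + 8) * w (m + 1)
          + (2 * M + 2) * ((M + 2) * M * 64 + 64) * w m = 0"
        using R[of "m + 2"] by (simp add: M_def power3_eq_cube algebra_simps)
      moreover have "w (m + 1) = - (e * d (m + 1))" "w m = e * d m"
        using less[of "m + 1"] less[of m] 3 by (simp_all add: d_def e_def)
      moreover have "(M + 2) ^ 3 * d (m + 2)
           = (2 * M + 3) * (10 * (M + 1) ^ 2 + 10 * (M + 1) + 4) * d (m + 1) - 64 * (M + 1) ^ 3 * d m"
        using domb_recurrence[of m] by (simp add: M_def d_def)
      ultimately have "2 * (M + 2) ^ 3 * (w (m + 2) - e * d (m + 2)) = 0" by algebra
      then have "w (m + 2) = e * d (m + 2)" using M by simp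
      then show ?thesis using 3 by (simp add: d_def e_def)
    qed
  qed
  with w show ?thesis by simp
qed

section \<open>The parameter \<open>xstar\<close> and the form -12 s^2\<close>

lemma y6_small: "\<forall>\<^sub>F q in nhds 0. 1 + 16 * y6 q \<noteq> 0"
proof -
  have "isCont y6 0" using analytic_forms(3) analytic_at_imp_isCont by blast
  then have "isCont (\<lambda>q. 1 + 16 * y6 q) 0" by (intro continuous_intros)
  then have "((\<lambda>q. 1 + 16 * y6 q) \<longlongrightarrow> 1) (nhds 0)"
    using values_0 by (simp add: isCont_def tendsto_nhds_iff)
  then show ?thesis by (rule tendsto_imp_eventually_ne) simp
qed

lemma xstar_y6:
  assumes "1 + 16 * y6 q \<noteq> 0"
  shows "1 - 16 * xstar q = 1 / (1 + 16 * y6 q)"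
  using assms by (simp add: xstar_def field_simps)

text \<open>The denominator contributes 16 y / (1 + 16 y) = 16 \<open>xstar\<close> times
  \<open>y_log\<close>.\<close>

lemma has_theta_xstar: "has_theta xstar (\<lambda>q. xstar q * (y_log q * (1 - 16 * xstar q)))"
  unfolding has_theta_def using y6_small eventually_unit_disc
proof eventually_elim
  case (elim q)
  have "theta_at (\<lambda>q. 1 + 16 * y6 q) q (0 + (0 * y6 q + 16 * (y6 q * y_log q)))"
    by (intro theta_at_add theta_at_mult theta_at_const theta_at_y6 elim)
  then have "theta_at (\<lambda>q. 1 + 16 * y6 q) q ((1 + 16 * y6 q) * (16 * y6 q * y_log q / (1 + 16 * y6 q)))"
    using elim(1) by (simp add: mult.assoc)
  from theta_at_log_divide[OF theta_at_y6[OF elim(2)] this elim(1)]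
  have "theta_at xstar q (xstar q * (y_log q - 16 * y6 q * y_log q / (1 + 16 * y6 q)))"
    unfolding xstar_def[abs_def] .
  moreover have "y_log q - 16 * y6 q * y_log q / (1 + 16 * y6 q) = y_log q * (1 - 16 * xstar q)"
    by (simp add: xstar_def algebra_simps)
  ultimately show ?case by simp
qed

lemma xstar_deriv_0: "deriv xstar 0 = 1" "xstar 0 = 0"
proof -
  obtain d where d: "(y6 has_field_derivative d) (at 0)"
    using theta_at_y6[of 0] by (auto simp: theta_at_def)
  then have "d = 1" using y6_deriv_0 DERIV_imp_deriv by auto
  have "((\<lambda>q. 1 + 16 * y6 q) has_field_derivative 0 + 16 * d) (at 0)"
    by (intro DERIV_add DERIV_const DERIV_cmult d)
  from DERIV_divide[OF d this] have "(xstar has_field_derivative 1) (at 0)"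
    unfolding xstar_def[abs_def] by (simp add: values_0 \<open>d = 1\<close>)
  then show "deriv xstar 0 = 1" by (rule DERIV_imp_deriv)
  show "xstar 0 = 0" by (simp add: xstar_def values_0)
qed

lemma has_theta_Zstar:
  "has_theta (\<lambda>q. - 12 * s_form q ^ 2) (\<lambda>q. - 24 * (s_form q * s_theta q))"
  "has_theta (\<lambda>q. - 24 * (s_form q * s_theta q)) (\<lambda>q. - 24 * (s_theta q * s_theta q + s_form q * s_theta2 q))"
proof -
  have "theta_at (\<lambda>q. - 12 * s_form q ^ 2) q (0 * s_form q ^ 2 + - 12 * (of_nat 2 * s_form q ^ (2 - 1) * s_theta q))"
    if "norm q < 1" for q
    by (intro theta_at_mult theta_at_const theta_at_power theta_at_s_form that)
  then show "has_theta (\<lambda>q. - 12 * s_form q ^ 2) (\<lambda>q. - 24 * (s_form q * s_theta q))"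
    by (intro has_thetaI) simp
  have "theta_at (\<lambda>q. - 24 * (s_form q * s_theta q)) q
     (0 * (s_form q * s_theta q) + - 24 * (s_theta q * s_theta q + s_form q * s_theta2 q))" if "norm q < 1" for q
    by (intro theta_at_mult theta_at_const theta_at_s_form theta_at_s_theta that)
  then show "has_theta (\<lambda>q. - 24 * (s_form q * s_theta q)) (\<lambda>q. - 24 * (s_theta q * s_theta q + s_form q * s_theta2 q))"
    by (intro has_thetaI) simp
qed

text \<open>Put x = \<open>xstar\<close>. Then 1 - 12 x = (1 + 4 y) / (1 + 16 y), Z x = y z and Z (1
  - 16 x) = z, so both claims reduce to relations between r, s, z and y z. They are stated with
  \<open>y_log\<close> instead of the logarithmic derivative of x, because they serve x and x (1 -
  16 x)^2 alike.\<close>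

lemma Zstar_relations:
  defines "Z \<equiv> \<lambda>q. - 12 * s_form q ^ 2"
  shows "\<forall>\<^sub>F q in nhds 0. y_log q ^ 2 = Z q ^ 2 * (1 - 12 * xstar q)"
    and "\<forall>\<^sub>F q in nhds 0. 2 * Z q * (- 24 * (s_theta q * s_theta q + s_form q * s_theta2 q))
           - 3 * (- 24 * (s_form q * s_theta q)) ^ 2 = Z q ^ 4 * (24 * (xstar q * (1 - 16 * xstar q) ^ 2))"
proof -
  have xy: "\<forall>\<^sub>F q in nhds 0. xstar q * (1 + 16 * y6 q) = y6 q \<and> (1 - 16 * xstar q) * (1 + 16 * y6 q) = 1
      \<and> (1 - 12 * xstar q) * (1 + 16 * y6 q) = 1 + 4 * y6 q \<and> (1 + 16 * y6 q) \<noteq> 0"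
    using y6_small
  proof eventually_elim
    case (elim q)
    then have x: "xstar q * (1 + 16 * y6 q) = y6 q" by (simp add: xstar_def)
    have lin: "(1 - c * xstar q) * (1 + 16 * y6 q) = (1 + 16 * y6 q) - c * (xstar q * (1 + 16 * y6 q))" for c
      by (simp add: algebra_simps)
    have "(1 - 16 * xstar q) * (1 + 16 * y6 q) = 1" unfolding lin x by simp
    moreover have "(1 - 12 * xstar q) * (1 + 16 * y6 q) = 1 + 4 * y6 q" unfolding lin x by simp
    ultimately show ?case using elim x by blast
  qed
  show "\<forall>\<^sub>F q in nhds 0. y_log q ^ 2 = Z q ^ 2 * (1 - 12 * xstar q)"
    using Zstar_form xy
  proof eventually_elim
    case (elim q)
    define r s z y x where "r = r_form q" "s = s_form q" "z = z6 q" "y = y6 q" "x = xstar q"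
    have z: "z = - 4 * r * (r - 2 * s)" "4 * (y * z) = (r + s) * (r - 3 * s)" "z + 16 * (y * z) = - 12 * s ^ 2"
      and x: "(1 - 12 * x) * (1 + 16 * y) = 1 + 4 * y"
      unfolding r_s_z_y_x_def using elim by blast+
    have Zs: "- 12 * s ^ 2 = z * (1 + 16 * y)" using z(3) by algebra
    have "(6 * s * (s - r)) ^ 2 = - 12 * s ^ 2 * (z + 4 * (y * z))" unfolding z(2) using z(1) by algebra
    also have "\<dots> = - 12 * s ^ 2 * (z * (1 + 4 * y))" by (simp add: algebra_simps)
    also have "\<dots> = - 12 * s ^ 2 * (z * (1 + 16 * y)) * (1 - 12 * x)" using x by algebra
    finally show ?case unfolding Zs[symmetric] by (simp add: Z_def r_s_z_y_x_def y_log_def power2_eq_square mult.assoc)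
  qed
  show "\<forall>\<^sub>F q in nhds 0. 2 * Z q * (- 24 * (s_theta q * s_theta q + s_form q * s_theta2 q))
           - 3 * (- 24 * (s_form q * s_theta q)) ^ 2 = Z q ^ 4 * (24 * (xstar q * (1 - 16 * xstar q) ^ 2))"
    using Zstar_form xy
  proof eventually_elim
    case (elim q)
    define r s z y x p where "r = r_form q" "s = s_form q" "z = z6 q" "y = y6 q" "x = xstar q" "p = eisP q / 12"
    have P: "eisP q = 12 * p" by (simp add: r_s_z_y_x_p_def)
    have z: "z = - 4 * r * (r - 2 * s)" "4 * (y * z) = (r + s) * (r - 3 * s)" "z + 16 * (y * z) = - 12 * s ^ 2"
      and x: "x * (1 + 16 * y) = y" "(1 - 16 * x) * (1 + 16 * y) = 1"
      unfolding r_s_z_y_x_p_def using elim by blast+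
    have Zs: "- 12 * s ^ 2 = z * (1 + 16 * y)" using z(3) by algebra
    have Zx: "(- 12 * s ^ 2) * x = y * z" "(- 12 * s ^ 2) * (1 - 16 * x) = z"
      unfolding Zs mult.assoc mult.commute[of "1 + 16 * y"] x by simp_all
    define rt st where "rt = r * p + r * (r ^ 2 - r * s - 5 * s ^ 2)" and "st = s * p + r ^ 3 - 3 * r ^ 2 * s + s ^ 3"
    define Pt where "Pt = 6 * s * st - (4 * s * (r + s) * (r - 2 * s) ^ 2 - (3 * s ^ 2 - p) ^ 2)"
    define stt where "stt = (st * p + s * Pt) + 3 * r ^ 2 * rt - 3 * (2 * r * rt * s + r ^ 2 * st) + 3 * s ^ 2 * st"
    have st: "s_theta q = st" unfolding st_def s_theta_def P by (simp add: r_s_z_y_x_p_def(1,2))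
    have rt: "r_theta q = rt" unfolding rt_def r_theta_def P by (simp add: r_s_z_y_x_p_def(1,2))
    have Pt: "P_theta q = 12 * Pt" unfolding P_theta_def st Pt_def P by (simp add: r_s_z_y_x_p_def(1,2) right_diff_distrib)
    have stt: "s_theta2 q = stt" unfolding s_theta2_def st rt Pt stt_def P by (simp add: r_s_z_y_x_p_def(1,2) add_divide_distrib)
    \<comment> \<open>What remains, of weight 6, once the common factor 288 s^2 is taken out; p
      cancels again.\<close>
    have key: "2 * (s * stt - 2 * st ^ 2) = - (y * z * z ^ 2)"
    proof -
      have "8 * (s * stt - 2 * st ^ 2) = - ((r + s) * (r - 3 * s) * z ^ 2)"
        unfolding stt_def Pt_def rt_def st_def z(1) by algebra
      then have "4 * (2 * (s * stt - 2 * st ^ 2)) = 4 * (- (y * z * z ^ 2))" unfolding z(2)[symmetric] by algebra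
      then show ?thesis by (simp only: mult_cancel_left) simp
    qed
    have "2 * (- 12 * s ^ 2) * (- 24 * (st * st + s * stt)) - 3 * (- 24 * (s * st)) ^ 2
        = 288 * s ^ 2 * (2 * (s * stt - 2 * st ^ 2))" by algebra
    also have "\<dots> = - 288 * s ^ 2 * (((- 12 * s ^ 2) * x) * ((- 12 * s ^ 2) * (1 - 16 * x)) ^ 2)"
      unfolding key Zx by simp
    also have "\<dots> = (- 12 * s ^ 2) ^ 4 * (24 * (x * (1 - 16 * x) ^ 2))" by algebra
    finally show ?case unfolding st stt Z_def r_s_z_y_x_p_def .
  qed
qed

lemma analytic_Z: "(\<lambda>q. - 12 * s_form q ^ 2) analytic_on {0}"
  by (rule has_theta_analytic[OF has_theta_Zstar(1)])

lemma analytic_xstar: "xstar analytic_on {0}"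
  by (rule has_theta_analytic[OF has_theta_xstar])

lemma Z_0: "- 12 * s_form 0 ^ 2 = 1"
  unfolding forms_0(3) by simp

lemma Zstar_recurrence:
  assumes v: "\<forall>\<^sub>F q in nhds 0. (\<lambda>n. v n * xstar q ^ n) sums Zstar q"
  shows "v_recurrence v"
proof -
  have sums: "\<forall>\<^sub>F q in nhds 0. (\<lambda>n. v n * xstar q ^ n) sums (- 12 * s_form q ^ 2)"
    using v Zstar_form by eventually_elim metis
  \<comment> \<open>W = (1 - 12 x)(1 - 16 x)^2, where the square comes from the logarithmic
    derivative of \<open>xstar\<close>. Its degree 3 accounts for the four terms of the
    recurrence.\<close>
  have W: "\<forall>\<^sub>F q in nhds 0. (y_log q * (1 - 16 * xstar q)) ^ 2
      = (- 12 * s_form q ^ 2) ^ 2 * poly [:1, - 44, 640, - 3072:] (xstar q)"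
    using Zstar_relations(1)
  proof eventually_elim
    case (elim q)
    have "poly [:1, - 44, 640, - 3072:] (xstar q) = (1 - 12 * xstar q) * (1 - 16 * xstar q) ^ 2"
      by (simp add: power2_eq_square algebra_simps)
    then show ?case using elim by (simp only: power_mult_distrib mult.assoc)
  qed
  have R: "\<forall>\<^sub>F q in nhds 0. 2 * (- 12 * s_form q ^ 2) * (- 24 * (s_theta q * s_theta q + s_form q * s_theta2 q))
      - 3 * (- 24 * (s_form q * s_theta q)) ^ 2 = (- 12 * s_form q ^ 2) ^ 4 * poly [:0, 24, - 768, 6144:] (xstar q)"
    using Zstar_relations(2)
  proof eventually_elim
    case (elim q)
    have "poly [:0, 24, - 768, 6144:] (xstar q) = 24 * (xstar q * (1 - 16 * xstar q) ^ 2)"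
      by (simp add: power2_eq_square algebra_simps)
    then show ?case using elim by (simp only:)
  qed
  have G: "(\<lambda>q. y_log q * (1 - 16 * xstar q)) analytic_on {0}"
    by (intro analytic_intros analytic_forms(4) analytic_xstar)
  have nz: "deriv xstar 0 \<noteq> 0" "- 12 * s_form 0 ^ 2 \<noteq> 0" "coeff [:1, - 44, 640, - 3072 :: complex:] 0 \<noteq> 0"
    unfolding Z_0 by (simp_all add: xstar_deriv_0)
  note rec = modular_recurrence(1)[OF has_theta_xstar xstar_deriv_0(2) nz(1) G has_theta_Zstar nz(2,3) W R sums]
  show ?thesis unfolding v_recurrence_def
  proof
    fix n :: nat
    define N :: complex where "N = of_nat n"
    define g where "g = (\<lambda>k. (2 * of_nat (n + 1) - of_nat k) * (of_nat (n + 1) * of_nat (n + 1 - k)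
      * coeff [:1, - 44, 640, - 3072:] k - coeff [:0, 24, - 768, 6144:] k) * v (n + 1 - k))"
    have g: "g 0 = 2 * (N + 1) ^ 3 * v (n + 1)" "g 1 = - ((2 * N + 1) * (44 * N * (N + 1) + 24)) * v n"
      by (simp_all add: g_def N_def power3_eq_cube algebra_simps)
    have g2: "g 2 = 2 * N * (640 * (N + 1) * (N - 1) + 768) * v (n - 1)" if "2 \<le> n + 1"
    proof -
      have n: "n + 1 - 2 = n - 1" "(of_nat (n - 1) :: complex) = N - 1" "(of_nat (n + 1) :: complex) = N + 1"
        using that by (simp_all add: N_def of_nat_diff)
      have c: "coeff [:1, - 44, 640, - 3072 :: complex:] 2 = 640" "coeff [:0, 24, - 768, 6144 :: complex:] 2 = - 768"
        by (simp_all add: numeral_2_eq_2)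
      show ?thesis unfolding g_def n c of_nat_numeral by (simp add: algebra_simps)
    qed
    have g3: "g 3 = (2 * N - 1) * (- 3072 * (N + 1) * (N - 2) - 6144) * v (n - 2)" if "3 \<le> n + 1"
    proof -
      have n: "n + 1 - 3 = n - 2" "(of_nat (n - 2) :: complex) = N - 2" "(of_nat (n + 1) :: complex) = N + 1"
        using that by (simp_all add: N_def of_nat_diff)
      have c: "coeff [:1, - 44, 640, - 3072 :: complex:] 3 = - 3072" "coeff [:0, 24, - 768, 6144 :: complex:] 3 = 6144"
        by (simp_all add: numeral_3_eq_3)
      show ?thesis unfolding g_def n c of_nat_numeral by (simp add: algebra_simps)
    qed
    have "g k = 0" if "k > 3" for k using that by (simp add: g_def coeff_eq_0)
    from sum_upto_3[of g, OF this, of "n + 1"] rec[of "n + 1"]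
    have "g 0 + g 1 + (if 2 \<le> n + 1 then g 2 else 0) + (if 3 \<le> n + 1 then g 3 else 0) = 0"
      unfolding g_def[symmetric] by simp
    \<comment> \<open>The condition fails only for n = 0, where the factor N vanishes.\<close>
    moreover have "(if 2 \<le> n + 1 then g 2 else 0) = 2 * N * (640 * (N + 1) * (N - 1) + 768) * v (n - 1)"
      using g2 by (auto simp: N_def)
    \<comment> \<open>Because (N + 1)(N - 2) + 2 = N (N - 1), the coefficient vanishes for n = 0 and
      n = 1, exactly where the subtraction n - 2 is truncated.\<close>
    moreover have "(if 3 \<le> n + 1 then g 3 else 0) = - 3072 * (2 * N - 1) * (N * (N - 1)) * v (n - 2)"
    proof -
      have "(2 * N - 1) * (- 3072 * (N + 1) * (N - 2) - 6144) = - 3072 * (2 * N - 1) * (N * (N - 1))" by algebra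
      moreover have "N * (N - 1) = 0" if "\<not> 3 \<le> n + 1"
      proof -
        from that have "n = 0 \<or> n = 1" by auto
        then show ?thesis by (auto simp: N_def)
      qed
      ultimately show ?thesis using g3 by auto
    qed
    ultimately have "2 * ((N + 1) ^ 3 * v (n + 1)) = 2 * ((2 * N + 1) * (22 * N ^ 2 + 22 * N + 12) * v n
       - 128 * N * (5 * N ^ 2 + 1) * v (n - 1) + 1536 * N * (N - 1) * (2 * N - 1) * v (n - 2))"
      unfolding g by algebra
    then have "(N + 1) ^ 3 * v (n + 1) = (2 * N + 1) * (22 * N ^ 2 + 22 * N + 12) * v n
       - 128 * N * (5 * N ^ 2 + 1) * v (n - 1) + 1536 * N * (N - 1) * (2 * N - 1) * v (n - 2)"
      by (simp only: mult_cancel_left) simp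
    then show "(of_nat n + 1) ^ 3 * v (n + 1) =
       (2 * of_nat n + 1) * (22 * of_nat n ^ 2 + 22 * of_nat n + 12) * v n
       - 128 * of_nat n * (5 * of_nat n ^ 2 + 1) * v (n - 1)
       + 1536 * of_nat n * (of_nat n - 1) * (2 * of_nat n - 1) * v (n - 2)"
      unfolding N_def .
  qed
qed

section \<open>The hypergeometric parameter x (1 - 16 x)^2\<close>

definition hyp_coeff :: "nat \<Rightarrow> complex" where
  "hyp_coeff n = of_nat (((3 * n) choose n) * ((2 * n) choose n) ^ 2)"

text \<open>As the quotient (3n)! (2n)! / n!^5 the coefficient has a ratio of successive terms that
  can be read off from factorials.\<close>

lemma hyp_coeff_fact: "hyp_coeff n * fact n ^ 5 = fact (3 * n) * fact (2 * n)"
proof -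
  have "fact n * fact (2 * n) * ((3 * n) choose n) = (fact (3 * n) :: nat)"
    using binomial_fact_lemma[of n "3 * n"] by simp
  from arg_cong[OF this, of "of_nat :: nat \<Rightarrow> complex"]
  have a: "of_nat ((3 * n) choose n) * (fact n * fact (2 * n)) = (fact (3 * n) :: complex)"
    by (simp only: of_nat_mult of_nat_fact mult_ac)
  have "fact n * fact n * ((2 * n) choose n) = (fact (2 * n) :: nat)"
    using binomial_fact_lemma[of n "2 * n"] by simp
  from arg_cong[OF this, of "of_nat :: nat \<Rightarrow> complex"]
  have b: "of_nat ((2 * n) choose n) * (fact n * fact n) = (fact (2 * n) :: complex)"
    by (simp only: of_nat_mult of_nat_fact mult_ac)
  define A B c :: complex where "A = of_nat ((3 * n) choose n)" "B = of_nat ((2 * n) choose n)" "c = fact n"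
  have "hyp_coeff n * fact n ^ 5 * fact (2 * n) = (A * (c * fact (2 * n))) * (B * (c * c)) ^ 2"
    unfolding hyp_coeff_def of_nat_mult of_nat_power A_B_c_def by (simp add: eval_nat_numeral mult_ac)
  also have "\<dots> = fact (3 * n) * fact (2 * n) * fact (2 * n)"
    unfolding A_B_c_def a b by (simp add: power2_eq_square)
  finally show ?thesis by simp
qed

lemma hyp_coeff_Suc:
  "(of_nat n + 1) ^ 3 * hyp_coeff (Suc n) = 6 * (2 * of_nat n + 1) * (3 * of_nat n + 1) * (3 * of_nat n + 2) * hyp_coeff n"
proof -
  define N :: complex where "N = of_nat n"
  have nz: "N + 1 \<noteq> 0" "(fact n :: complex) \<noteq> 0" using of_nat_Suc_neq_0 by (auto simp: N_def)
  have f3: "(fact (3 * Suc n) :: complex) = (3 * N + 3) * (3 * N + 2) * (3 * N + 1) * fact (3 * n)"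
  proof -
    have "3 * Suc n = Suc (Suc (Suc (3 * n)))" by simp
    then show ?thesis by (simp only: fact_Suc of_nat_Suc) (simp add: N_def algebra_simps)
  qed
  have f2: "(fact (2 * Suc n) :: complex) = (2 * N + 2) * (2 * N + 1) * fact (2 * n)"
  proof -
    have "2 * Suc n = Suc (Suc (2 * n))" by simp
    then show ?thesis by (simp only: fact_Suc of_nat_Suc) (simp add: N_def algebra_simps)
  qed
  have "hyp_coeff (Suc n) * ((N + 1) * fact n) ^ 5
      = (3 * N + 3) * (3 * N + 2) * (3 * N + 1) * fact (3 * n) * ((2 * N + 2) * (2 * N + 1) * fact (2 * n))"
    using hyp_coeff_fact[of "Suc n"] unfolding f3 f2 by (simp add: N_def add.commute)
  moreover note hyp_coeff_fact[of n]
  ultimately have "(N + 1) ^ 2 * fact n ^ 5 * ((N + 1) ^ 3 * hyp_coeff (Suc n))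
      = (N + 1) ^ 2 * fact n ^ 5 * (6 * (2 * N + 1) * (3 * N + 1) * (3 * N + 2) * hyp_coeff n)"
    by algebra
  then show ?thesis using nz unfolding N_def by simp
qed

text \<open>In \<open>Zstar_relations\<close> R is already 24 x (1 - 16 x)^2, so X = x (1 - 16 x)^2
  makes it linear. X has logarithmic derivative \<open>y_log\<close> times 1 - 48 x, and W becomes
  linear in X as well. The recurrence then has two terms, that is, the series is
  hypergeometric.\<close>

lemma Zstar_hypergeometric:
  "\<forall>\<^sub>F q in nhds 0. (\<lambda>n. hyp_coeff n * (xstar q * (1 - 16 * xstar q) ^ 2) ^ n) sums Zstar q"
proof -
  define X where "X = (\<lambda>q. xstar q * (1 - 16 * xstar q) ^ 2)"
  have X: "has_theta X (\<lambda>q. X q * (y_log q * (1 - 48 * xstar q)))"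
    unfolding has_theta_def using has_theta_xstar[unfolded has_theta_def]
  proof eventually_elim
    case (elim q)
    have "theta_at X q (xstar q * (y_log q * (1 - 16 * xstar q)) * (1 - 16 * xstar q) ^ 2
       + xstar q * (of_nat 2 * (1 - 16 * xstar q) ^ (2 - 1)
           * (0 - (0 * xstar q + 16 * (xstar q * (y_log q * (1 - 16 * xstar q)))))))"
      unfolding X_def by (intro theta_at_mult theta_at_power theta_at_diff theta_at_const elim)
    moreover have "xstar q * (y_log q * (1 - 16 * xstar q)) * (1 - 16 * xstar q) ^ 2
       + xstar q * (of_nat 2 * (1 - 16 * xstar q) ^ (2 - 1)
           * (0 - (0 * xstar q + 16 * (xstar q * (y_log q * (1 - 16 * xstar q)))))) = X q * (y_log q * (1 - 48 * xstar q))"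
      unfolding X_def by simp algebra
    ultimately show ?case by simp
  qed
  have X0: "X 0 = 0" by (simp add: X_def xstar_deriv_0)
  have DX: "deriv X 0 \<noteq> 0"
  proof -
    have "xstar field_differentiable at 0" using analytic_xstar analytic_on_imp_differentiable_at by blast
    then have d: "(xstar has_field_derivative 1) (at 0)"
      using field_differentiable_derivI xstar_deriv_0(1) by metis
    have "((\<lambda>q. (1 - 16 * xstar q) ^ 2) has_field_derivative of_nat 2 * ((0 - 16 * 1) * (1 - 16 * xstar 0) ^ (2 - Suc 0))) (at 0)"
      by (intro DERIV_power DERIV_diff DERIV_const DERIV_cmult d)
    from DERIV_mult[OF d this] have "(X has_field_derivative 1) (at 0)"
      unfolding X_def by (simp add: xstar_deriv_0)
    then show ?thesis using DERIV_imp_deriv by fastforce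
  qed
  obtain w where w: "\<forall>\<^sub>F q in nhds 0. (\<lambda>n. w n * X q ^ n) sums (- 12 * s_form q ^ 2)"
    using exists_expansion_in_parameter[OF analytic_Z has_theta_analytic[OF X] X0 DX] by blast
  have W: "\<forall>\<^sub>F q in nhds 0. (y_log q * (1 - 48 * xstar q)) ^ 2 = (- 12 * s_form q ^ 2) ^ 2 * poly [:1, - 108:] (X q)"
    using Zstar_relations(1)
  proof eventually_elim
    case (elim q)
    \<comment> \<open>The polynomial 1 - 108 x (1 - 16 x)^2 has the double root x = 1/48, the
      critical point of X.\<close>
    have "poly [:1, - 108:] (X q) = (1 - 12 * xstar q) * (1 - 48 * xstar q) ^ 2"
      by (simp add: X_def power2_eq_square algebra_simps)
    then show ?case using elim by (simp only: power_mult_distrib mult.assoc)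
  qed
  have R: "\<forall>\<^sub>F q in nhds 0. 2 * (- 12 * s_form q ^ 2) * (- 24 * (s_theta q * s_theta q + s_form q * s_theta2 q))
      - 3 * (- 24 * (s_form q * s_theta q)) ^ 2 = (- 12 * s_form q ^ 2) ^ 4 * poly [:0, 24:] (X q)"
    using Zstar_relations(2)
  proof eventually_elim
    case (elim q)
    have "poly [:0, 24:] (X q) = 24 * (xstar q * (1 - 16 * xstar q) ^ 2)"
      by (simp add: X_def)
    then show ?case using elim by (simp only:)
  qed
  have G: "(\<lambda>q. y_log q * (1 - 48 * xstar q)) analytic_on {0}"
    by (intro analytic_intros analytic_forms(4) analytic_xstar)
  have nz: "- 12 * s_form 0 ^ 2 \<noteq> 0" "coeff [:1, - 108 :: complex:] 0 \<noteq> 0"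
    unfolding Z_0 by simp_all
  note rec = modular_recurrence[OF X X0 DX G has_theta_Zstar nz W R w]
  have "w n = hyp_coeff n" for n
  proof (induction n)
    case 0
    then show ?case using rec(2) unfolding Z_0 by (simp add: hyp_coeff_def)
  next
    case (Suc n)
    define N :: complex where "N = of_nat n"
    have nz: "N + 1 \<noteq> 0" using of_nat_Suc_neq_0 by (auto simp: N_def)
    define g where "g = (\<lambda>k. (2 * of_nat (Suc n) - of_nat k) * (of_nat (Suc n) * of_nat (Suc n - k)
      * coeff [:1, - 108:] k - coeff [:0, 24:] k) * w (Suc n - k))"
    have g: "g 0 = 2 * (N + 1) ^ 3 * w (Suc n)" "g 1 = - ((2 * N + 1) * (108 * N * (N + 1) + 24)) * w n" "g 2 = 0" "g 3 = 0"
      by (simp_all add: g_def N_def power3_eq_cube numeral_2_eq_2 numeral_3_eq_3 algebra_simps)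
    have "g k = 0" if "k > 3" for k using that by (simp add: g_def coeff_eq_0)
    from sum_upto_3[of g, OF this, of "Suc n"] rec(1)[of "Suc n"]
    have "2 * (N + 1) ^ 3 * w (Suc n) - (2 * N + 1) * (108 * N * (N + 1) + 24) * hyp_coeff n = 0"
      unfolding g_def[symmetric] g Suc by simp
    moreover have "(N + 1) ^ 3 * hyp_coeff (Suc n) = 6 * (2 * N + 1) * (3 * N + 1) * (3 * N + 2) * hyp_coeff n"
      using hyp_coeff_Suc[of n] by (simp add: N_def)
    ultimately have "2 * (N + 1) ^ 3 * (w (Suc n) - hyp_coeff (Suc n)) = 0" by algebra
    then show ?case using nz by simp
  qed
  with w have "\<forall>\<^sub>F q in nhds 0. (\<lambda>n. hyp_coeff n * X q ^ n) sums (- 12 * s_form q ^ 2)" by simp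
  then show ?thesis using Zstar_form unfolding X_def by eventually_elim metis
qed

theorem theorem6p6:
  shows "(\<exists>v :: nat \<Rightarrow> complex. \<forall>\<^sub>F q in nhds 0.
            Zstar q = (3 * eisP (q ^ 3) - eisP q) / 2 \<and>
            (\<lambda>n. v n * xstar q ^ n) sums Zstar q \<and>
            (\<lambda>n. (-1) ^ n * of_nat (domb n) * (xstar q ^ n / (1 - 16 * xstar q) ^ (n + 1)))
              sums Zstar q \<and>
            (\<lambda>n. of_nat (((3 * n) choose n) * ((2 * n) choose n) ^ 2)
                   * xstar q ^ n * (1 - 16 * xstar q) ^ (2 * n))
              sums Zstar q)
       \<and> (\<forall>v :: nat \<Rightarrow> complex.
            (\<forall>\<^sub>F q in nhds 0. (\<lambda>n. v n * xstar q ^ n) sums Zstar q) \<longrightarrow> v_recurrence v)"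
proof (intro conjI allI impI)
  obtain v where "\<forall>\<^sub>F q in nhds 0. (\<lambda>n. v n * xstar q ^ n) sums (- 12 * s_form q ^ 2)"
    using exists_expansion_in_parameter[OF analytic_Z analytic_xstar xstar_deriv_0(2)] xstar_deriv_0(1) by auto
  then have "\<forall>\<^sub>F q in nhds 0. Zstar q = (3 * eisP (q ^ 3) - eisP q) / 2 \<and>
            (\<lambda>n. v n * xstar q ^ n) sums Zstar q \<and>
            (\<lambda>n. (-1) ^ n * of_nat (domb n) * (xstar q ^ n / (1 - 16 * xstar q) ^ (n + 1)))
              sums Zstar q \<and>
            (\<lambda>n. of_nat (((3 * n) choose n) * ((2 * n) choose n) ^ 2)
                   * xstar q ^ n * (1 - 16 * xstar q) ^ (2 * n))
              sums Zstar q"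
    using Zstar_form z6_domb Zstar_hypergeometric y6_small eventually_unit_disc
  proof eventually_elim
    case (elim q)
    have Z: "Zstar q = - 12 * s_form q ^ 2" using elim(2) by blast
    \<comment> \<open>3 P(q^3) = P - 24 s^2, so P cancels and -12 s^2 remains.\<close>
    have "Zstar q = (3 * eisP (q ^ 3) - eisP q) / 2"
      unfolding Z eisP_multiples(2)[OF elim(6)] by (simp add: diff_divide_distrib)
    moreover have "(\<lambda>n. v n * xstar q ^ n) sums Zstar q" unfolding Z by (rule elim(1))
    moreover have "(\<lambda>n. (-1) ^ n * of_nat (domb n) * (xstar q ^ n / (1 - 16 * xstar q) ^ (n + 1))) sums Zstar q"
    proof -
      \<comment> \<open>As 1 / (1 - 16 x) = 1 + 16 y, the series is the Domb expansion of z in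
        powers of y multiplied by 1 + 16 y.\<close>
      have "xstar q ^ n / (1 - 16 * xstar q) ^ (n + 1) = y6 q ^ n * (1 + 16 * y6 q)" for n
        unfolding xstar_y6[OF elim(5)] unfolding xstar_def using elim(5) by (simp add: power_divide)
      then show ?thesis
        using sums_mult2[OF elim(3), of "1 + 16 * y6 q"] by (simp add: Zstar_def mult_ac)
    qed
    moreover have "(\<lambda>n. of_nat (((3 * n) choose n) * ((2 * n) choose n) ^ 2)
        * xstar q ^ n * (1 - 16 * xstar q) ^ (2 * n)) sums Zstar q"
      using elim(4) by (simp only: hyp_coeff_def power_mult_distrib power_mult[symmetric] mult.assoc)
    ultimately show ?case by blast
  qed
  then show "\<exists>v :: nat \<Rightarrow> complex. \<forall>\<^sub>F q in nhds 0.
            Zstar q = (3 * eisP (q ^ 3) - eisP q) / 2 \<and>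
            (\<lambda>n. v n * xstar q ^ n) sums Zstar q \<and>
            (\<lambda>n. (-1) ^ n * of_nat (domb n) * (xstar q ^ n / (1 - 16 * xstar q) ^ (n + 1)))
              sums Zstar q \<and>
            (\<lambda>n. of_nat (((3 * n) choose n) * ((2 * n) choose n) ^ 2)
                   * xstar q ^ n * (1 - 16 * xstar q) ^ (2 * n))
              sums Zstar q" by blast
qed (rule Zstar_recurrence)

end
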